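(* Let $d, k \in \mathbb{N}$ with $1<k<d$. Let $\Omega$ be a bounded Lipschitz domain in $\mathbb{R}^{d}$, and let $K \subset \Omega$ be a smooth compact set of class $C^{0,1}$ of codimension $k$ (in the sense defined in the context). Let $p>1$ and $s \in (0,1)$ be such that $sp=d$. Then there exists $\alpha_{*}=\alpha_{*}(d,s,k,\Omega,K)>0$ such that $$\sup_{u \in \widetilde{W}^{s,p}_{0}(\Omega \setminus K),\ [u]_{W^{s,p}(\mathbb{R}^{d})} \leq 1} \int_{\Omega} \Phi_{d,s}\left(\alpha |u(x)|^{\frac{d}{d-s}}\right) \frac{dx}{\delta_{K}^{d}(x)} < \infty, \qquad \forall\ \alpha \in [0,\alpha_{*}).$$ Furthermore, the inequality $$\sup_{u \in \widetilde{W}^{s,p}_{0}(\Omega \setminus K),\ [u]_{W^{s,p}(\mathbb{R}^{d})} \leq 1} \int_{\Omega} \Phi_{d,s}\left(\alpha |u(x)|^{\frac{d}{d-s}}\right) \frac{dx}{\delta_{K}^{d}(x)} < \infty$$ fails (i.e. the supremum equals $+\infty$) for every $\alpha > \alpha^{*}_{s,d}$, where $$\alpha^{*}_{s,d} := d \left( \frac{2 (d\omega_{d})^{2}\, \Gamma(p+1)}{d!} \sum_{n=0}^{\infty} \frac{(d+n-1)!}{n!} \frac{1}{(d+2n)^{p}} \right)^{\frac{s}{d-s}}$$ and $\omega_{d}$ denotes the volume of the unit ball in $\mathbb{R}^{d}$.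
   Context: Distance: for $K \subset \Omega$ compact and $x \in \Omega$, $\delta_{K}(x) := \inf_{y \in K}|x-y|$. Smooth compact set of class $C^{0,1}$ of codimension $k$: let $k \in \mathbb{N}$, $1<k<d$, and let $Q = B^{k}_{1}(0) \times (0,1)^{d-k}$, where $B^{k}_{1}(0) \subset \mathbb{R}^{k}$ is the unit ball centred at $0$; write $\xi = (\xi_{k},\xi_{d-k}) \in Q$ with $\xi_{k} \in B^{k}_{1}(0)$, $\xi_{d-k} \in (0,1)^{d-k}$. A compact surface $K \subset \Omega$ of codimension $k$ in $\mathbb{R}^{d}$ is of class $C^{0,1}$ if there exists $C>0$ such that for every $x \in K$ there exist a ball $B = B_{r}(x) \subset \mathbb{R}^{d}$, $r>0$, and an isomorphism (bijection) $T: Q \to B$ such that $T \in C^{0,1}(\overline{Q})$, $T^{-1} \in C^{0,1}(\overline{B})$, $\|T\|_{C^{0,1}(\overline{Q})} + \|T^{-1}\|_{C^{0,1}(\overline{B})} \leq C$, and $T^{-1}(B \cap K) = \{(\xi_{k},\xi_{d-k}) \in Q : \xi_{k}=0\}$; moreover, for any $y \in (\Omega \setminus K) \cap B$ with $y = T((\xi_{k},\xi_{d-k}))$ one has $\delta_{K}(y) \sim |\xi_{k}|$, i.e. $C_{1}|\xi_{k}| \leq \delta_{K}(y) \leq C_{2}|\xi_{k}|$ for some $C_{1},C_{2}>0$ very close to $1$. Function spaces: for an open set $U \subset \mathbb{R}^{d}$, $[u]_{W^{s,p}(U)} = \left( \int_{U}\int_{U} \frac{|u(x)-u(y)|^{p}}{|x-y|^{d+sp}}\,dx\,dy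 \right)^{1/p}$ and $\|u\|_{W^{s,p}(U)} = \left([u]^{p}_{W^{s,p}(U)} + \|u\|^{p}_{L^{p}(U)}\right)^{1/p}$. $W^{s,p}_{0}(\Omega \setminus K)$ is the closure of $C^{\infty}_{c}(\Omega \setminus K)$ with respect to $\|\cdot\|_{W^{s,p}(\Omega)}$. For $u \in W^{s,p}_{0}(\Omega \setminus K)$, its zero extension $\widetilde{u}: \mathbb{R}^{d} \to \mathbb{R}$ is $\widetilde{u}(x) = u(x)$ for $x \in \Omega \setminus K$ and $\widetilde{u}(x)=0$ for $x \in (\mathbb{R}^{d} \setminus \Omega) \cup K$. Define $\widetilde{W}^{s,p}_{0}(\Omega \setminus K) := \{\widetilde{u} : u \in W^{s,p}_{0}(\Omega \setminus K)\}$. The function $\Phi_{d,s}$: $\Phi_{d,s}(t) := \exp(t) - \sum_{i=0}^{j_{p}-2} \frac{t^{i}}{i!}$, where $j_{p} = \min\{j \in \mathbb{N} : j \geq p\}$ (and $p = d/s$). *)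

theory Defs
  imports "HOL-Analysis.Analysis"
begin

section \<open>Domains\<close>

text \<open>Locally, after a rigid motion, the set is the strict epigraph of a Lipschitz function
  on the hyperplane orthogonal to a unit vector \<open>e\<close>.\<close>

definition Lipschitz_boundary :: "(real^'d) set \<Rightarrow> bool" where
  "Lipschitz_boundary \<Omega> \<longleftrightarrow>
     (\<forall>x\<in>frontier \<Omega>. \<exists>r>0. \<exists>e \<gamma> L. norm e = 1 \<and> L-lipschitz_on {v. v \<bullet> e = 0} \<gamma> \<and>
        (\<forall>y\<in>ball x r. y \<in> \<Omega> \<longleftrightarrow> \<gamma> (y - (y \<bullet> e) *\<^sub>R e) < y \<bullet> e))"

definition bounded_Lipschitz_domain :: "(real^'d) set \<Rightarrow> bool" where
  "bounded_Lipschitz_domain \<Omega> \<longleftrightarrow>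
     open \<Omega> \<and> connected \<Omega> \<and> \<Omega> \<noteq> {} \<and> bounded \<Omega> \<and> Lipschitz_boundary \<Omega>"


section \<open>Compact sets of class \<open>C\<^sup>0\<^sup>,\<^sup>1\<close> and codimension \<open>k\<close>\<close>

definition in_C01 :: "'a::real_normed_vector set \<Rightarrow> ('a \<Rightarrow> 'b::real_normed_vector) \<Rightarrow> bool" where
  "in_C01 S f \<longleftrightarrow> bounded (f ` S) \<and> (\<exists>L. L-lipschitz_on S f)"

text \<open>Supremum norm plus Lipschitz seminorm; only meaningful for \<open>in_C01 S f\<close> and for
  \<open>S\<close> with at least two points.\<close>

definition C01_norm :: "'a::real_normed_vector set \<Rightarrow> ('a \<Rightarrow> 'b::real_normed_vector) \<Rightarrow> real" where
  "C01_norm S f = (SUP x\<in>S. norm (f x)) +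
     (SUP (x, y)\<in>{(x, y). x \<in> S \<and> y \<in> S \<and> x \<noteq> y}. norm (f x - f y) / norm (x - y))"

text \<open>The splitting \<open>\<xi> = (\<xi>\<^sub>k, \<xi>\<^sub>d\<^sub>-\<^sub>k)\<close> is encoded by a set \<open>J\<close> of \<open>k\<close> coordinate indices:
  \<open>\<xi>\<^sub>k\<close> consists of the coordinates in \<open>J\<close> and \<open>L2_set (($) \<xi>) J\<close> is its Euclidean norm.
  The set below is then the product of the unit ball in the \<open>J\<close>-coordinates and the
  open unit cube in the others.\<close>

definition model_domain :: "'d set \<Rightarrow> (real^'d) set" where
  "model_domain J = {\<xi>. L2_set (($) \<xi>) J < 1 \<and> (\<forall>i. i \<notin> J \<longrightarrow> 0 < \<xi> $ i \<and> \<xi> $ i < 1)}"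

text \<open>\<open>T\<close> and \<open>T'\<close> (the inverse of \<open>T\<close>) are considered together with their continuous
  extensions to the closures of \<open>Q\<close> and of the ball.\<close>

definition C01_codim :: "nat \<Rightarrow> (real^'d) set \<Rightarrow> (real^'d) set \<Rightarrow> bool" where
  "C01_codim k \<Omega> K \<longleftrightarrow>
     (\<exists>J::'d set. card J = k \<and>
       (let Q = model_domain J in
         \<exists>C>0. \<forall>x\<in>K. \<exists>r>0. \<exists>(T :: real^'d \<Rightarrow> real^'d) T'.
           (let B = ball x r in
              bij_betw T Q B \<and> (\<forall>\<xi>\<in>Q. T' (T \<xi>) = \<xi>) \<and>
              in_C01 (closure Q) T \<and> in_C01 (closure B) T' \<and>
              C01_norm (closure Q) T + C01_norm (closure B) T' \<le> C \<and>
              {\<xi>\<in>Q. T \<xi> \<in> B \<inter> K} = {\<xi>\<in>Q. \<forall>i\<in>J. \<xi> $ i = 0} \<and>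
              (\<exists>C1>0. \<exists>C2>0. \<forall>\<xi>\<in>Q. T \<xi> \<in> (\<Omega> - K) \<inter> B \<longrightarrow>
                 C1 * L2_set (($) \<xi>) J \<le> infdist (T \<xi>) K \<and>
                 infdist (T \<xi>) K \<le> C2 * L2_set (($) \<xi>) J))))"


section \<open>Test functions\<close>

primrec Ck :: "nat \<Rightarrow> ('a::euclidean_space \<Rightarrow> real) \<Rightarrow> bool" where
  "Ck 0 f \<longleftrightarrow> continuous_on UNIV f"
| "Ck (Suc n) f \<longleftrightarrow> (\<forall>x. f differentiable (at x)) \<and>
     (\<forall>v. Ck n (\<lambda>x. frechet_derivative f (at x) v))"

text \<open>Functions in \<open>C\<^sub>c\<^sup>\<infinity>(U)\<close>, for open \<open>U\<close>, are extended by zero to the whole space.\<close>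

definition Cc_infinity :: "'a::euclidean_space set \<Rightarrow> ('a \<Rightarrow> real) set" where
  "Cc_infinity U = {f. (\<forall>n. Ck n f) \<and>
     compact (closure {x. f x \<noteq> 0}) \<and> closure {x. f x \<noteq> 0} \<subseteq> U}"


section \<open>Fractional Sobolev spaces\<close>

text \<open>Real powers with a positive exponent on the extended nonnegative reals.\<close>

definition epowr :: "ennreal \<Rightarrow> real \<Rightarrow> ennreal" where
  "epowr x a = (if x = \<infinity> then \<infinity> else ennreal (enn2real x powr a))"

definition Wsp_seminorm :: "real \<Rightarrow> real \<Rightarrow> (real^'d) set \<Rightarrow> (real^'d \<Rightarrow> real) \<Rightarrow> ennreal" where
  "Wsp_seminorm s p U u =
     epowr (\<integral>\<^sup>+x\<in>U. (\<integral>\<^sup>+y\<in>U.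
              ennreal (\<bar>u x - u y\<bar> powr p / norm (x - y) powr (real CARD('d) + s * p))
            \<partial>lebesgue) \<partial>lebesgue) (1 / p)"

definition Lp_norm :: "real \<Rightarrow> (real^'d) set \<Rightarrow> (real^'d \<Rightarrow> real) \<Rightarrow> ennreal" where
  "Lp_norm p U u = epowr (\<integral>\<^sup>+x\<in>U. ennreal (\<bar>u x\<bar> powr p) \<partial>lebesgue) (1 / p)"

definition Wsp_norm :: "real \<Rightarrow> real \<Rightarrow> (real^'d) set \<Rightarrow> (real^'d \<Rightarrow> real) \<Rightarrow> ennreal" where
  "Wsp_norm s p U u = epowr (epowr (Wsp_seminorm s p U u) p + epowr (Lp_norm p U u) p) (1 / p)"

text \<open>Elements are functions rather than classes modulo null sets; values outside \<open>U\<close>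
  are irrelevant.\<close>

definition Wsp :: "real \<Rightarrow> real \<Rightarrow> (real^'d) set \<Rightarrow> (real^'d \<Rightarrow> real) set" where
  "Wsp s p U = {u \<in> borel_measurable (lebesgue_on U). Wsp_norm s p U u < \<infinity>}"

text \<open>The closure of \<open>C\<^sub>c\<^sup>\<infinity>(\<Omega> - K)\<close> with respect to the norm on \<open>\<Omega>\<close> (not on \<open>\<Omega> - K\<close>).\<close>

definition Wsp0 :: "real \<Rightarrow> real \<Rightarrow> (real^'d) set \<Rightarrow> (real^'d) set \<Rightarrow> (real^'d \<Rightarrow> real) set" where
  "Wsp0 s p \<Omega> K = {u \<in> Wsp s p \<Omega>.
     \<forall>\<epsilon>>0. \<exists>\<phi>\<in>Cc_infinity (\<Omega> - K). Wsp_norm s p \<Omega> (\<lambda>x. u x - \<phi> x) < ennreal \<epsilon>}"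

definition zero_ext :: "(real^'d) set \<Rightarrow> (real^'d) set \<Rightarrow> (real^'d \<Rightarrow> real) \<Rightarrow> real^'d \<Rightarrow> real" where
  "zero_ext \<Omega> K u = (\<lambda>x. if x \<in> \<Omega> - K then u x else 0)"

definition Wsp0_tilde :: "real \<Rightarrow> real \<Rightarrow> (real^'d) set \<Rightarrow> (real^'d) set \<Rightarrow> (real^'d \<Rightarrow> real) set" where
  "Wsp0_tilde s p \<Omega> K = zero_ext \<Omega> K ` Wsp0 s p \<Omega> K"


section \<open>The Trudinger--Moser functional\<close>

definition Phi :: "nat \<Rightarrow> real \<Rightarrow> real \<Rightarrow> real" where
  "Phi d s t = (let jp = (LEAST j::nat. real j \<ge> real d / s)
                in exp t - (\<Sum>i=0..jp - 2. t ^ i / fact i))"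

text \<open>For \<open>K\<close> nonempty, \<open>infdist x K\<close> is \<open>\<delta>\<^sub>K(x)\<close>. On \<open>K\<close> itself the weight is \<open>1 / 0 = 0\<close>;
  all admissible \<open>u\<close> vanish there and \<open>Phi d s 0 = 0\<close>, so this convention is harmless.\<close>

definition TM_integral ::
  "real \<Rightarrow> real \<Rightarrow> (real^'d) set \<Rightarrow> (real^'d) set \<Rightarrow> (real^'d \<Rightarrow> real) \<Rightarrow> ennreal" where
  "TM_integral s \<alpha> \<Omega> K u =
     (let d = CARD('d) in
      \<integral>\<^sup>+x\<in>\<Omega>. ennreal (Phi d s (\<alpha> * \<bar>u x\<bar> powr (real d / (real d - s))) / infdist x K ^ d)
      \<partial>lebesgue)"

definition TM_sup :: "real \<Rightarrow> real \<Rightarrow> real \<Rightarrow> (real^'d) set \<Rightarrow> (real^'d) set \<Rightarrow> ennreal" where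
  "TM_sup s p \<alpha> \<Omega> K =
     (SUP u\<in>{u \<in> Wsp0_tilde s p \<Omega> K. Wsp_seminorm s p UNIV u \<le> 1}. TM_integral s \<alpha> \<Omega> K u)"

definition alpha_upper :: "nat \<Rightarrow> real \<Rightarrow> real" where
  "alpha_upper d s =
     (let p = real d / s in
      real d * (2 * (real d * unit_ball_vol (real d))\<^sup>2 * Gamma (p + 1) / fact d *
        (\<Sum>n. fact (d + n - 1) / fact n * (1 / real (d + 2 * n) powr p)))
      powr (s / (real d - s)))"

end

theory Submission
  imports Defs
begin

text \<open>Write \<open>d\<close> for the dimension, \<open>\<delta>\<close> for the distance to \<open>K\<close>, \<open>p' = p / (p - 1) = d / (d - s)\<close>, and
  \<open>k(x, y) = |u x - u y|\<^sup>p / |x - y|\<^sup>2\<^sup>d\<close>; as \<open>s p = d\<close>, the \<open>p\<close>-th power of the seminorm is the integral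
  of \<open>k\<close>, and it is invariant under dilations.

  Finiteness for small \<open>\<alpha>\<close>. Put \<open>g(x) = \<integral>k(x, y) dy\<close>, so that \<open>g\<close> has integral at most 1, and
  consider the dyadic annuli \<open>A\<^sub>n\<close> around \<open>x\<close> with outer radii \<open>2\<^sup>-\<^sup>n \<delta>(x)\<close>. The products
  \<open>A\<^sub>n\<^sub>+\<^sub>1 \<times> A\<^sub>n\<close> are disjoint, so the \<open>p\<close>-th powers of the increments of the means of \<open>|u|\<close> along the annuli
  have a bounded sum, and \<open>N\<close> steps change the mean by at most a multiple of \<open>N\<^sup>1\<^sup>/\<^sup>p\<^sup>'\<close> (\<open>chained_means\<close>).
  Moreover \<open>|u x|\<close> exceeds the mean over \<open>A\<^sub>N\<close> by at most a constant as soon as \<open>2\<^sup>N\<^sup>d \<ge> \<delta>\<^sup>d g(x)\<close>. Hence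
  \<open>|u x|\<close> is at most of the order of the \<open>1/p'\<close>-th power of \<open>1 + log(max 1 (\<delta>\<^sup>d g(x)))\<close> (\<open>growth_bound\<close>), and for small
  \<open>\<alpha>\<close> one gets \<open>\<Phi>(\<alpha> |u|\<^sup>p\<^sup>') \<le> C (|u|\<^sup>p + \<delta>\<^sup>d g)\<close> pointwise (\<open>Phi_growth\<close>). After division by \<open>\<delta>\<^sup>d\<close> the second term
  has integral at most \<open>C\<close>, and the first is controlled by the Hardy inequality
  \<open>\<integral>|u|\<^sup>p / \<delta>\<^sup>d \<le> C\<close> (\<open>hardy_Wsp0_tilde\<close>). The Hardy inequality compares \<open>u x\<close> with the values at points
  that lie within distance \<open>3 \<delta>(x)\<close> of \<open>x\<close> but \<open>m\<close> times closer to \<open>K\<close>. Since \<open>K\<close> has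
  dimension \<open>d - k\<close>, these points have volume at least \<open>c m\<^sup>-\<^sup>k \<delta>(x)\<^sup>d\<close> (\<open>packing_C01_codim\<close>,
  \<open>emeasure_near_K\<close>), and moving the mass of \<open>|u|\<^sup>p / \<delta>\<^sup>d\<close> to them costs a factor of order \<open>m\<^sup>k\<^sup>-\<^sup>d\<close>. As \<open>k < d\<close>,
  a large \<open>m\<close> makes this factor small and the transported term is absorbed (\<open>hardy_near_compact\<close>).

  Blow-up for large \<open>\<alpha>\<close>. Around a point of \<open>\<Omega> - K\<close> take a smooth version of the logarithm
  \<open>ln(R / |x|)\<close> (with \<open>x\<close> measured from that point), cut off at height \<open>T = ln(R / a)\<close>. Its energy is at most \<open>\<gamma> T\<close>, where \<open>\<gamma>\<close> is the expression
  inside the power in the definition of the critical exponent (\<open>log_bump_energy\<close>). Normalised, its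
  \<open>p'\<close>-th power is about \<open>T / \<gamma>\<^sup>1\<^sup>/\<^sup>(\<^sup>p\<^sup>-\<^sup>1\<^sup>)\<close> on a ball of volume of order \<open>exp(- d T)\<close>, and the integral
  is unbounded in \<open>T\<close> once \<open>\<alpha> > d \<gamma>\<^sup>1\<^sup>/\<^sup>(\<^sup>p\<^sup>-\<^sup>1\<^sup>)\<close> (\<open>TM_sup_infinite_above_alpha_upper\<close>).

  The energy bound uses that a radially decreasing \<open>W\<close> with
  \<open>W y - W x \<le> ln(|x| / |y|)\<close> satisfies
  \<open>(W y - W x)\<^sup>p \<le> ln(|x| / |y|)\<^sup>p\<^sup>-\<^sup>1 (W y - W x)\<close>. Slicing the last factor by the levels of \<open>W\<close> leaves for
  every level the interaction of the two sides of one sphere, with kernel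
  \<open>ln(|x| / |y|)\<^sup>p\<^sup>-\<^sup>1 |x - y|\<^sup>-\<^sup>2\<^sup>d\<close>; by dilation invariance it does not depend on the sphere
  (\<open>gagliardo_energy_radial\<close>, \<open>log_kernel_across_sphere\<close>). To compute it, slice the logarithm too. What
  remains is the integral of \<open>|x - y|\<^sup>-\<^sup>2\<^sup>d\<close> over a ball, and since \<open>|v|\<^sup>-\<^sup>2\<^sup>d\<close> is the Jacobian of the inversion
  \<open>v \<mapsto> v / |v|\<^sup>2\<close>, this is the volume of the inverted ball
  (\<open>nn_integral_inverse_power_ball_le\<close>). Expanding that volume in the negative binomial series turns the
  remaining integrals into Gamma integrals, which yields the series in the critical exponent.\<close>

section \<open>Radial integrals\<close>

text \<open>Polar coordinates for radial functions: both measures give the half-line up to \<open>a\<close> the volume of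
  the ball of radius \<open>a\<close>.\<close>

lemma distr_norm_lborel:
  defines "d \<equiv> DIM('a)"
  shows "distr (lborel :: 'a::euclidean_space measure) borel norm =
    density lborel (\<lambda>r. ennreal (real d * unit_ball_vol d * r ^ (d - 1)) * indicator {0<..} r)"
    (is "?M = ?N")
proof (rule measure_eqI_generator_eq)
  let ?E = "range (\<lambda>a::real. {..a})"
  have d: "0 < d" by (simp add: d_def)
  show "Int_stable ?E" by (auto simp: Int_stable_def)
  show "?E \<subseteq> Pow UNIV" by simp
  show "sets ?M = sigma_sets UNIV ?E" "sets ?N = sigma_sets UNIV ?E"
    by (simp_all add: borel_eq_atMost)
  have M: "emeasure ?M {..a} = ennreal (if 0 \<le> a then unit_ball_vol d * a ^ d else 0)" for a
  proof -
    have "emeasure ?M {..a} = emeasure lborel (norm -` {..a} \<inter> space (lborel :: 'a measure))"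
      by (subst emeasure_distr) auto
    also have "norm -` {..a} \<inter> space (lborel :: 'a measure) = cball 0 a" by auto
    finally show ?thesis by (simp add: emeasure_cball d_def)
  qed
  have N: "emeasure ?N {..a} = ennreal (if 0 \<le> a then unit_ball_vol d * a ^ d else 0)" for a
  proof (cases "0 \<le> a")
    case True
    have "emeasure ?N {..a} = (\<integral>\<^sup>+r. ennreal (real d * unit_ball_vol d * r ^ (d - 1)) * indicator {0<..} r * indicator {..a} r \<partial>lborel)"
      by (simp add: emeasure_density)
    also have "\<dots> = (\<integral>\<^sup>+r. ennreal (real d * unit_ball_vol d * r ^ (d - 1)) * indicator {0..a} r \<partial>lborel)"
      using AE_lborel_singleton[of 0] by (intro nn_integral_cong_AE) (auto elim!: eventually_mono split: split_indicator)
    also have "\<dots> = ennreal (unit_ball_vol d * a ^ d - unit_ball_vol d * 0 ^ d)"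
      using True by (intro nn_integral_FTC_Icc) (auto intro!: derivative_eq_intros)
    finally show ?thesis using True d by (simp add: zero_power)
  next
    case False
    have "emeasure ?N {..a} = (\<integral>\<^sup>+r. ennreal (real d * unit_ball_vol d * r ^ (d - 1)) * indicator {0<..} r * indicator {..a} r \<partial>lborel)"
      by (simp add: emeasure_density)
    also have "\<dots> = (\<integral>\<^sup>+r. 0 \<partial>(lborel :: real measure))"
      using False by (intro nn_integral_cong) (auto split: split_indicator)
    finally show ?thesis using False by simp
  qed
  show "emeasure ?M X = emeasure ?N X" if "X \<in> ?E" for X
    using that M N by auto
  show "range (\<lambda>i. {..real i}) \<subseteq> ?E" by auto
  show "(\<Union>i. {..real i}) = UNIV" by (auto intro: real_arch_simple)
  show "emeasure ?M {..real i} \<noteq> \<infinity>" for i by (simp add: M)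
qed

lemma nn_integral_radial:
  fixes f :: "real \<Rightarrow> ennreal"
  assumes [measurable]: "f \<in> borel_measurable borel"
  shows "(\<integral>\<^sup>+x. f (norm x) \<partial>(lborel :: 'a::euclidean_space measure)) =
    (\<integral>\<^sup>+r\<in>{0<..}. ennreal (DIM('a) * unit_ball_vol DIM('a) * r ^ (DIM('a) - 1)) * f r \<partial>lborel)"
proof -
  have "(\<integral>\<^sup>+x. f (norm x) \<partial>(lborel :: 'a::euclidean_space measure)) =
      (\<integral>\<^sup>+r. f r \<partial>distr (lborel :: 'a::euclidean_space measure) borel norm)"
    by (simp add: nn_integral_distr)
  also have "\<dots> = (\<integral>\<^sup>+r. (ennreal (DIM('a) * unit_ball_vol DIM('a) * r ^ (DIM('a) - 1)) * indicator {0<..} r) * f r \<partial>lborel)"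
    unfolding distr_norm_lborel by (subst nn_integral_density) auto
  finally show ?thesis by (simp add: mult_ac)
qed

lemma nn_integral_radial_center:
  fixes f :: "real \<Rightarrow> ennreal" and c :: "'a::euclidean_space"
  assumes [measurable]: "f \<in> borel_measurable borel"
  shows "(\<integral>\<^sup>+x. f (norm (x - c)) \<partial>lborel) =
    (\<integral>\<^sup>+r\<in>{0<..}. ennreal (DIM('a) * unit_ball_vol DIM('a) * r ^ (DIM('a) - 1)) * f r \<partial>lborel)"
proof -
  have "(\<integral>\<^sup>+x. f (norm (x - c)) \<partial>lborel) = (\<integral>\<^sup>+x. f (norm (x - c)) \<partial>distr lborel borel ((+) c))"
    by (simp add: lborel_distr_plus)
  also have "\<dots> = (\<integral>\<^sup>+x. f (norm x) \<partial>(lborel :: 'a measure))"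
    by (subst nn_integral_distr) auto
  finally show ?thesis by (simp add: nn_integral_radial)
qed

text \<open>The part inside the ball of radius \<open>\<rho>\<close> and the part outside contribute equally.\<close>

lemma nn_integral_truncated_kernel:
  fixes y :: "'a::euclidean_space"
  assumes \<rho>: "0 < \<rho>"
  shows "(\<integral>\<^sup>+x. ennreal (1 / max \<rho> (norm (x - y)) ^ (2 * DIM('a))) \<partial>lborel) =
    ennreal (2 * unit_ball_vol DIM('a) / \<rho> ^ DIM('a))"
proof -
  define d where "d = DIM('a)"
  define w where "w = unit_ball_vol d"
  have d: "0 < d" by (simp add: d_def)
  have w: "0 \<le> w" by (simp add: w_def)
  let ?f = "\<lambda>r. real d * w * r ^ (d - 1) * (1 / max \<rho> r ^ (2 * d))"
  have [measurable]: "(\<lambda>r. ?f r) \<in> borel_measurable borel" by measurable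
  have "(\<integral>\<^sup>+x. ennreal (1 / max \<rho> (norm (x - y)) ^ (2 * d)) \<partial>lborel) =
      (\<integral>\<^sup>+r\<in>{0<..}. ennreal (real d * w * r ^ (d - 1)) * ennreal (1 / max \<rho> r ^ (2 * d)) \<partial>lborel)"
    unfolding d_def w_def by (rule nn_integral_radial_center) measurable
  also have "\<dots> = (\<integral>\<^sup>+r. ennreal (?f r) * indicator {0..\<rho>} r + ennreal (?f r) * indicator {\<rho>..} r \<partial>lborel)"
    using AE_lborel_singleton[of 0] AE_lborel_singleton[of \<rho>]
    by (intro nn_integral_cong_AE, eventually_elim)
      (use \<rho> w in \<open>auto split: split_indicator simp: ennreal_mult[symmetric] not_le not_less\<close>)
  also have "\<dots> = (\<integral>\<^sup>+r. ennreal (?f r) * indicator {0..\<rho>} r \<partial>lborel) + (\<integral>\<^sup>+r. ennreal (?f r) * indicator {\<rho>..} r \<partial>lborel)"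
    by (rule nn_integral_add) auto
  also have "(\<integral>\<^sup>+r. ennreal (?f r) * indicator {0..\<rho>} r \<partial>lborel) =
      (\<integral>\<^sup>+r. ennreal (real d * w * r ^ (d - 1) * (1 / \<rho> ^ (2 * d))) * indicator {0..\<rho>} r \<partial>lborel)"
    by (intro nn_integral_cong) (auto split: split_indicator simp: max_def)
  also have "\<dots> = ennreal (w * \<rho> ^ d * (1 / \<rho> ^ (2 * d)) - w * 0 ^ d * (1 / \<rho> ^ (2 * d)))"
    using \<rho> w by (intro nn_integral_FTC_Icc) (auto intro!: derivative_eq_intros)
  also have "w * \<rho> ^ d * (1 / \<rho> ^ (2 * d)) - w * 0 ^ d * (1 / \<rho> ^ (2 * d)) = w / \<rho> ^ d"
    unfolding mult_2 power_add using d \<rho> by (simp add: zero_power)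
  also have "(\<integral>\<^sup>+r. ennreal (?f r) * indicator {\<rho>..} r \<partial>lborel) =
      (\<integral>\<^sup>+r. ennreal (real d * w / r ^ (d + 1)) * indicator {\<rho>..} r \<partial>lborel)"
  proof (intro nn_integral_cong)
    fix r
    have "?f r = real d * w / r ^ (d + 1)" if "\<rho> \<le> r"
    proof -
      have "r ^ (2 * d) = r ^ (d - 1) * r ^ (d + 1)" using d
        by (simp only: power_add[symmetric]) (intro arg_cong[of _ _ "power r"], simp)
      then show ?thesis using that \<rho> by (simp add: max_def field_simps)
    qed
    then show "ennreal (?f r) * indicator {\<rho>..} r = ennreal (real d * w / r ^ (d + 1)) * indicator {\<rho>..} r"
      by (auto split: split_indicator)
  qed
  also have "\<dots> = ennreal (0 - (- (w / \<rho> ^ d)))"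
  proof (rule nn_integral_FTC_atLeast)
    show "((\<lambda>r. - (w / r ^ d)) has_real_derivative real d * w / r ^ (d + 1)) (at r)" if "\<rho> \<le> r" for r
    proof -
      have "r ^ d = r * r ^ (d - 1)" using d by (simp add: power_eq_if)
      then show ?thesis using that \<rho> d
        by (auto intro!: derivative_eq_intros simp: field_simps)
    qed
    have "((\<lambda>r::real. - (w * inverse r ^ d)) \<longlongrightarrow> - (w * 0 ^ d)) at_top"
      by (intro tendsto_intros tendsto_inverse_0_at_top filterlim_ident)
    then show "((\<lambda>r. - (w / r ^ d)) \<longlongrightarrow> 0) at_top"
      using d by (simp add: zero_power divide_inverse power_inverse)
  qed (use \<rho> w in auto)
  finally show ?thesis
    using w \<rho> by (simp add: ennreal_plus[symmetric] w_def d_def del: ennreal_plus)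
qed

section \<open>Volumes under inversion\<close>

text \<open>After squaring, the two conditions differ by the positive factor \<open>D |v|\<^sup>2\<close>, because
  \<open>|a|\<^sup>2 - D = r\<^sup>2\<close>.\<close>

lemma inversion_mem_ball_iff:
  fixes a v :: "'a::real_inner"
  assumes r: "0 < r" "r < norm a" and v: "v \<noteq> 0"
  defines "D \<equiv> (norm a)\<^sup>2 - r\<^sup>2"
  shows "(1 / (norm v)\<^sup>2) *\<^sub>R v \<in> ball ((1 / D) *\<^sub>R a) (r / D) \<longleftrightarrow> v \<in> ball a r"
proof -
  have D: "0 < D" using r by (simp add: D_def power_strict_mono)
  have n: "0 < (norm v)\<^sup>2" using v by simp
  have sq: "x < y \<longleftrightarrow> x\<^sup>2 < y\<^sup>2" if "0 \<le> x" "0 \<le> y" for x y :: real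
    using that power_strict_mono[of x y 2] power2_less_imp_less[of x y] by auto
  have 1: "(norm ((1 / (norm v)\<^sup>2) *\<^sub>R v - (1 / D) *\<^sub>R a))\<^sup>2 =
      1 / (norm v)\<^sup>2 - 2 * (v \<bullet> a) / (D * (norm v)\<^sup>2) + (norm a)\<^sup>2 / D\<^sup>2"
    using n D unfolding power2_norm_eq_inner
    by (simp add: inner_diff_left inner_diff_right inner_commute[of a v] field_simps power2_eq_square)
  have 2: "(norm (v - a))\<^sup>2 = (norm v)\<^sup>2 - 2 * (v \<bullet> a) + (norm a)\<^sup>2"
    unfolding power2_norm_eq_inner by (simp add: inner_diff_left inner_diff_right inner_commute[of a v])
  have 3: "(1 / (norm v)\<^sup>2 - 2 * (v \<bullet> a) / (D * (norm v)\<^sup>2) + (norm a)\<^sup>2 / D\<^sup>2 - (r / D)\<^sup>2) * (D * (norm v)\<^sup>2) =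
      (norm (v - a))\<^sup>2 - r\<^sup>2"
  proof -
    have "(norm a)\<^sup>2 / D\<^sup>2 - (r / D)\<^sup>2 = D / D\<^sup>2" by (simp add: power_divide D_def diff_divide_distrib)
    also have "\<dots> = 1 / D" using D by (simp add: power2_eq_square)
    finally have "1 / (norm v)\<^sup>2 - 2 * (v \<bullet> a) / (D * (norm v)\<^sup>2) + (norm a)\<^sup>2 / D\<^sup>2 - (r / D)\<^sup>2 =
        1 / (norm v)\<^sup>2 - 2 * (v \<bullet> a) / (D * (norm v)\<^sup>2) + 1 / D" by linarith
    also have "\<dots> * (D * (norm v)\<^sup>2) = D - 2 * (v \<bullet> a) + (norm v)\<^sup>2"
      using D n by (simp add: field_simps)
    finally show ?thesis by (simp add: 2 D_def)
  qed
  have "(1 / (norm v)\<^sup>2) *\<^sub>R v \<in> ball ((1 / D) *\<^sub>R a) (r / D) \<longleftrightarrow>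
      norm ((1 / (norm v)\<^sup>2) *\<^sub>R v - (1 / D) *\<^sub>R a) < r / D"
    by (simp add: dist_norm norm_minus_commute)
  also have "\<dots> \<longleftrightarrow> (norm ((1 / (norm v)\<^sup>2) *\<^sub>R v - (1 / D) *\<^sub>R a))\<^sup>2 < (r / D)\<^sup>2"
    using r D by (intro sq) auto
  also have "\<dots> \<longleftrightarrow> ((norm ((1 / (norm v)\<^sup>2) *\<^sub>R v - (1 / D) *\<^sub>R a))\<^sup>2 - (r / D)\<^sup>2) * (D * (norm v)\<^sup>2) < 0"
    using n D by (simp add: mult_less_0_iff)
  also have "\<dots> \<longleftrightarrow> (norm (v - a))\<^sup>2 - r\<^sup>2 < 0"
    unfolding 1 3 ..
  also have "\<dots> \<longleftrightarrow> norm (v - a) < r"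
    using r sq[of "norm (v - a)" r] by simp
  also have "\<dots> \<longleftrightarrow> v \<in> ball a r" by (simp add: dist_norm norm_minus_commute)
  finally show ?thesis .
qed

lemma inversion_image_ball:
  fixes a :: "'a::real_inner"
  assumes r: "0 < r" "r < norm a"
  defines "D \<equiv> (norm a)\<^sup>2 - r\<^sup>2"
  shows "(\<lambda>v. (1 / (norm v)\<^sup>2) *\<^sub>R v) ` ball a r = ball ((1 / D) *\<^sub>R a) (r / D)"
proof (intro set_eqI iffI)
  let ?F = "\<lambda>v::'a. (1 / (norm v)\<^sup>2) *\<^sub>R v"
  have D: "0 < D" using r by (simp add: D_def power_strict_mono)
  note iff = inversion_mem_ball_iff[OF r, folded D_def]
  fix w
  { assume "w \<in> ?F ` ball a r"
    then obtain v where v: "v \<in> ball a r" "w = ?F v" by blast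
    then have "v \<noteq> 0" using r by (auto simp: dist_norm)
    then show "w \<in> ball ((1 / D) *\<^sub>R a) (r / D)" using v iff[of v] by simp }
  { assume w: "w \<in> ball ((1 / D) *\<^sub>R a) (r / D)"
    have "w \<noteq> 0"
    proof
      assume "w = 0"
      then have "norm a / D < r / D" using w D by (simp add: dist_norm)
      then show False using r D by (simp add: divide_less_cancel)
    qed
    then have F: "?F w \<noteq> 0" "?F (?F w) = w" by (simp_all add: power2_eq_square)
    then have "?F w \<in> ball a r" using w iff[OF F(1)] unfolding F(2) by blast
    then have "?F (?F w) \<in> ?F ` ball a r" by (rule imageI)
    then show "w \<in> ?F ` ball a r" unfolding F(2) . }
qed

text \<open>The integrand is the Jacobian of the inversion. Instead of a change of variables, the ball is filled,
  up to a null set, with disjoint balls so small that on each of them the integral exceeds the volume of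
  its inverted image by at most the factor \<open>q > 1\<close> (Vitali). The images are disjoint and lie in the image of
  the whole ball; finally \<open>q\<close> tends to 1.\<close>

lemma nn_integral_inverse_power_ball_le:
  fixes c :: "'a::euclidean_space"
  assumes \<rho>: "0 < \<rho>" "\<rho> < norm c"
  shows "(\<integral>\<^sup>+v\<in>ball c \<rho>. ennreal (1 / norm v ^ (2 * DIM('a))) \<partial>lborel) \<le>
    ennreal (unit_ball_vol DIM('a) * (\<rho> / ((norm c)\<^sup>2 - \<rho>\<^sup>2)) ^ DIM('a))"
proof -
  let ?d = "DIM('a)"
  let ?F = "\<lambda>v::'a. (1 / (norm v)\<^sup>2) *\<^sub>R v"
  let ?S = "ball c \<rho>"
  define f :: "'a \<Rightarrow> ennreal" where "f = (\<lambda>v. ennreal (1 / norm v ^ (2 * ?d)))"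
  have [measurable]: "f \<in> borel_measurable borel" unfolding f_def by measurable
  define \<nu> where "\<nu> = density lborel f"
  have [simp]: "sets \<nu> = sets borel" by (simp add: \<nu>_def)
  define b where "b = unit_ball_vol ?d * (\<rho> / ((norm c)\<^sup>2 - \<rho>\<^sup>2)) ^ ?d"
  have pos: "0 < (norm a)\<^sup>2 - r\<^sup>2" if "0 < r" "r < norm a" for a :: 'a and r
    using that by (simp add: power_strict_mono)
  have vol: "emeasure lborel (?F ` ball a r) = ennreal (unit_ball_vol ?d * (r / ((norm a)\<^sup>2 - r\<^sup>2)) ^ ?d)"
    if "0 < r" "r < norm a" for a r
    unfolding inversion_image_ball[OF that] using pos[OF that] that by (subst emeasure_ball) auto
  have b: "0 \<le> b" using pos[OF \<rho>] \<rho> by (simp add: b_def)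
  have main: "emeasure \<nu> ?S \<le> ennreal (q * b)" if q: "1 < q" for q
  proof -
    \<comment> \<open>The small balls, indexed by centre and radius; the last condition bounds the ratio of
  the integral over the ball to the volume of its inverted image.\<close>
    define I where "I = {(a, r). 0 < r \<and> r < norm a \<and> ball a r \<subseteq> ?S \<and> ((norm a + r) / (norm a - r)) ^ ?d \<le> q}"
    have ex: "\<exists>i. i \<in> I \<and> x \<in> ball (fst i) (snd i) \<and> snd i < t" if x: "x \<in> ?S" and t: "0 < t" for x t
    proof -
      have nx: "0 < norm x" using x \<rho> by (auto simp: dist_norm)
      obtain e where e: "0 < e" "ball x e \<subseteq> ?S" using x open_ball openE by blast
      have "((\<lambda>r. ((norm x + r) / (norm x - r)) ^ ?d) \<longlongrightarrow> ((norm x + 0) / (norm x - 0)) ^ ?d) (at_right 0)"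
        using nx by (intro tendsto_intros) auto
      then have "eventually (\<lambda>r. ((norm x + r) / (norm x - r)) ^ ?d < q) (at_right 0)"
        using q nx by (intro order_tendstoD(2)) auto
      moreover have "eventually (\<lambda>r. 0 < r \<and> r < min (norm x) (min e t)) (at_right (0::real))"
        using nx e t by (intro eventually_at_rightI[of 0 "min (norm x) (min e t)"]) auto
      ultimately have "eventually (\<lambda>r. ((norm x + r) / (norm x - r)) ^ ?d < q \<and> 0 < r \<and> r < min (norm x) (min e t)) (at_right 0)"
        by (rule eventually_conj)
      then obtain r where r: "((norm x + r) / (norm x - r)) ^ ?d < q" "0 < r" "r < min (norm x) (min e t)"
        using eventually_happens trivial_limit_at_right_real by blast
      have "ball x r \<subseteq> ?S" using e(2) r(3) by (meson less_imp_le min_less_iff_conj order_trans subset_ball)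
      then have "(x, r) \<in> I" using r by (simp add: I_def)
      then show ?thesis using r by (intro exI[of _ "(x, r)"]) auto
    qed
    obtain C where C: "countable C" "C \<subseteq> I"
      "pairwise (\<lambda>i j. disjnt (ball (fst i) (snd i)) (ball (fst j) (snd j))) C"
      "negligible (?S - (\<Union>i\<in>C. ball (fst i) (snd i)))"
      by (rule Vitali_covering_theorem_balls[of ?S I fst snd, OF ex]) (auto intro: that)
    let ?B = "\<lambda>i. ball (fst i) (snd i)"
    have CI: "0 < snd i" "snd i < norm (fst i)" "?B i \<subseteq> ?S" "((norm (fst i) + snd i) / (norm (fst i) - snd i)) ^ ?d \<le> q"
      if "i \<in> C" for i
    proof -
      have "(fst i, snd i) \<in> I" using C(2) that by auto
      then show "0 < snd i" "snd i < norm (fst i)" "?B i \<subseteq> ?S" "((norm (fst i) + snd i) / (norm (fst i) - snd i)) ^ ?d \<le> q"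
        unfolding I_def mem_Collect_eq case_prod_conv by blast+
    qed
    have disj: "disjoint_family_on ?B C"
      using C(3) by (auto simp: disjoint_family_on_def pairwise_def disjnt_def)
    have inj: "inj_on ?F ?S"
    proof (rule inj_on_inverseI[where g = ?F])
      fix v assume "v \<in> ?S"
      then have "v \<noteq> 0" using \<rho> by (auto simp: dist_norm)
      then show "?F (?F v) = v" by (simp add: power2_eq_square power_divide)
    qed
    have disjF: "disjoint_family_on (\<lambda>i. ?F ` ?B i) C"
      unfolding disjoint_family_on_def
    proof (intro ballI impI)
      fix i j assume ij: "i \<in> C" "j \<in> C" "i \<noteq> j"
      have "?F ` ?B i \<inter> ?F ` ?B j = ?F ` (?B i \<inter> ?B j)"
        using CI(3)[OF ij(1)] CI(3)[OF ij(2)] by (intro inj_on_image_Int[OF inj, symmetric])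
      then show "?F ` ?B i \<inter> ?F ` ?B j = {}" using disj ij by (simp add: disjoint_family_on_def)
    qed
    have each: "emeasure \<nu> (?B i) \<le> ennreal q * emeasure lborel (?F ` ?B i)" if i: "i \<in> C" for i
    proof -
      obtain a r where ar: "i = (a, r)" by (cases i)
      have r: "0 < r" "r < norm a" "((norm a + r) / (norm a - r)) ^ ?d \<le> q" using CI[OF i] by (auto simp: ar)
      have "emeasure \<nu> (?B i) = (\<integral>\<^sup>+v. f v * indicator (ball a r) v \<partial>lborel)"
        by (simp add: \<nu>_def emeasure_density ar)
      also have "\<dots> \<le> (\<integral>\<^sup>+v. ennreal (1 / (norm a - r) ^ (2 * ?d)) * indicator (ball a r) v \<partial>lborel)"
      proof (rule nn_integral_mono)
        fix v
        show "f v * indicator (ball a r) v \<le> ennreal (1 / (norm a - r) ^ (2 * ?d)) * indicator (ball a r) v"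
        proof (cases "v \<in> ball a r")
          case True
          then have "norm a - r \<le> norm v" using norm_triangle_sub[of a v] by (simp add: dist_norm)
          then have "(norm a - r) ^ (2 * ?d) \<le> norm v ^ (2 * ?d)" using r by (intro power_mono) auto
          then show ?thesis using r unfolding f_def by (intro mult_right_mono ennreal_leI frac_le) auto
        qed simp
      qed
      also have "\<dots> = ennreal (1 / (norm a - r) ^ (2 * ?d)) * ennreal (unit_ball_vol ?d * r ^ ?d)"
        using r by (simp add: nn_integral_cmult_indicator emeasure_ball)
      also have "\<dots> = ennreal (((norm a + r) / (norm a - r)) ^ ?d * (unit_ball_vol ?d * (r / ((norm a)\<^sup>2 - r\<^sup>2)) ^ ?d))"
      proof -
        have "(norm a)\<^sup>2 - r\<^sup>2 = (norm a + r) * (norm a - r)" by (simp add: power2_eq_square algebra_simps)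
        then have "1 / (norm a - r) ^ (2 * ?d) * (unit_ball_vol ?d * r ^ ?d) =
            ((norm a + r) / (norm a - r)) ^ ?d * (unit_ball_vol ?d * (r / ((norm a)\<^sup>2 - r\<^sup>2)) ^ ?d)"
          using r unfolding mult_2 power_add by (simp add: power_divide power_mult_distrib)
        then show ?thesis using r by (subst ennreal_mult[symmetric]) auto
      qed
      also have "\<dots> \<le> ennreal (q * (unit_ball_vol ?d * (r / ((norm a)\<^sup>2 - r\<^sup>2)) ^ ?d))"
        using r pos[OF r(1,2)] by (intro ennreal_leI mult_right_mono) auto
      also have "\<dots> = ennreal q * emeasure lborel (?F ` ?B i)"
        unfolding ar fst_conv snd_conv vol[OF r(1,2)] using q r pos[OF r(1,2)] by (intro ennreal_mult) auto
      finally show ?thesis .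
    qed
    have open_B: "open (?F ` ?B i)" if "i \<in> C" for i
      unfolding inversion_image_ball[OF CI(1,2)[OF that]] by simp
    have "emeasure \<nu> ?S \<le> emeasure \<nu> (\<Union>i\<in>C. ?B i)"
    proof -
      have "?S - (\<Union>i\<in>C. ?B i) \<in> null_sets lborel"
      proof -
        have "open (\<Union>i\<in>C. ?B i)" by auto
        then have "?S - (\<Union>i\<in>C. ?B i) \<in> sets lborel" by (auto intro!: sets.Diff)
        then show ?thesis using C(4) null_sets_completion_iff[of "?S - (\<Union>i\<in>C. ?B i)" lborel]
          by (simp add: negligible_iff_null_sets)
      qed
      then have "AE x in lborel. x \<notin> ?S - (\<Union>i\<in>C. ?B i)" by (rule AE_not_in)
      then have "AE x in lborel. 0 < f x \<longrightarrow> x \<notin> ?S - (\<Union>i\<in>C. ?B i)" by (rule eventually_mono) simp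
      then have "AE x in \<nu>. x \<notin> ?S - (\<Union>i\<in>C. ?B i)" unfolding \<nu>_def by (subst AE_density) auto
      then have "AE x in \<nu>. x \<in> ?S \<longrightarrow> x \<in> (\<Union>i\<in>C. ?B i)" by (rule eventually_mono) auto
      then show ?thesis by (intro emeasure_mono_AE) (auto intro!: borel_open)
    qed
    also have "\<dots> = (\<integral>\<^sup>+i. emeasure \<nu> (?B i) \<partial>count_space C)"
      using C(1) disj by (intro emeasure_UN_countable) auto
    also have "\<dots> \<le> (\<integral>\<^sup>+i. ennreal q * emeasure lborel (?F ` ?B i) \<partial>count_space C)"
      using each by (intro nn_integral_mono) auto
    also have "\<dots> = ennreal q * (\<integral>\<^sup>+i. emeasure lborel (?F ` ?B i) \<partial>count_space C)"
      by (intro nn_integral_cmult) auto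
    also have "(\<integral>\<^sup>+i. emeasure lborel (?F ` ?B i) \<partial>count_space C) = emeasure lborel (\<Union>i\<in>C. ?F ` ?B i)"
      using C(1) disjF open_B by (intro emeasure_UN_countable[symmetric]) (auto intro!: borel_open)
    also have "ennreal q * \<dots> \<le> ennreal q * emeasure lborel (?F ` ?S)"
    proof (intro mult_left_mono emeasure_mono)
      show "(\<Union>i\<in>C. ?F ` ?B i) \<subseteq> ?F ` ?S" using CI(3) by (intro UN_least image_mono)
      show "?F ` ?S \<in> sets lborel" unfolding inversion_image_ball[OF \<rho>] by simp
    qed simp
    also have "\<dots> = ennreal (q * b)"
      unfolding vol[OF \<rho>] b_def[symmetric] using q b by (intro ennreal_mult[symmetric]) auto
    finally show ?thesis .
  qed
  have "emeasure \<nu> ?S \<le> ennreal b"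
  proof (rule ennreal_le_epsilon)
    fix e :: real assume e: "0 < e"
    have "emeasure \<nu> ?S \<le> ennreal ((1 + e / (b + 1)) * b)" using e b by (intro main) auto
    also have "\<dots> \<le> ennreal (b + e)"
      using e b by (intro ennreal_leI) (simp add: field_simps)
    also have "\<dots> = ennreal b + ennreal e"
      by (rule ennreal_plus) (use e b in auto)
    finally show "emeasure \<nu> ?S \<le> ennreal b + ennreal e" .
  qed
  then show ?thesis by (simp add: \<nu>_def emeasure_density f_def b_def)
qed

lemma nn_integral_inverse_power_centered_ball_le:
  fixes x :: "'a::euclidean_space"
  assumes \<rho>: "0 < \<rho>" "\<rho> < norm x"
  shows "(\<integral>\<^sup>+y\<in>ball 0 \<rho>. ennreal (1 / norm (x - y) ^ (2 * DIM('a))) \<partial>lborel) \<le>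
    ennreal (unit_ball_vol DIM('a) * (\<rho> / ((norm x)\<^sup>2 - \<rho>\<^sup>2)) ^ DIM('a))"
proof -
  define g where "g = (\<lambda>v. ennreal (1 / norm v ^ (2 * DIM('a))) * indicator (ball x \<rho>) v)"
  have [measurable]: "g \<in> borel_measurable borel"
    unfolding g_def by (intro borel_measurable_times_ennreal borel_measurable_indicator) auto
  have "(\<integral>\<^sup>+y\<in>ball 0 \<rho>. ennreal (1 / norm (x - y) ^ (2 * DIM('a))) \<partial>lborel) = (\<integral>\<^sup>+y. g (x + (-1) *\<^sub>R y) \<partial>lborel)"
    by (intro nn_integral_cong) (auto simp: g_def dist_norm split: split_indicator)
  also have "\<dots> = (\<integral>\<^sup>+y. g y \<partial>density (distr lborel borel (\<lambda>y. x + (-1) *\<^sub>R y)) (\<lambda>_. ennreal (\<bar>- 1 :: real\<bar> ^ DIM('a))))"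
    by (simp add: nn_integral_density nn_integral_distr)
  also have "\<dots> = (\<integral>\<^sup>+y. g y \<partial>lborel)"
    using lborel_affine[of "-1" x] by simp
  finally show ?thesis using nn_integral_inverse_power_ball_le[OF \<rho>] by (simp add: g_def)
qed

section \<open>The singular kernel in series form\<close>

text \<open>The binomial coefficient \<open>d + n - 1\<close> over \<open>n\<close>, in the form in which it occurs in the critical
  exponent.\<close>

definition negbin :: "nat \<Rightarrow> nat \<Rightarrow> real" where
  "negbin d n = fact (d + n - 1) / (fact n * fact (d - 1))"

lemma negbin_sums:
  fixes z :: real
  assumes "0 \<le> z" "z < 1" "0 < d"
  shows "(\<lambda>n. negbin d n * z ^ n) sums (1 / (1 - z) ^ d)"
proof -
  have "(\<lambda>n. ((- real d) gchoose n) * (- z) ^ n) sums (1 + (- z)) powr (- real d)"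
    by (rule gen_binomial_real) (use assms in auto)
  also have "(\<lambda>n. ((- real d) gchoose n) * (- z) ^ n) = (\<lambda>n. negbin d n * z ^ n)"
  proof
    fix n
    have "real d + real n - 1 = real (d + n - 1)" using assms by (simp add: of_nat_diff)
    then have "((real d + real n - 1) gchoose n) = real ((d + n - 1) choose n)"
      by (simp only: binomial_gbinomial)
    also have "\<dots> = negbin d n"
    proof -
      have "n \<le> d + n - 1" "d + n - 1 - n = d - 1" using assms by auto
      then show ?thesis unfolding negbin_def by (simp add: binomial_fact)
    qed
    finally have "((- real d) gchoose n) = (- 1) ^ n * negbin d n" by (simp add: gbinomial_minus)
    moreover have "(- z) ^ n = (- 1) ^ n * z ^ n" by (rule power_minus)
    ultimately have "((- real d) gchoose n) * (- z) ^ n = ((- 1) ^ n * (- 1) ^ n) * (negbin d n * z ^ n)"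
      by (simp only: mult_ac)
    also have "(- 1) ^ n * (- 1) ^ n = (1::real)" by (simp flip: power_mult_distrib)
    finally show "((- real d) gchoose n) * (- z) ^ n = negbin d n * z ^ n" by simp
  qed
  also have "(1 + (- z)) powr (- real d) = 1 / (1 - z) ^ d"
    using assms by (simp add: powr_minus_divide powr_realpow)
  finally show ?thesis .
qed

lemma negbin_nonneg: "0 \<le> negbin d n"
  by (simp add: negbin_def)

lemma inverse_power_ball_series:
  fixes x :: "'a::euclidean_space"
  assumes "0 < \<rho>" "\<rho> < norm x"
  shows "ennreal (unit_ball_vol DIM('a) * (\<rho> / ((norm x)\<^sup>2 - \<rho>\<^sup>2)) ^ DIM('a)) =
    (\<Sum>n. ennreal (unit_ball_vol DIM('a) / norm x ^ DIM('a) * negbin DIM('a) n * (\<rho> / norm x) ^ (DIM('a) + 2 * n)))"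
proof -
  let ?d = "DIM('a)"
  define q where "q = \<rho> / norm x"
  have "0 < norm x" using assms by linarith
  then have q: "0 < q" "q < 1" using assms by (auto simp: q_def)
  then have q2: "q\<^sup>2 < 1" using power_strict_mono[of q 1 2] by simp
  have "(\<lambda>n. negbin ?d n * (q\<^sup>2) ^ n) sums (1 / (1 - q\<^sup>2) ^ ?d)"
    using q q2 by (intro negbin_sums) auto
  then have "(\<lambda>n. unit_ball_vol ?d / norm x ^ ?d * q ^ ?d * (negbin ?d n * (q\<^sup>2) ^ n)) sums
      (unit_ball_vol ?d / norm x ^ ?d * q ^ ?d * (1 / (1 - q\<^sup>2) ^ ?d))"
    by (rule sums_mult)
  also have "(\<lambda>n. unit_ball_vol ?d / norm x ^ ?d * q ^ ?d * (negbin ?d n * (q\<^sup>2) ^ n)) =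
      (\<lambda>n. unit_ball_vol ?d / norm x ^ ?d * negbin ?d n * q ^ (?d + 2 * n))"
  proof
    fix n
    have "q ^ (?d + 2 * n) = q ^ ?d * (q\<^sup>2) ^ n" by (simp only: power_add power_mult)
    then show "unit_ball_vol ?d / norm x ^ ?d * q ^ ?d * (negbin ?d n * (q\<^sup>2) ^ n) =
        unit_ball_vol ?d / norm x ^ ?d * negbin ?d n * q ^ (?d + 2 * n)" by (simp only: mult_ac)
  qed
  also have "unit_ball_vol ?d / norm x ^ ?d * q ^ ?d * (1 / (1 - q\<^sup>2) ^ ?d) =
      unit_ball_vol ?d * (\<rho> / ((norm x)\<^sup>2 - \<rho>\<^sup>2)) ^ ?d"
  proof -
    have nx: "0 < norm x" using assms by linarith
    have "(norm x)\<^sup>2 - \<rho>\<^sup>2 = (norm x)\<^sup>2 * (1 - q\<^sup>2)" using nx by (simp add: q_def power_divide algebra_simps)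
    moreover have "\<rho> = norm x * q" using nx by (simp add: q_def)
    ultimately have "\<rho> / ((norm x)\<^sup>2 - \<rho>\<^sup>2) = q / (norm x * (1 - q\<^sup>2))"
      using nx by (simp add: power2_eq_square)
    then show ?thesis by (simp add: power_divide power_mult_distrib)
  qed
  finally show ?thesis
    unfolding q_def[symmetric]
    using q by (intro suminf_ennreal_eq[symmetric]) (auto intro!: mult_nonneg_nonneg divide_nonneg_nonneg negbin_nonneg)
qed

text \<open>The integrand is \<open>c\<^sup>m |x|\<^sup>-\<^sup>d\<close> up to radius \<open>r / c\<close> and \<open>r\<^sup>m |x|\<^sup>-\<^sup>d\<^sup>-\<^sup>m\<close> beyond it; the radius \<open>r\<close> drops out
  of the result because \<open>|x|\<^sup>-\<^sup>d dx\<close> is invariant under dilations.\<close>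

lemma nn_integral_outside_ball:
  fixes r c :: real and m :: nat
  assumes r: "0 < r" and c: "0 < c" "c < 1" and m: "0 < m"
  shows "(\<integral>\<^sup>+x. (if r \<le> norm x then ennreal (1 / norm x ^ DIM('a) * (min r (norm x * c) / norm x) ^ m) else 0) \<partial>(lborel :: 'a::euclidean_space measure)) =
    ennreal (DIM('a) * unit_ball_vol DIM('a) * c ^ m * (ln (1 / c) + 1 / m))"
proof -
  let ?d = "DIM('a)"
  let ?w = "unit_ball_vol (real ?d)"
  have d: "0 < ?d" by simp
  have [measurable]: "(\<lambda>t. if r \<le> t then ennreal (1 / t ^ ?d * (min r (t * c) / t) ^ m) else 0) \<in> borel_measurable borel"
    by measurable
  have rc: "r \<le> r / c" "0 < r / c" using r c by (auto simp: field_simps)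
  have "(\<integral>\<^sup>+x. (if r \<le> norm x then ennreal (1 / norm x ^ ?d * (min r (norm x * c) / norm x) ^ m) else 0) \<partial>(lborel :: 'a measure)) =
      (\<integral>\<^sup>+t\<in>{0<..}. ennreal (?d * ?w * t ^ (?d - 1)) * (if r \<le> t then ennreal (1 / t ^ ?d * (min r (t * c) / t) ^ m) else 0) \<partial>lborel)"
    by (rule nn_integral_radial) measurable
  also have "\<dots> = (\<integral>\<^sup>+t. ennreal (?d * ?w * c ^ m / t) * indicator {r..r / c} t + ennreal (?d * ?w * r ^ m / t ^ (m + 1)) * indicator {r / c..} t \<partial>lborel)"
  proof (rule nn_integral_cong_AE)
    show "AE t in lborel. ennreal (?d * ?w * t ^ (?d - 1)) * (if r \<le> t then ennreal (1 / t ^ ?d * (min r (t * c) / t) ^ m) else 0) * indicator {0<..} t =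
      ennreal (?d * ?w * c ^ m / t) * indicator {r..r / c} t + ennreal (?d * ?w * r ^ m / t ^ (m + 1)) * indicator {r / c..} t"
      using AE_lborel_singleton[of "r / c"]
    proof eventually_elim
      fix t assume ne: "t \<noteq> r / c"
      show "ennreal (?d * ?w * t ^ (?d - 1)) * (if r \<le> t then ennreal (1 / t ^ ?d * (min r (t * c) / t) ^ m) else 0) * indicator {0<..} t =
      ennreal (?d * ?w * c ^ m / t) * indicator {r..r / c} t + ennreal (?d * ?w * r ^ m / t ^ (m + 1)) * indicator {r / c..} t"
      proof (cases "r \<le> t")
        case False
        then show ?thesis using rc by auto
      next
        case True
        then have t: "0 < t" using r by simp
        have td: "t ^ (?d - 1) * (1 / t ^ ?d) = 1 / t"
        proof -
          have "t ^ ?d = t * t ^ (?d - 1)" by (simp add: power_eq_if)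
          then show ?thesis using t by simp
        qed
        have "ennreal (?d * ?w * t ^ (?d - 1)) * ennreal (1 / t ^ ?d * (min r (t * c) / t) ^ m) =
            ennreal (?d * ?w * (t ^ (?d - 1) * (1 / t ^ ?d)) * (min r (t * c) / t) ^ m)"
          using t r c by (subst ennreal_mult[symmetric]) (auto simp: mult_ac)
        also have "\<dots> = ennreal (?d * ?w * (1 / t) * (min r (t * c) / t) ^ m)" unfolding td ..
        finally have eq: "ennreal (?d * ?w * t ^ (?d - 1)) * ennreal (1 / t ^ ?d * (min r (t * c) / t) ^ m) =
          ennreal (?d * ?w * (1 / t) * (min r (t * c) / t) ^ m)" .
        show ?thesis
        proof (cases "t < r / c")
          case True
          then have "min r (t * c) = t * c" using c by (simp add: field_simps)
          then show ?thesis using \<open>r \<le> t\<close> True eq t by simp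
        next
          case False
          then have "r / c < t" using ne by simp
          moreover from this have "min r (t * c) = r" using c by (simp add: field_simps)
          ultimately show ?thesis using \<open>r \<le> t\<close> eq t by (simp add: power_divide)
        qed
      qed
    qed
  qed
  also have "\<dots> = (\<integral>\<^sup>+t. ennreal (?d * ?w * c ^ m / t) * indicator {r..r / c} t \<partial>lborel) +
      (\<integral>\<^sup>+t. ennreal (?d * ?w * r ^ m / t ^ (m + 1)) * indicator {r / c..} t \<partial>lborel)"
    by (rule nn_integral_add) auto
  also have "(\<integral>\<^sup>+t. ennreal (?d * ?w * c ^ m / t) * indicator {r..r / c} t \<partial>lborel) =
      ennreal (?d * ?w * c ^ m * ln (r / c) - ?d * ?w * c ^ m * ln r)"
    using r rc c by (intro nn_integral_FTC_Icc) (auto intro!: derivative_eq_intros)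
  also have "(\<integral>\<^sup>+t. ennreal (?d * ?w * r ^ m / t ^ (m + 1)) * indicator {r / c..} t \<partial>lborel) =
      ennreal (0 - (- (?d * ?w * r ^ m / (m * (r / c) ^ m))))"
  proof (rule nn_integral_FTC_atLeast)
    show "((\<lambda>t. - (?d * ?w * r ^ m / (m * t ^ m))) has_real_derivative ?d * ?w * r ^ m / t ^ (m + 1)) (at t)" if "r / c \<le> t" for t :: real
    proof -
      have t: "0 < t" using that rc by simp
      have "t ^ m = t * t ^ (m - 1)" using m by (simp add: power_eq_if)
      then show ?thesis using t m
        by (auto intro!: derivative_eq_intros simp: field_simps)
    qed
    have "((\<lambda>t::real. - (?d * ?w * r ^ m / m * inverse t ^ m)) \<longlongrightarrow> - (?d * ?w * r ^ m / m * 0 ^ m)) at_top"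
      by (intro tendsto_intros tendsto_inverse_0_at_top filterlim_ident)
    then show "((\<lambda>t::real. - (?d * ?w * r ^ m / (m * t ^ m))) \<longlongrightarrow> 0) at_top"
      using m by (simp add: zero_power divide_inverse power_inverse mult_ac)
  qed (use rc r in auto)
  also have "?d * ?w * c ^ m * ln (r / c) - ?d * ?w * c ^ m * ln r = ?d * ?w * c ^ m * ln (1 / c)"
    using r c by (simp add: ln_div algebra_simps)
  also have "0 - (- (?d * ?w * r ^ m / (m * (r / c) ^ m))) = ?d * ?w * c ^ m * (1 / m)"
    using r c by (simp add: power_divide)
  also have "ennreal (?d * ?w * c ^ m * ln (1 / c)) + ennreal (?d * ?w * c ^ m * (1 / m)) =
      ennreal (?d * ?w * c ^ m * (ln (1 / c) + 1 / m))"
    using c by (subst ennreal_plus[symmetric]) (auto simp: distrib_left intro!: mult_nonneg_nonneg)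
  finally show ?thesis .
qed

lemma nn_integral_Gamma_scaled:
  fixes z m :: real
  assumes z: "0 < z" and m: "0 < m"
  shows "(\<integral>\<^sup>+a\<in>{0..}. ennreal (a powr (z - 1) * exp (- (m * a))) \<partial>lborel) = ennreal (Gamma z / m powr z)"
proof -
  have "ennreal (Gamma z) = (\<integral>\<^sup>+t. ennreal (indicator {0..} t * t powr (z - 1) / exp t) \<partial>lborel)"
    by (rule Gamma_conv_nn_integral_real[OF z])
  also have "\<dots> = ennreal \<bar>m\<bar> * (\<integral>\<^sup>+t. ennreal (indicator {0..} (0 + m * t) * (0 + m * t) powr (z - 1) / exp (0 + m * t)) \<partial>lborel)"
    using m by (intro nn_integral_real_affine) auto
  also have "(\<integral>\<^sup>+t. ennreal (indicator {0..} (0 + m * t) * (0 + m * t) powr (z - 1) / exp (0 + m * t)) \<partial>lborel) =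
      (\<integral>\<^sup>+t. ennreal (m powr (z - 1)) * (ennreal (t powr (z - 1) * exp (- (m * t))) * indicator {0..} t) \<partial>lborel)"
  proof (rule nn_integral_cong)
    fix t
    show "ennreal (indicator {0..} (0 + m * t) * (0 + m * t) powr (z - 1) / exp (0 + m * t)) =
        ennreal (m powr (z - 1)) * (ennreal (t powr (z - 1) * exp (- (m * t))) * indicator {0..} t)"
      using m by (cases "0 \<le> t") (auto simp: powr_mult exp_minus divide_inverse ennreal_mult[symmetric] mult_ac zero_le_mult_iff)
  qed
  also have "\<dots> = ennreal (m powr (z - 1)) * (\<integral>\<^sup>+a\<in>{0..}. ennreal (a powr (z - 1) * exp (- (m * a))) \<partial>lborel)"
    by (rule nn_integral_cmult) measurable
  finally have "ennreal (Gamma z) = ennreal (m * m powr (z - 1)) * (\<integral>\<^sup>+a\<in>{0..}. ennreal (a powr (z - 1) * exp (- (m * a))) \<partial>lborel)"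
    using m by (simp add: ennreal_mult mult.assoc)
  also have "m * m powr (z - 1) = m powr z" using m by (simp add: powr_mult_base)
  finally have "ennreal (1 / m powr z) * ennreal (Gamma z) = ennreal (1 / m powr z) * (ennreal (m powr z) * (\<integral>\<^sup>+a\<in>{0..}. ennreal (a powr (z - 1) * exp (- (m * a))) \<partial>lborel))"
    by simp
  also have "\<dots> = (\<integral>\<^sup>+a\<in>{0..}. ennreal (a powr (z - 1) * exp (- (m * a))) \<partial>lborel)"
    using m by (simp add: mult.assoc[symmetric] ennreal_mult[symmetric])
  finally show ?thesis using m z Gamma_real_pos[OF z] by (simp add: ennreal_mult[symmetric])
qed

text \<open>Both summands are Gamma integrals; together they give
  \<open>(p - 1) \<Gamma>(p) + \<Gamma>(p) = \<Gamma>(p + 1)\<close>.\<close>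

lemma nn_integral_Gamma_combined:
  fixes p :: real and m :: nat
  assumes p: "1 < p" and m: "0 < m"
  shows "(\<integral>\<^sup>+a\<in>{0<..}. ennreal ((p - 1) * a powr (p - 2) * exp (- a) ^ m * (a + 1 / m)) \<partial>lborel) =
    ennreal (Gamma (p + 1) / m powr p)"
proof -
  have G: "Gamma p = (p - 1) * Gamma (p - 1)" "Gamma (p + 1) = p * Gamma p"
    using p Gamma_plus1[of "p - 1"] Gamma_plus1[of p] by (auto simp: nonpos_Ints_def)
  have "(\<integral>\<^sup>+a\<in>{0<..}. ennreal ((p - 1) * a powr (p - 2) * exp (- a) ^ m * (a + 1 / m)) \<partial>lborel) =
     (\<integral>\<^sup>+a. ennreal (p - 1) * (ennreal (a powr (p - 1) * exp (- (real m * a))) * indicator {0..} a) +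
        ennreal ((p - 1) / m) * (ennreal (a powr ((p - 1) - 1) * exp (- (real m * a))) * indicator {0..} a) \<partial>lborel)"
    using AE_lborel_singleton[of 0]
  proof (intro nn_integral_cong_AE, eventually_elim)
    fix a :: real assume "a \<noteq> 0"
    have "(p - 1) * a powr (p - 2) * exp (- a) ^ m * (a + 1 / m) =
        (p - 1) * (a powr (p - 1) * exp (- (real m * a))) + (p - 1) / m * (a powr ((p - 1) - 1) * exp (- (real m * a)))"
      if "0 < a"
    proof -
      have "a powr (p - 1) = a * a powr (p - 2)" using that by (simp add: powr_mult_base)
      moreover have "exp (- a) ^ m = exp (- (real m * a))" by (simp add: exp_of_nat_mult[symmetric])
      ultimately show ?thesis by (simp add: algebra_simps diff_divide_distrib)
    qed
    then show "ennreal ((p - 1) * a powr (p - 2) * exp (- a) ^ m * (a + 1 / m)) * indicator {0<..} a =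
        ennreal (p - 1) * (ennreal (a powr (p - 1) * exp (- (real m * a))) * indicator {0..} a) +
        ennreal ((p - 1) / m) * (ennreal (a powr ((p - 1) - 1) * exp (- (real m * a))) * indicator {0..} a)"
      using p \<open>a \<noteq> 0\<close> by (cases "0 < a") (auto simp: ennreal_mult[symmetric] ennreal_plus[symmetric] simp del: ennreal_plus)
  qed
  also have "\<dots> = ennreal (p - 1) * ennreal (Gamma p / real m powr p) + ennreal ((p - 1) / m) * ennreal (Gamma (p - 1) / real m powr (p - 1))"
  proof -
    have "(\<integral>\<^sup>+a\<in>{0..}. ennreal (a powr (p - 1) * exp (- (real m * a))) \<partial>lborel) = ennreal (Gamma p / real m powr p)"
      "(\<integral>\<^sup>+a\<in>{0..}. ennreal (a powr ((p - 1) - 1) * exp (- (real m * a))) \<partial>lborel) = ennreal (Gamma (p - 1) / real m powr (p - 1))"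
      using p m by (intro nn_integral_Gamma_scaled; simp)+
    note G = this
    show ?thesis
      by (subst nn_integral_add, measurable, subst (1 2) nn_integral_cmult, measurable) (simp only: G)
  qed
  also have "\<dots> = ennreal ((p - 1) * (Gamma p / real m powr p) + (p - 1) / m * (Gamma (p - 1) / real m powr (p - 1)))"
    using p m Gamma_real_pos[of p] Gamma_real_pos[of "p - 1"] by (simp add: ennreal_mult[symmetric] ennreal_plus[symmetric] del: ennreal_plus)
  also have "(p - 1) * (Gamma p / real m powr p) + (p - 1) / m * (Gamma (p - 1) / real m powr (p - 1)) = Gamma (p + 1) / real m powr p"
  proof -
    have "real m powr p = m * real m powr (p - 1)" using m by (simp add: powr_mult_base)
    then have "(p - 1) / m * (Gamma (p - 1) / real m powr (p - 1)) = Gamma p / real m powr p" by (simp add: G)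
    then show ?thesis unfolding G(2) by (simp add: add_divide_distrib[symmetric] distrib_right[symmetric] left_diff_distrib)
  qed
  finally show ?thesis .
qed

section \<open>Interaction across a sphere\<close>

text \<open>For a radially decreasing function with logarithmic Lipschitz constant 1 this kernel, times the
  increment of the function, dominates the integrand of the seminorm. It is set to 0 unless \<open>y\<close> is closer to the
  origin than \<open>x\<close>; the other half is recovered by symmetry.\<close>

definition log_kernel :: "real \<Rightarrow> 'a::euclidean_space \<Rightarrow> 'a \<Rightarrow> ennreal" where
  "log_kernel p x y = (if norm y < norm x
     then ennreal (ln (norm x / norm y) powr (p - 1) / norm (x - y) ^ (2 * DIM('a))) else 0)"

text \<open>The layers that slice the power of the logarithm in \<open>log_kernel\<close>.\<close>

lemma nn_integral_power_layers:
  fixes p t :: real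
  assumes "1 < p" "0 \<le> t"
  shows "ennreal (t powr (p - 1)) = (\<integral>\<^sup>+a\<in>{0<..}. (if a \<le> t then ennreal ((p - 1) * a powr (p - 2)) else 0) \<partial>lborel)"
proof -
  have "((\<lambda>a. a powr (p - 2)) has_integral (t powr (p - 2 + 1) / (p - 2 + 1))) {0..t}"
    using assms by (intro has_integral_powr_from_0) auto
  then have "((\<lambda>a. (p - 1) * a powr (p - 2)) has_integral ((p - 1) * (t powr (p - 2 + 1) / (p - 2 + 1)))) {0..t}"
    by (rule has_integral_mult_right)
  moreover have "(p - 1) * (t powr (p - 2 + 1) / (p - 2 + 1)) = t powr (p - 1)"
    using assms by simp
  ultimately have "((\<lambda>a. (p - 1) * a powr (p - 2)) has_integral t powr (p - 1)) {0..t}" by simp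
  then have "ennreal (t powr (p - 1)) = (\<integral>\<^sup>+a. ennreal ((p - 1) * a powr (p - 2)) * indicator {0..t} a \<partial>lborel)"
    using assms by (intro nn_integral_has_integral_lebesgue'[symmetric]) auto
  also have "\<dots> = (\<integral>\<^sup>+a\<in>{0<..}. (if a \<le> t then ennreal ((p - 1) * a powr (p - 2)) else 0) \<partial>lborel)"
    using AE_lborel_singleton[of 0]
    by (intro nn_integral_cong_AE, eventually_elim) (auto split: split_indicator)
  finally show ?thesis .
qed

text \<open>Writing the power of the logarithm as an integral over \<open>a\<close> turns the condition
  \<open>a \<le> ln(|x| / |y|)\<close> into \<open>|y| \<le> |x| exp(- a)\<close>. For fixed \<open>x\<close> and \<open>a\<close>, the point \<open>y\<close> thus ranges over a ball
  around the origin that avoids \<open>x\<close>, whose contribution is known through inversion. The series of that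
  contribution is integrated termwise, first in \<open>x\<close> and then in \<open>a\<close>.\<close>

lemma log_kernel_across_sphere:
  fixes p r :: real
  assumes p: "1 < p" and r: "0 < r"
  shows "(\<integral>\<^sup>+x. (\<integral>\<^sup>+y. (if norm y < r \<and> r \<le> norm x then log_kernel p x y else 0) \<partial>lborel) \<partial>(lborel :: 'a::euclidean_space measure)) \<le>
    (\<Sum>n. ennreal (unit_ball_vol DIM('a) * (DIM('a) * unit_ball_vol DIM('a)) * negbin DIM('a) n *
      (Gamma (p + 1) / real (DIM('a) + 2 * n) powr p)))"
proof -
  let ?d = "DIM('a)"
  let ?w = "unit_ball_vol (real ?d)"
  have d: "0 < ?d" by simp
  let ?g = "\<lambda>(x::'a) a n. (if r \<le> norm x then ennreal (1 / norm x ^ ?d *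
      (min r (norm x * exp (- a)) / norm x) ^ (?d + 2 * n)) else 0)"
  let ?h = "\<lambda>a n. ennreal ((p - 1) * a powr (p - 2) * exp (- a) ^ (?d + 2 * n) * (a + 1 / real (?d + 2 * n)))"
  let ?k = "\<lambda>a n. ennreal (?d * ?w * exp (- a) ^ (?d + 2 * n) * (a + 1 / real (?d + 2 * n)))"
  define wt where "wt = (\<lambda>a::real. ennreal ((p - 1) * a powr (p - 2)) * indicator {0<..} a)"
  have [measurable]: "wt \<in> borel_measurable borel" unfolding wt_def by measurable
  \<comment> \<open>The radius of the ball to which \<open>y\<close> is confined by the sphere and by the layer \<open>a\<close>.\<close>
  define \<rho> where "\<rho> = (\<lambda>(x::'a) a. min r (norm x * exp (- a)))"
  define G :: "'a \<Rightarrow> 'a \<Rightarrow> real \<Rightarrow> ennreal" where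
    "G = (\<lambda>x y a. if norm y \<le> \<rho> x a \<and> norm y < r \<and> r \<le> norm x then ennreal (1 / norm (x - y) ^ (2 * ?d)) else 0)"
  have [measurable (raw)]: "(\<lambda>w. G (f w) (g w) (h w)) \<in> borel_measurable M"
    if [measurable]: "f \<in> borel_measurable M" "g \<in> borel_measurable M" "h \<in> borel_measurable M"
    for f g and h :: "'c \<Rightarrow> real" and M :: "'c measure"
    unfolding G_def \<rho>_def by measurable
  have split: "(if norm y < r \<and> r \<le> norm x then log_kernel p x y else 0) = (\<integral>\<^sup>+a. wt a * G x y a \<partial>lborel)"
    if y: "y \<noteq> 0" for x y :: 'a
  proof (cases "norm y < r \<and> r \<le> norm x")
    case False
    then have "G x y a = 0" for a by (auto simp: G_def)
    then show ?thesis using False by auto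
  next
    case True
    have ny: "0 < norm y" "norm y < norm x" using y True by auto
    then have nxy: "0 < norm x / norm y" by (intro divide_pos_pos) linarith+
    let ?t = "ln (norm x / norm y)"
    have iff: "norm y \<le> \<rho> x a \<longleftrightarrow> a \<le> ?t" for a
    proof -
      have "norm y \<le> \<rho> x a \<longleftrightarrow> norm y \<le> norm x * exp (- a)" using True by (auto simp: \<rho>_def)
      also have "\<dots> \<longleftrightarrow> exp a \<le> norm x / norm y" using ny by (simp add: exp_minus field_simps)
      also have "\<dots> \<longleftrightarrow> a \<le> ?t" using nxy by (subst ln_ge_iff) auto
      finally show ?thesis .
    qed
    have "(if norm y < r \<and> r \<le> norm x then log_kernel p x y else 0) =
        ennreal (?t powr (p - 1)) * ennreal (1 / norm (x - y) ^ (2 * ?d))"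
      using True ny by (simp add: log_kernel_def ennreal_mult[symmetric])
    also have "ennreal (?t powr (p - 1)) = (\<integral>\<^sup>+a\<in>{0<..}. (if a \<le> ?t then ennreal ((p - 1) * a powr (p - 2)) else 0) \<partial>lborel)"
      using ny p by (intro nn_integral_power_layers) auto
    also have "\<dots> * ennreal (1 / norm (x - y) ^ (2 * ?d)) =
       (\<integral>\<^sup>+a. ((if a \<le> ?t then ennreal ((p - 1) * a powr (p - 2)) else 0) * indicator {0<..} a) * ennreal (1 / norm (x - y) ^ (2 * ?d)) \<partial>lborel)"
      by (rule nn_integral_multc[symmetric]) measurable
    also have "\<dots> = (\<integral>\<^sup>+a. wt a * G x y a \<partial>lborel)"
      using True iff by (intro nn_integral_cong) (auto simp: wt_def G_def mult_ac split: split_indicator)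
    finally show ?thesis .
  qed
  have "(\<integral>\<^sup>+x. (\<integral>\<^sup>+y. (if norm y < r \<and> r \<le> norm x then log_kernel p x y else 0) \<partial>lborel) \<partial>(lborel :: 'a measure)) =
      (\<integral>\<^sup>+x. (\<integral>\<^sup>+y. (\<integral>\<^sup>+a. wt a * G x y a \<partial>lborel) \<partial>lborel) \<partial>lborel)"
  proof (rule nn_integral_cong)
    fix x :: 'a
    have "AE y in lborel. (if norm y < r \<and> r \<le> norm x then log_kernel p x y else 0) = (\<integral>\<^sup>+a. wt a * G x y a \<partial>lborel)"
      using AE_lborel_singleton[of "0::'a"] by (rule eventually_mono) (rule split)
    then show "(\<integral>\<^sup>+y. (if norm y < r \<and> r \<le> norm x then log_kernel p x y else 0) \<partial>lborel) =
        (\<integral>\<^sup>+y. (\<integral>\<^sup>+a. wt a * G x y a \<partial>lborel) \<partial>lborel)"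
      by (rule nn_integral_cong_AE)
  qed
  also have "\<dots> = (\<integral>\<^sup>+x. (\<integral>\<^sup>+a. (\<integral>\<^sup>+y. wt a * G x y a \<partial>lborel) \<partial>lborel) \<partial>lborel)"
    by (intro nn_integral_cong lborel_pair.Fubini') measurable
  also have "\<dots> = (\<integral>\<^sup>+a. (\<integral>\<^sup>+x. (\<integral>\<^sup>+y. wt a * G x y a \<partial>lborel) \<partial>lborel) \<partial>lborel)"
    by (intro lborel_pair.Fubini') measurable
  also have "\<dots> \<le> (\<integral>\<^sup>+a. wt a * (\<integral>\<^sup>+x. (\<Sum>n. ennreal (?w * negbin ?d n) * ?g x a n) \<partial>(lborel :: 'a measure)) \<partial>lborel)"
  proof (rule nn_integral_mono)
    fix a
    have inner: "(\<integral>\<^sup>+y. G x y a \<partial>lborel) \<le> (\<Sum>n. ennreal (?w * negbin ?d n) * ?g x a n)" if a: "0 < a" for x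
    proof (cases "r \<le> norm x")
      case False
      then show ?thesis by (simp add: G_def)
    next
      case True
      then have nx: "0 < norm x" using r by linarith
      have \<rho>: "0 < \<rho> x a" "\<rho> x a < norm x"
      proof -
        show "0 < \<rho> x a" using r nx by (simp add: \<rho>_def)
        have "norm x * exp (- a) < norm x * 1" using a nx by (intro mult_strict_left_mono) auto
        then show "\<rho> x a < norm x" by (simp add: \<rho>_def)
      qed
      have "(\<integral>\<^sup>+y. G x y a \<partial>lborel) \<le> (\<integral>\<^sup>+y\<in>ball 0 (\<rho> x a). ennreal (1 / norm (x - y) ^ (2 * ?d)) \<partial>lborel)"
      proof (rule nn_integral_mono_AE)
        have "sphere 0 (\<rho> x a) \<in> null_sets (lborel :: 'a measure)"
          using negligible_sphere[of "0 :: 'a" "\<rho> x a"] null_sets_completion_iff[of "sphere 0 (\<rho> x a) :: 'a set" lborel]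
          by (simp add: negligible_iff_null_sets)
        then have "AE y in (lborel :: 'a measure). y \<notin> sphere 0 (\<rho> x a)" by (rule AE_not_in)
        then show "AE y in lborel. G x y a \<le> ennreal (1 / norm (x - y) ^ (2 * ?d)) * indicator (ball 0 (\<rho> x a)) y"
          by (rule eventually_mono) (auto simp: G_def split: split_indicator)
      qed
      also have "\<dots> \<le> ennreal (?w * (\<rho> x a / ((norm x)\<^sup>2 - (\<rho> x a)\<^sup>2)) ^ ?d)"
        by (rule nn_integral_inverse_power_centered_ball_le[OF \<rho>])
      also have "\<dots> = (\<Sum>n. ennreal (?w / norm x ^ ?d * negbin ?d n * (\<rho> x a / norm x) ^ (?d + 2 * n)))"
        by (rule inverse_power_ball_series[OF \<rho>])
      also have "\<dots> = (\<Sum>n. ennreal (?w * negbin ?d n) * ?g x a n)"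
      proof (intro suminf_cong)
        fix n
        have "?w / norm x ^ ?d * negbin ?d n * (\<rho> x a / norm x) ^ (?d + 2 * n) =
            (?w * negbin ?d n) * (1 / norm x ^ ?d * (\<rho> x a / norm x) ^ (?d + 2 * n))" by simp
        moreover have "ennreal ((?w * negbin ?d n) * (1 / norm x ^ ?d * (\<rho> x a / norm x) ^ (?d + 2 * n))) =
            ennreal (?w * negbin ?d n) * ennreal (1 / norm x ^ ?d * (\<rho> x a / norm x) ^ (?d + 2 * n))"
          using \<rho> nx negbin_nonneg[of ?d n] by (intro ennreal_mult) auto
        ultimately show "ennreal (?w / norm x ^ ?d * negbin ?d n * (\<rho> x a / norm x) ^ (?d + 2 * n)) =
            ennreal (?w * negbin ?d n) * ?g x a n"
          using True unfolding \<rho>_def by simp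
      qed
      finally show ?thesis .
    qed
    have "(\<integral>\<^sup>+x. (\<integral>\<^sup>+y. wt a * G x y a \<partial>lborel) \<partial>lborel) = wt a * (\<integral>\<^sup>+x. (\<integral>\<^sup>+y. G x y a \<partial>lborel) \<partial>lborel)"
      by (simp add: nn_integral_cmult)
    also have "\<dots> \<le> wt a * (\<integral>\<^sup>+x. (\<Sum>n. ennreal (?w * negbin ?d n) * ?g x a n) \<partial>(lborel :: 'a measure))"
    proof (cases "0 < a")
      case True
      then show ?thesis by (intro mult_left_mono nn_integral_mono inner) auto
    qed (simp add: wt_def)
    finally show "(\<integral>\<^sup>+x. (\<integral>\<^sup>+y. wt a * G x y a \<partial>lborel) \<partial>lborel) \<le> wt a * (\<integral>\<^sup>+x. (\<Sum>n. ennreal (?w * negbin ?d n) * ?g x a n) \<partial>(lborel :: 'a measure))" .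
  qed
  also have "\<dots> = (\<integral>\<^sup>+a. (\<Sum>n. ennreal (?w * negbin ?d n * (?d * ?w)) *
      (?h a n * indicator {0<..} a)) \<partial>lborel)"
  proof (rule nn_integral_cong)
    fix a
    show "wt a * (\<integral>\<^sup>+x. (\<Sum>n. ennreal (?w * negbin ?d n) * ?g x a n) \<partial>(lborel :: 'a measure)) =
      (\<Sum>n. ennreal (?w * negbin ?d n * (?d * ?w)) *
      (?h a n * indicator {0<..} a))"
    proof (cases "0 < a")
      case True
      have "(\<integral>\<^sup>+x. (\<Sum>n. ennreal (?w * negbin ?d n) * ?g x a n) \<partial>(lborel :: 'a measure)) =
        (\<Sum>n. \<integral>\<^sup>+x. ennreal (?w * negbin ?d n) * ?g x a n \<partial>(lborel :: 'a measure))"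
        by (rule nn_integral_suminf) measurable
      also have "\<dots> = (\<Sum>n. ennreal (?w * negbin ?d n) * (\<integral>\<^sup>+x. ?g x a n \<partial>(lborel :: 'a measure)))"
        by (intro suminf_cong nn_integral_cmult) measurable
      also have "\<dots> = (\<Sum>n. ennreal (?w * negbin ?d n) * ?k a n)"
      proof (intro suminf_cong arg_cong2[of _ _ _ _ "(*)"] refl)
        fix n
        have ln_eq: "ln (1 / exp (- a)) = a" by (simp only: exp_minus divide_inverse inverse_inverse_eq mult_1 ln_exp)
        have "(\<integral>\<^sup>+x. ?g x a n \<partial>(lborel :: 'a measure)) =
          ennreal (?d * ?w * exp (- a) ^ (?d + 2 * n) * (ln (1 / exp (- a)) + 1 / real (?d + 2 * n)))"
        proof (rule nn_integral_outside_ball[OF r])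
          show "0 < exp (- a)" "exp (- a) < 1" using True by auto
          show "0 < ?d + 2 * n" using d by linarith
        qed
        then show "(\<integral>\<^sup>+x. ?g x a n \<partial>(lborel :: 'a measure)) =
          ?k a n"
          unfolding ln_eq .
      qed
      finally have integral_x: "(\<integral>\<^sup>+x. (\<Sum>n. ennreal (?w * negbin ?d n) * ?g x a n) \<partial>(lborel :: 'a measure)) =
        (\<Sum>n. ennreal (?w * negbin ?d n) * ?k a n)" .
      have "wt a * (\<Sum>n. ennreal (?w * negbin ?d n) * ?k a n) =
        (\<Sum>n. wt a * (ennreal (?w * negbin ?d n) * ?k a n))"
        by (rule ennreal_suminf_cmult[symmetric])
      also have "\<dots> = (\<Sum>n. ennreal (?w * negbin ?d n * (?d * ?w)) *
        (?h a n * indicator {0<..} a))"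
      proof (intro suminf_cong)
        fix n
        define Z where "Z = a + 1 / real (?d + 2 * n)"
        define X where "X = exp (- a) ^ (?d + 2 * n)"
        have Z: "0 \<le> Z" "0 \<le> X" using True by (simp_all add: Z_def X_def)
        show "wt a * (ennreal (?w * negbin ?d n) * ?k a n) =
          ennreal (?w * negbin ?d n * (?d * ?w)) *
          (?h a n * indicator {0<..} a)"
        proof -
          have "ennreal A * (ennreal B * ennreal (C * X * Z)) = ennreal (B * C) * ennreal (A * X * Z)"
            if "0 \<le> A" "0 \<le> B" "0 \<le> C" for A B C
          proof -
            have "ennreal (C * X * Z) = ennreal C * ennreal X * ennreal Z"
              "ennreal (A * X * Z) = ennreal A * ennreal X * ennreal Z" "ennreal (B * C) = ennreal B * ennreal C"
              using that Z by (simp_all only: ennreal_mult mult_nonneg_nonneg)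
            then show ?thesis by (simp only: mult_ac)
          qed
          from this[of "(p - 1) * a powr (p - 2)" "?w * negbin ?d n" "?d * ?w"] show ?thesis
            unfolding Z_def[symmetric] X_def[symmetric] using True p negbin_nonneg[of ?d n]
            by (simp only: wt_def indicator_simps greaterThan_iff mult_1_right mult_nonneg_nonneg powr_ge_zero
                unit_ball_vol_nonneg of_nat_0_le_iff less_imp_le diff_ge_0_iff_ge)
        qed
      qed
      finally show ?thesis unfolding integral_x .
    qed (simp add: wt_def)
  qed
  also have "\<dots> = (\<Sum>n. \<integral>\<^sup>+a. ennreal (?w * negbin ?d n * (?d * ?w)) *
      (?h a n * indicator {0<..} a) \<partial>lborel)"
    by (rule nn_integral_suminf) measurable
  also have "\<dots> = (\<Sum>n. ennreal (?w * negbin ?d n * (?d * ?w)) * ennreal (Gamma (p + 1) / real (?d + 2 * n) powr p))"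
  proof (intro suminf_cong)
    fix n
    show "(\<integral>\<^sup>+a. ennreal (?w * negbin ?d n * (?d * ?w)) *
      (?h a n * indicator {0<..} a) \<partial>lborel) =
      ennreal (?w * negbin ?d n * (?d * ?w)) * ennreal (Gamma (p + 1) / real (?d + 2 * n) powr p)"
      by (subst nn_integral_cmult, measurable, subst nn_integral_Gamma_combined[OF p]) auto
  qed
  also have "\<dots> = (\<Sum>n. ennreal (?w * (?d * ?w) * negbin ?d n * (Gamma (p + 1) / real (?d + 2 * n) powr p)))"
    using p Gamma_real_pos[of "p + 1"] negbin_nonneg[of ?d]
    by (intro suminf_cong) (subst ennreal_mult[symmetric], auto simp: mult_ac)
  finally show ?thesis .
qed

section \<open>Averages over annuli\<close>

text \<open>The integrand of the \<open>p\<close>-th power of the seminorm when \<open>s p\<close> equals the dimension.\<close>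

definition gagliardo :: "real \<Rightarrow> (real^'d \<Rightarrow> real) \<Rightarrow> real^'d \<Rightarrow> real^'d \<Rightarrow> ennreal" where
  "gagliardo p u x y = ennreal (\<bar>u x - u y\<bar> powr p / norm (x - y) powr (2 * real CARD('d)))"

abbreviation potential_on :: "real \<Rightarrow> (real^'d \<Rightarrow> real) \<Rightarrow> (real^'d) set \<Rightarrow> real^'d \<Rightarrow> ennreal" where
  "potential_on p u A x \<equiv> (\<integral>\<^sup>+z \<in> A. gagliardo p u x z \<partial>lebesgue)"

abbreviation potential :: "real \<Rightarrow> (real^'d \<Rightarrow> real) \<Rightarrow> real^'d \<Rightarrow> ennreal" where
  "potential p u x \<equiv> (\<integral>\<^sup>+ z. gagliardo p u x z \<partial>lebesgue)"

abbreviation energy_on :: "real \<Rightarrow> (real^'d \<Rightarrow> real) \<Rightarrow> (real^'d) set \<Rightarrow> ennreal" where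
  "energy_on p u A \<equiv> (\<integral>\<^sup>+x\<in>A. potential_on p u A x \<partial>lebesgue)"

abbreviation energy :: "real \<Rightarrow> (real^'d \<Rightarrow> real) \<Rightarrow> ennreal" where
  "energy p u \<equiv> (\<integral>\<^sup>+x. potential p u x \<partial>lebesgue)"

abbreviation mass_on :: "(real^'d) set \<Rightarrow> (real^'d \<Rightarrow> real) \<Rightarrow> ennreal" where
  "mass_on A u \<equiv> (\<integral>\<^sup>+ x \<in> A. ennreal \<bar>u x\<bar> \<partial>lebesgue)"

abbreviation hardy_mass :: "real \<Rightarrow> (real^'d) set \<Rightarrow> (real^'d) set \<Rightarrow> (real^'d \<Rightarrow> real) \<Rightarrow> ennreal" where
  "hardy_mass p K S u \<equiv> (\<integral>\<^sup>+ x \<in> S. ennreal (\<bar>u x\<bar> powr p / infdist x K ^ CARD('d)) \<partial>lebesgue)"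

text \<open>A substitute for the inequality of Jensen: averaging it over a set bounds a mean by a \<open>p\<close>-th mean,
  for a level \<open>t\<close> that can be chosen freely.\<close>

lemma le_threshold_plus_powr:
  fixes c t p :: real
  assumes "0 \<le> c" "0 < t" "1 \<le> p"
  shows "c \<le> t + t powr (1 - p) * c powr p"
proof (cases "c \<le> t")
  case True
  have "0 \<le> t powr (1 - p) * c powr p" by simp
  with True show ?thesis by linarith
next
  case False
  then have "c powr (1 - p) \<le> t powr (1 - p)"
    using assms by (intro powr_mono2') auto
  moreover have "c = c powr (1 - p) * c powr p"
    using False assms by (simp add: powr_add[symmetric])
  ultimately have "c \<le> t powr (1 - p) * c powr p"
    using mult_right_mono[of "c powr (1 - p)" "t powr (1 - p)" "c powr p"] by auto
  with assms show ?thesis by linarith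
qed

lemma borel_measurable_lebesgue_id [measurable]: "(\<lambda>x. x) \<in> lebesgue \<rightarrow>\<^sub>M (borel :: 'a::euclidean_space measure)"
  by (intro measurable_completion) simp

lemma borel_measurable_fst_snd_lebesgue [measurable]:
  "fst \<in> lebesgue \<Otimes>\<^sub>M lebesgue \<rightarrow>\<^sub>M (borel :: 'a::euclidean_space measure)"
  "snd \<in> lebesgue \<Otimes>\<^sub>M lebesgue \<rightarrow>\<^sub>M (borel :: 'a::euclidean_space measure)"
  using measurable_compose[OF measurable_fst borel_measurable_lebesgue_id]
    measurable_compose[OF measurable_snd borel_measurable_lebesgue_id] by auto

text \<open>Completion preserves sigma-finiteness, so the theorem of Tonelli is available for the product of two
  completed measures, as the iterated integrals over \<open>lebesgue\<close> require.\<close>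

interpretation lebesgue: sigma_finite_measure "lebesgue :: ('a::euclidean_space) measure"
proof
  obtain A :: "'a set set" where "countable A" "A \<subseteq> sets lborel" "\<Union>A = space lborel"
      "\<forall>a\<in>A. emeasure lborel a \<noteq> \<infinity>"
    using lborel.sigma_finite_countable by blast
  then show "\<exists>A::'a set set. countable A \<and> A \<subseteq> sets lebesgue \<and> \<Union>A = space lebesgue \<and>
      (\<forall>a\<in>A. emeasure lebesgue a \<noteq> \<infinity>)"
    by (intro exI[of _ A]) (auto simp: subset_iff)
qed

interpretation lebesgue_pair: pair_sigma_finite "lebesgue :: ('a::euclidean_space) measure" "lebesgue :: ('b::euclidean_space) measure"
  ..

lemma measurable_gagliardo_pair [measurable]:
  assumes [measurable]: "u \<in> borel_measurable lebesgue"
  shows "(\<lambda>(x, y). gagliardo p u x y) \<in> borel_measurable (lebesgue \<Otimes>\<^sub>M lebesgue)"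
  unfolding gagliardo_def by measurable

lemma measurable_gagliardo [measurable]:
  assumes [measurable]: "u \<in> borel_measurable lebesgue"
  shows "gagliardo p u x \<in> borel_measurable lebesgue"
    and "(\<lambda>y. gagliardo p u y x) \<in> borel_measurable lebesgue"
  unfolding gagliardo_def by measurable

lemma le_gagliardo:
  fixes u :: "real^'d \<Rightarrow> real"
  assumes "norm (x - y) \<le> \<rho>" "0 \<le> \<rho>"
  shows "ennreal (\<bar>u x - u y\<bar> powr p) \<le> ennreal (\<rho> ^ (2 * CARD('d))) * gagliardo p u x y"
proof (cases "x = y")
  case False
  then have n: "norm (x - y) > 0" by simp
  have "norm (x - y) powr (2 * real CARD('d)) = norm (x - y) ^ (2 * CARD('d))"
    using n by (simp add: powr_realpow[symmetric])
  moreover have "norm (x - y) ^ (2 * CARD('d)) \<le> \<rho> ^ (2 * CARD('d))"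
    using assms by (intro power_mono) auto
  ultimately have "\<bar>u x - u y\<bar> powr p \<le>
      \<rho> ^ (2 * CARD('d)) * (\<bar>u x - u y\<bar> powr p / norm (x - y) powr (2 * real CARD('d)))"
    using n mult_right_mono[of "norm (x - y) ^ (2 * CARD('d))" "\<rho> ^ (2 * CARD('d))" "\<bar>u x - u y\<bar> powr p"]
    by (simp add: field_simps)
  then show ?thesis
    unfolding gagliardo_def using assms by (subst ennreal_mult[symmetric]) (auto intro: ennreal_leI)
qed simp

text \<open>The mean of \<open>|u x - u z|\<close> over \<open>z \<in> A\<close> is estimated with \<open>le_threshold_plus_powr\<close>, and the power
  \<open>|u x - u z|\<^sup>p\<close> with the Gagliardo integrand, as \<open>|x - z| \<le> \<rho>\<close>.\<close>

lemma le_mean_plus_gagliardo: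
  fixes u :: "real^'d \<Rightarrow> real"
  assumes [measurable]: "u \<in> borel_measurable lebesgue" "A \<in> sets lebesgue"
    and a: "emeasure lebesgue A = ennreal a" "0 < a"
    and \<rho>: "\<And>z. z \<in> A \<Longrightarrow> norm (x - z) \<le> \<rho>" "0 \<le> \<rho>"
    and t: "0 < t" and p: "1 \<le> p"
  shows "ennreal \<bar>u x\<bar> \<le> ennreal (1 / a) * mass_on A u + ennreal t +
      ennreal (t powr (1 - p) * \<rho> ^ (2 * CARD('d)) / a) * potential_on p u A x"
proof -
  define c where "c = t powr (1 - p) * \<rho> ^ (2 * CARD('d))"
  have c: "0 \<le> c" using \<rho> by (simp add: c_def)
  have pw: "ennreal \<bar>u x\<bar> \<le> ennreal \<bar>u z\<bar> + ennreal t + ennreal c * gagliardo p u x z" if "z \<in> A" for z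
  proof -
    have "\<bar>u x\<bar> \<le> \<bar>u z\<bar> + (t + t powr (1 - p) * \<bar>u x - u z\<bar> powr p)"
      using le_threshold_plus_powr[of "\<bar>u x - u z\<bar>" t p] t p by linarith
    then have "ennreal \<bar>u x\<bar> \<le> ennreal \<bar>u z\<bar> + (ennreal t + ennreal (t powr (1 - p)) * ennreal (\<bar>u x - u z\<bar> powr p))"
      using t by (auto simp: ennreal_plus[symmetric] ennreal_mult[symmetric] simp del: ennreal_plus intro!: ennreal_leI)
    also have "\<dots> \<le> ennreal \<bar>u z\<bar> + (ennreal t + ennreal (t powr (1 - p)) *
        (ennreal (\<rho> ^ (2 * CARD('d))) * gagliardo p u x z))"
      by (intro add_left_mono mult_left_mono le_gagliardo \<rho> that) auto
    finally show ?thesis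
      using \<rho> by (simp add: c_def ennreal_mult mult.assoc add.assoc)
  qed
  have "ennreal \<bar>u x\<bar> * ennreal a = (\<integral>\<^sup>+z\<in>A. ennreal \<bar>u x\<bar> \<partial>lebesgue)"
    using a by (simp add: nn_integral_cmult_indicator)
  also have "\<dots> \<le> (\<integral>\<^sup>+z. ennreal \<bar>u z\<bar> * indicator A z + ennreal t * indicator A z +
      ennreal c * (gagliardo p u x z * indicator A z) \<partial>lebesgue)"
    using pw by (intro nn_integral_mono) (auto split: split_indicator)
  also have "\<dots> = mass_on A u + ennreal t * ennreal a +
      ennreal c * potential_on p u A x"
    using a by (simp add: nn_integral_add nn_integral_cmult nn_integral_cmult_indicator)
  finally have "ennreal (1 / a) * (ennreal \<bar>u x\<bar> * ennreal a) \<le> ennreal (1 / a) * \<dots>"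
    by (rule mult_left_mono) simp
  moreover have "ennreal (1 / a) * (X * ennreal a) = X" for X
    using a by (metis ennreal_1 ennreal_mult' less_imp_le mult.assoc mult.commute mult.right_neutral
        nonzero_eq_divide_eq order_less_irrefl zero_le_divide_1_iff)
  ultimately show ?thesis
    using c a by (simp add: distrib_left ennreal_mult[symmetric] mult.assoc[symmetric] c_def[symmetric])
qed

text \<open>The mean of \<open>le_mean_plus_gagliardo\<close> over \<open>x \<in> B\<close>.\<close>

lemma mean_le_mean_plus_gagliardo:
  fixes u :: "real^'d \<Rightarrow> real"
  assumes [measurable]: "u \<in> borel_measurable lebesgue" "A \<in> sets lebesgue" "B \<in> sets lebesgue"
    and a: "emeasure lebesgue A = ennreal a" "0 < a"
    and b: "emeasure lebesgue B = ennreal b" "0 < b"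
    and \<rho>: "\<And>x z. x \<in> B \<Longrightarrow> z \<in> A \<Longrightarrow> norm (x - z) \<le> \<rho>" "0 \<le> \<rho>"
    and t: "0 < t" and p: "1 \<le> p"
  shows "ennreal (1 / b) * mass_on B u \<le>
      ennreal (1 / a) * mass_on A u + ennreal t +
      ennreal (t powr (1 - p) * \<rho> ^ (2 * CARD('d)) / (a * b)) *
        (\<integral>\<^sup>+x\<in>B. potential_on p u A x \<partial>lebesgue)"
proof -
  define c where "c = t powr (1 - p) * \<rho> ^ (2 * CARD('d)) / a"
  have c: "0 \<le> c" using \<rho> a by (simp add: c_def)
  define m where "m = ennreal (1 / a) * mass_on A u + ennreal t"
  have [measurable]: "(\<lambda>x. potential_on p u A x) \<in> borel_measurable lebesgue"
    by (rule lebesgue.borel_measurable_nn_integral) measurable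
  have "(mass_on B u) \<le>
      (\<integral>\<^sup>+x. m * indicator B x + ennreal c * ((potential_on p u A x) * indicator B x) \<partial>lebesgue)"
    unfolding m_def c_def
    using le_mean_plus_gagliardo[OF assms(1,2) a \<rho> t p]
    by (intro nn_integral_mono) (auto split: split_indicator)
  also have "\<dots> = m * ennreal b + ennreal c * (\<integral>\<^sup>+x\<in>B. potential_on p u A x \<partial>lebesgue)"
    using b by (simp add: nn_integral_add nn_integral_cmult nn_integral_cmult_indicator)
  finally have "ennreal (1 / b) * mass_on B u \<le> ennreal (1 / b) * \<dots>"
    by (rule mult_left_mono) simp
  also have "\<dots> = ennreal (1 / b) * (m * ennreal b) +
      ennreal (1 / b) * (ennreal c * (\<integral>\<^sup>+x\<in>B. potential_on p u A x \<partial>lebesgue))"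
    by (rule distrib_left)
  also have "ennreal (1 / b) * (m * ennreal b) = m"
    using b by (metis ennreal_1 ennreal_mult' less_imp_le mult.assoc mult.commute mult.right_neutral
        nonzero_eq_divide_eq order_less_irrefl zero_le_divide_1_iff)
  finally show ?thesis
    using c b a unfolding m_def by (simp add: ennreal_mult[symmetric] mult.assoc[symmetric] c_def mult.commute[of b])
qed

definition annulus :: "'a::metric_space \<Rightarrow> real \<Rightarrow> nat \<Rightarrow> 'a set" where
  "annulus x R n = ball x (R / 2 ^ n) - ball x (R / 2 ^ Suc n)"

text \<open>The volume of an annulus of outer radius 1 and inner radius 1/2.\<close>

definition annulus_vol :: "nat \<Rightarrow> real" where
  "annulus_vol d = unit_ball_vol (real d) * (1 - 1 / 2 ^ d)"

lemma annulus_vol_pos: "0 < d \<Longrightarrow> 0 < annulus_vol d"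
  unfolding annulus_vol_def by (simp add: field_simps)

lemma sets_annulus [measurable]: "annulus x R n \<in> sets (borel :: 'a::euclidean_space measure)"
  unfolding annulus_def by measurable

lemma sets_lebesgue_annulus [measurable]: "annulus x R n \<in> sets (lebesgue :: 'a::euclidean_space measure)"
  by (simp add: sets_completionI_sets)

lemma emeasure_annulus:
  fixes x :: "real^'d"
  assumes "0 < R"
  shows "emeasure lebesgue (annulus x R n) = ennreal (annulus_vol CARD('d) * (R / 2 ^ n) ^ CARD('d))"
proof -
  have "emeasure lebesgue (annulus x R n) = emeasure lborel (ball x (R / 2 ^ n) - ball x (R / 2 ^ Suc n))"
    by (simp add: annulus_def)
  also have "\<dots> = emeasure lborel (ball x (R / 2 ^ n)) - emeasure lborel (ball x (R / 2 ^ Suc n))"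
    using assms by (intro emeasure_Diff subset_ball) (auto simp: field_simps emeasure_ball)
  also have "\<dots> = ennreal (unit_ball_vol CARD('d) * (R / 2 ^ n) ^ CARD('d) -
      unit_ball_vol CARD('d) * (R / 2 ^ Suc n) ^ CARD('d))"
    using assms by (subst (1 2) emeasure_ball) (auto simp: ennreal_minus)
  also have "unit_ball_vol CARD('d) * (R / 2 ^ n) ^ CARD('d) - unit_ball_vol CARD('d) * (R / 2 ^ Suc n) ^ CARD('d) =
      annulus_vol CARD('d) * (R / 2 ^ n) ^ CARD('d)"
    by (simp add: annulus_vol_def power_divide power_mult_distrib field_simps)
  finally show ?thesis .
qed

lemma annulus_disjoint:
  fixes x :: "'a::metric_space"
  assumes "0 < R" "y \<in> annulus x R m" "y \<in> annulus x R n"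
  shows "m = n"
proof (rule ccontr)
  assume "m \<noteq> n"
  then consider "Suc m \<le> n" | "Suc n \<le> m" by linarith
  then show False
  proof cases
    case 1
    then have "R / 2 ^ n \<le> R / 2 ^ Suc m"
      using assms(1) by (intro divide_left_mono power_increasing) auto
    then show False using assms by (auto simp: annulus_def)
  next
    case 2
    then have "R / 2 ^ m \<le> R / 2 ^ Suc n"
      using assms(1) by (intro divide_left_mono power_increasing) auto
    then show False using assms by (auto simp: annulus_def)
  qed
qed

text \<open>Comparing the means over consecutive annuli costs \<open>t\<close> per step plus a part of the double integral.
  These parts belong to disjoint sets of pairs, so they add up to at most the energy.\<close>

lemma chained_means:
  fixes u :: "real^'d \<Rightarrow> real"
  assumes [measurable]: "u \<in> borel_measurable lebesgue"
    and R: "0 < R" and t: "0 < t" and p: "1 \<le> p"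
  defines "v \<equiv> (\<lambda>n. annulus_vol CARD('d) * (R / 2 ^ n) ^ CARD('d))"
  shows "ennreal (1 / v N) * mass_on (annulus x R N) u \<le>
      ennreal (1 / v 0) * mass_on (annulus x R 0) u + ennreal (real N * t) +
      ennreal (t powr (1 - p) * 8 ^ CARD('d) / (annulus_vol CARD('d))\<^sup>2) *
        (energy p u)"
proof -
  define U where "U = (\<lambda>n. ennreal (1 / v n) * mass_on (annulus x R n) u)"
  define e where "e = (\<lambda>n. \<integral>\<^sup>+y\<in>annulus x R (Suc n). potential_on p u (annulus x R n) y \<partial>lebesgue)"
  define c where "c = t powr (1 - p) * 8 ^ CARD('d) / (annulus_vol CARD('d))\<^sup>2"
  have v: "0 < v n" for n using R by (simp add: v_def annulus_vol_pos)
  have en: "emeasure lebesgue (annulus x R n) = ennreal (v n)" for n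
    using emeasure_annulus[OF R] by (simp add: v_def)
  have step: "U (Suc n) \<le> U n + ennreal t + ennreal c * e n" for n
  proof -
    have "norm (y - z) \<le> 2 * (R / 2 ^ n)" if "y \<in> annulus x R (Suc n)" "z \<in> annulus x R n" for y z
    proof -
      have "dist x y < R / 2 ^ Suc n" "dist x z < R / 2 ^ n"
        using that by (auto simp: annulus_def)
      moreover have "R / 2 ^ Suc n \<le> R / 2 ^ n" using R by (simp add: field_simps)
      ultimately have "dist y z \<le> 2 * (R / 2 ^ n)"
        using dist_triangle3[of y z x] by linarith
      then show ?thesis by (simp add: dist_norm)
    qed
    then have "U (Suc n) \<le> U n + ennreal t +
        ennreal (t powr (1 - p) * (2 * (R / 2 ^ n)) ^ (2 * CARD('d)) / (v n * v (Suc n))) * e n"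
      unfolding U_def e_def using R
      by (intro mean_le_mean_plus_gagliardo[OF assms(1) _ _ en v en v _ _ t p]) auto
    moreover have "(2 * (R / 2 ^ n)) ^ (2 * CARD('d)) / (v n * v (Suc n)) = 8 ^ CARD('d) / (annulus_vol CARD('d))\<^sup>2"
    proof -
      define X where "X = R / 2 ^ n"
      have X: "X > 0" using R by (simp add: X_def)
      have 1: "v n = annulus_vol CARD('d) * X ^ CARD('d)" by (simp add: v_def X_def)
      have 2: "v (Suc n) = annulus_vol CARD('d) * (X ^ CARD('d) / 2 ^ CARD('d))"
        by (simp add: v_def X_def power_divide power_mult_distrib)
      have "(8::real) ^ CARD('d) = 4 ^ CARD('d) * 2 ^ CARD('d)"
        by (simp add: power_mult_distrib[symmetric])
      moreover have "(2 * X) ^ (2 * CARD('d)) = 4 ^ CARD('d) * (X ^ CARD('d) * X ^ CARD('d))"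
        by (simp add: power_mult_distrib power_mult power_even_eq power2_eq_square)
      ultimately show ?thesis
        unfolding X_def[symmetric] 1 2 using X annulus_vol_pos[of "CARD('d)"]
        by (simp add: field_simps power2_eq_square)
    qed
    ultimately show ?thesis
      unfolding c_def by (simp only: times_divide_eq_right[symmetric])
  qed
  have "U N \<le> U 0 + ennreal (real N * t) + ennreal c * (\<Sum>n<N. e n)"
  proof (induction N)
    case (Suc N)
    have "U (Suc N) \<le> (U 0 + ennreal (real N * t) + ennreal c * (\<Sum>n<N. e n)) + ennreal t + ennreal c * e N"
      using step[of N] Suc by (meson add_right_mono order_trans)
    also have "\<dots> = U 0 + (ennreal (real N * t) + ennreal t) + ennreal c * (\<Sum>n<Suc N. e n)"
      by (simp add: distrib_left add_ac)
    also have "ennreal (real N * t) + ennreal t = ennreal (real (Suc N) * t)"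
      using t by (simp add: ennreal_plus[symmetric] algebra_simps del: ennreal_plus)
    finally show ?case .
  qed simp
  moreover have "(\<Sum>n<N. e n) \<le> energy p u"
  proof -
    have [measurable]: "(\<lambda>y. potential_on p u (annulus x R n) y) \<in> borel_measurable lebesgue" for n
      by (rule lebesgue.borel_measurable_nn_integral) measurable
    have "(\<Sum>n<N. e n) = (\<integral>\<^sup>+y. (\<Sum>n<N. potential_on p u (annulus x R n) y *
        indicator (annulus x R (Suc n)) y) \<partial>lebesgue)"
      unfolding e_def by (subst nn_integral_sum) auto
    also have "\<dots> \<le> energy p u"
    proof (rule nn_integral_mono)
      fix y
      show "(\<Sum>n<N. potential_on p u (annulus x R n) y * indicator (annulus x R (Suc n)) y)
          \<le> potential p u y"
      proof (cases "\<exists>k<N. y \<in> annulus x R (Suc k)")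
        case True
        then obtain k where k: "k < N" "y \<in> annulus x R (Suc k)" by blast
        have "(\<Sum>n<N. potential_on p u (annulus x R n) y * indicator (annulus x R (Suc n)) y) =
          (\<Sum>n\<in>{k}. potential_on p u (annulus x R n) y * indicator (annulus x R (Suc n)) y)"
          using k annulus_disjoint[OF R k(2)]
          by (intro sum.mono_neutral_right) (auto simp: indicator_eq_0_iff)
        also have "\<dots> \<le> potential p u y"
          using k by (auto intro!: nn_integral_mono split: split_indicator)
        finally show ?thesis .
      qed (auto intro!: sum_nonneg sum.neutral)
    qed
    finally show ?thesis .
  qed
  ultimately have "U N \<le> U 0 + ennreal (real N * t) +
      ennreal c * energy p u"
    by (meson add_left_mono mult_left_mono order_trans zero_le)
  then show ?thesis unfolding U_def c_def .
qed

section \<open>Growth of a function of unit energy\<close>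

text \<open>\<open>N\<close> dyadic steps bring the mean to the scale at which the hypothesis on \<open>N\<close> bounds the deviation of
  \<open>u x\<close> from it. The threshold \<open>t\<close> is taken so that the \<open>N\<close> thresholds and the factor in front of the energy
  are both of order \<open>N\<^sup>1\<^sup>-\<^sup>1\<^sup>/\<^sup>p\<close>.\<close>

lemma growth_bound:
  fixes u :: "real^'d \<Rightarrow> real"
  assumes [measurable]: "u \<in> borel_measurable lebesgue"
    and R: "0 < R" and p: "1 < p" and h: "0 \<le> h"
    and energy: "energy p u \<le> 1"
    and mean: "ennreal (1 / (annulus_vol CARD('d) * R ^ CARD('d))) *
        (mass_on (annulus x R 0) u) \<le> ennreal h"
    and local: "ennreal (R ^ CARD('d)) * potential p u x \<le> ennreal (2 ^ (N * CARD('d)))"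
  shows "\<bar>u x\<bar> \<le> (h + 2 + 1 / annulus_vol CARD('d) + 8 ^ CARD('d) / (annulus_vol CARD('d))\<^sup>2) *
      (real N + 1) powr (1 - 1 / p)"
proof -
  define v where "v = (\<lambda>n. annulus_vol CARD('d) * (R / 2 ^ n) ^ CARD('d))"
  define \<kappa> where "\<kappa> = annulus_vol CARD('d)"
  define g where "g = potential p u x"
  have \<kappa>: "0 < \<kappa>" by (simp add: \<kappa>_def annulus_vol_pos)
  have v: "0 < v n" for n using R \<kappa> by (simp add: v_def \<kappa>_def)
  \<comment> \<open>With \<open>N + 1\<close> in place of \<open>N\<close> the threshold is also defined for \<open>N = 0\<close>.\<close>
  define M where "M = real N + 1"
  define t where "t = M powr (- 1 / p)"
  have M: "1 \<le> M" by (simp add: M_def)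
  then have t: "0 < t" by (simp add: t_def)
  have Nt: "real N * t \<le> M powr (1 - 1 / p)"
  proof -
    have "real N * t \<le> M * t" using t by (simp add: M_def)
    also have "M * t = M powr (1 - 1 / p)"
      using M by (simp add: t_def powr_diff powr_minus_divide)
    finally show ?thesis .
  qed
  have tp: "t powr (1 - p) = M powr (1 - 1 / p)"
  proof -
    have "- 1 / p * (1 - p) = 1 - 1 / p" using p by (simp add: field_simps)
    then show ?thesis by (simp only: t_def powr_powr)
  qed
  have 1: "ennreal \<bar>u x\<bar> \<le> ennreal (1 / v N) * mass_on (annulus x R N) u + ennreal 1 +
      ennreal (1 powr (1 - p) * (R / 2 ^ N) ^ (2 * CARD('d)) / v N) *
        (potential_on p u (annulus x R N) x)"
  proof (rule le_mean_plus_gagliardo)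
    show "norm (x - z) \<le> R / 2 ^ N" if "z \<in> annulus x R N" for z
      using that by (auto simp: annulus_def dist_norm)
  qed (use R p v emeasure_annulus[OF R, of x N] in \<open>simp_all add: v_def\<close>)
  have 2: "ennreal (1 / v N) * mass_on (annulus x R N) u \<le>
      ennreal h + ennreal (real N * t) + ennreal (t powr (1 - p) * 8 ^ CARD('d) / \<kappa>\<^sup>2)"
  proof -
    have "ennreal (1 / v N) * mass_on (annulus x R N) u \<le>
      ennreal (1 / v 0) * mass_on (annulus x R 0) u + ennreal (real N * t) +
      ennreal (t powr (1 - p) * 8 ^ CARD('d) / \<kappa>\<^sup>2) *
        (energy p u)"
      using chained_means[OF assms(1) R t, where p = p and x = x and N = N] p by (simp add: v_def \<kappa>_def)
    also have "\<dots> \<le> ennreal h + ennreal (real N * t) + ennreal (t powr (1 - p) * 8 ^ CARD('d) / \<kappa>\<^sup>2) * 1"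
      using mean by (intro add_mono mult_left_mono energy) (auto simp: v_def)
    finally show ?thesis by simp
  qed
  have 3: "ennreal (1 powr (1 - p) * (R / 2 ^ N) ^ (2 * CARD('d)) / v N) *
        (potential_on p u (annulus x R N) x) \<le> ennreal (1 / \<kappa>)"
  proof -
    define X where "X = (R / 2 ^ N) ^ CARD('d)"
    have X: "0 < X" "X = R ^ CARD('d) * (1 / 2 ^ (N * CARD('d)))"
      using R by (simp_all add: X_def power_divide power_mult)
    have "1 powr (1 - p) * (R / 2 ^ N) ^ (2 * CARD('d)) / v N = X * X / (\<kappa> * X)"
      unfolding v_def X_def \<kappa>_def mult_2 power_add by simp
    also have "\<dots> = 1 / \<kappa> * (1 / 2 ^ (N * CARD('d)) * R ^ CARD('d))"
      using X(1) \<kappa> by (simp add: X(2))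
    finally have "ennreal (1 powr (1 - p) * (R / 2 ^ N) ^ (2 * CARD('d)) / v N) *
        (potential_on p u (annulus x R N) x) \<le>
        ennreal (1 / \<kappa> * (1 / 2 ^ (N * CARD('d)) * R ^ CARD('d))) * g"
      unfolding g_def by (auto intro!: mult_left_mono nn_integral_mono split: split_indicator)
    also have "\<dots> = ennreal (1 / \<kappa>) * (ennreal (1 / 2 ^ (N * CARD('d))) * (ennreal (R ^ CARD('d)) * g))"
    proof -
      have "ennreal (a * (b * c)) * X = ennreal a * (ennreal b * (ennreal c * X))"
        if "0 \<le> a" "0 \<le> b" "0 \<le> c" for a b c X
        using that by (simp add: ennreal_mult mult.assoc)
      from this[of "1 / \<kappa>" "1 / 2 ^ (N * CARD('d))" "R ^ CARD('d)" g] show ?thesis using \<kappa> R by fastforce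
    qed
    also have "\<dots> \<le> ennreal (1 / \<kappa>) * (ennreal (1 / 2 ^ (N * CARD('d))) * ennreal (2 ^ (N * CARD('d))))"
      using local by (intro mult_left_mono) (auto simp: g_def)
    also have "\<dots> = ennreal (1 / \<kappa>)"
      by (subst ennreal_mult[symmetric]) auto
    finally show ?thesis .
  qed
  have "ennreal \<bar>u x\<bar> \<le> (ennreal h + ennreal (real N * t) + ennreal (t powr (1 - p) * 8 ^ CARD('d) / \<kappa>\<^sup>2)) +
      ennreal 1 + ennreal (1 / \<kappa>)"
    using 1 by (rule order_trans) (intro add_mono 2 3 order_refl)
  also have "\<dots> = ennreal (h + real N * t + t powr (1 - p) * 8 ^ CARD('d) / \<kappa>\<^sup>2 + 1 + 1 / \<kappa>)"
    using h t \<kappa> by (simp add: add_nonneg_nonneg flip: ennreal_plus ennreal_1)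
  finally have "\<bar>u x\<bar> \<le> h + real N * t + t powr (1 - p) * 8 ^ CARD('d) / \<kappa>\<^sup>2 + 1 + 1 / \<kappa>"
    using h t \<kappa> by (subst (asm) ennreal_le_iff) auto
  also have "\<dots> \<le> h * M powr (1 - 1 / p) + M powr (1 - 1 / p) + M powr (1 - 1 / p) * (8 ^ CARD('d) / \<kappa>\<^sup>2) +
      M powr (1 - 1 / p) + (1 / \<kappa>) * M powr (1 - 1 / p)"
  proof -
    have "1 \<le> M powr (1 - 1 / p)" using M p by (intro ge_one_powr_ge_zero) auto
    then show ?thesis
      using Nt h \<kappa> mult_left_mono[of 1 "M powr (1 - 1 / p)" h] mult_left_mono[of 1 "M powr (1 - 1 / p)" "1 / \<kappa>"]
      unfolding tp by simp
  qed
  finally show ?thesis by (simp add: M_def \<kappa>_def algebra_simps)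
qed

text \<open>The function \<open>Phi\<close> is a Taylor remainder of the exponential, of an order \<open>m \<ge> p - 1\<close>; this is why it is
  small enough at 0 to be compared with a \<open>p\<close>-th power.\<close>

lemma Phi_bounds:
  fixes d :: nat and s t :: real
  assumes "1 < real d / s" "0 \<le> t"
  defines "m \<equiv> (LEAST j::nat. real j \<ge> real d / s) - 1"
  shows "0 \<le> Phi d s t" "Phi d s t \<le> exp t" "Phi d s t \<le> t ^ m * exp t" "real d / s - 1 \<le> real m"
    and "Phi d s t = exp t - (\<Sum>i<m. t ^ i / fact i)"
proof -
  define j where "j = (LEAST j::nat. real j \<ge> real d / s)"
  have "real j \<ge> real d / s"
    unfolding j_def by (rule LeastI_ex) (rule real_arch_simple)
  then have "2 \<le> j" using assms(1) by linarith
  then have m: "{0..j - 2} = {..<m}" "real m = real j - 1"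
    by (auto simp: m_def j_def[symmetric])
  with \<open>real j \<ge> real d / s\<close> show "real d / s - 1 \<le> real m" by simp
  show eq: "Phi d s t = exp t - (\<Sum>i<m. t ^ i / fact i)"
    by (simp add: Phi_def j_def[symmetric] m Let_def)
  obtain r where r: "\<bar>r\<bar> \<le> \<bar>t\<bar>" "exp t = (\<Sum>i<m. t ^ i / fact i) + exp r / fact m * t ^ m"
    using Maclaurin_exp_le by blast
  then have rem: "Phi d s t = exp r / fact m * t ^ m" by (simp add: eq)
  then show "0 \<le> Phi d s t" using assms(2) by simp
  show "Phi d s t \<le> exp t" using eq assms(2) by (simp add: sum_nonneg)
  have "exp r / fact m \<le> exp t / 1"
    using r(1) assms(2) by (intro frac_le) auto
  then show "Phi d s t \<le> t ^ m * exp t"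
    unfolding rem using assms(2) mult_right_mono[of "exp r / fact m" "exp t" "t ^ m"] by (simp add: mult.commute)
qed

text \<open>If \<open>G \<le> 1\<close>, then \<open>a\<close> is bounded and \<open>Phi\<close> is dominated by the \<open>p\<close>-th power of \<open>a\<close>. Otherwise the least
  admissible \<open>N\<close> satisfies \<open>2\<^sup>N\<^sup>d \<le> 2\<^sup>d G\<close>, and the exponential is at most \<open>2\<^sup>d 2\<^sup>N\<^sup>d\<close>.\<close>

lemma Phi_growth:
  fixes d :: nat and s \<alpha> B :: real
  assumes p: "p = real d / s" "1 < p" and \<alpha>: "0 \<le> \<alpha>" "\<alpha> * B \<le> real d * ln 2"
  shows "\<exists>C\<ge>0. \<forall>a G. 0 \<le> a \<longrightarrow> 0 \<le> G \<longrightarrow>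
      (\<forall>N::nat. G \<le> 2 ^ (N * d) \<longrightarrow> a powr (p / (p - 1)) \<le> B * (real N + 1)) \<longrightarrow>
      Phi d s (\<alpha> * a powr (p / (p - 1))) \<le> C * (a powr p + G)"
proof -
  define m where "m = (LEAST j::nat. real j \<ge> real d / s) - 1"
  define D where "D = real d * ln 2"
  have d: "0 < d" using p by (intro Nat.gr0I) auto
  have expD: "exp D = 2 ^ d" "exp (D * (real N + 1)) = 2 ^ d * 2 ^ (N * d)" for N
    using powr_realpow[of 2 d] powr_realpow[of 2 "N * d"]
    by (auto simp: D_def powr_def algebra_simps exp_add)
  define C1 where "C1 = D powr (real m - (p - 1)) * \<alpha> powr (p - 1) * 2 ^ d"
  have C1: "0 \<le> C1" by (simp add: C1_def)
  show ?thesis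
  proof (intro exI[of _ "C1 + 4 ^ d"] conjI allI impI)
    fix a G :: real
    assume a: "0 \<le> a" and G: "0 \<le> G"
      and bound: "\<forall>N::nat. G \<le> 2 ^ (N * d) \<longrightarrow> a powr (p / (p - 1)) \<le> B * (real N + 1)"
    define t where "t = \<alpha> * a powr (p / (p - 1))"
    have t: "0 \<le> t" using \<alpha> by (simp add: t_def)
    have tN: "t \<le> D * (real N + 1)" if "G \<le> 2 ^ (N * d)" for N
    proof -
      have "t \<le> \<alpha> * (B * (real N + 1))"
        unfolding t_def using bound that \<alpha> by (intro mult_left_mono) auto
      also have "\<dots> \<le> D * (real N + 1)"
        unfolding mult.assoc[symmetric] D_def by (intro mult_right_mono \<alpha>) auto
      finally show ?thesis .
    qed
    note Phi = Phi_bounds[of d s t, folded p(1), folded m_def[unfolded p(1)[symmetric]], OF p(2) t]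
    have "Phi d s t \<le> C1 * a powr p + 4 ^ d * G"
    proof (cases "G \<le> 1")
      case True
      then have tD: "t \<le> D" using tN[of 0] by simp
      have "t ^ m \<le> D powr (real m - (p - 1)) * (\<alpha> powr (p - 1) * a powr p)"
      proof (cases "t = 0")
        case True
        have "0 < m" using Phi(4) p(2) by (cases m) (auto simp: m_def p(1))
        then show ?thesis using True by (simp add: power_0_left)
      next
        case False
        then have "t ^ m = t powr (real m - (p - 1)) * t powr (p - 1)"
          using t by (simp add: powr_add[symmetric] powr_realpow)
        also have "\<dots> \<le> D powr (real m - (p - 1)) * t powr (p - 1)"
          using Phi(4) t tD by (intro mult_right_mono powr_mono2) (auto simp: m_def p(1))
        also have "t powr (p - 1) = \<alpha> powr (p - 1) * a powr p"
          using \<alpha> p(2) by (simp add: t_def powr_mult powr_powr)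
        finally show ?thesis .
      qed
      then have "t ^ m * exp t \<le> (D powr (real m - (p - 1)) * (\<alpha> powr (p - 1) * a powr p)) * exp D"
        using tD t by (intro mult_mono) auto
      then have "Phi d s t \<le> C1 * a powr p"
        using Phi(3) unfolding C1_def expD(1) by (simp add: m_def p(1) mult_ac)
      then show ?thesis using G by (simp add: add_increasing2)
    next
      case False
      define N where "N = (LEAST N::nat. G \<le> 2 ^ (N * d))"
      have ex: "\<exists>N::nat. G \<le> 2 ^ (N * d)"
      proof -
        obtain k :: nat where "G < 2 ^ k" using real_arch_pow[of 2 G] by auto
        also have "(2::real) ^ k \<le> 2 ^ (k * d)" using d by (intro power_increasing) auto
        finally show ?thesis by (intro exI[of _ k]) simp
      qed
      then have GN: "G \<le> 2 ^ (N * d)" unfolding N_def by (rule LeastI_ex)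
      with False have "N \<noteq> 0" by (auto intro: ccontr)
      then obtain k where k: "N = Suc k" by (cases N) auto
      then have "\<not> G \<le> 2 ^ (k * d)" using not_less_Least[of k "\<lambda>N. G \<le> 2 ^ (N * d)"] by (simp add: N_def)
      then have "2 ^ (N * d) \<le> 2 ^ d * G" by (simp add: k power_add)
      have "Phi d s t \<le> exp t" by (rule Phi(2))
      also have "\<dots> \<le> exp (D * (real N + 1))" using tN[OF GN] by simp
      also have "\<dots> = 2 ^ d * 2 ^ (N * d)" by (rule expD)
      also have "\<dots> \<le> 2 ^ d * (2 ^ d * G)" by (intro mult_left_mono) (fact, simp)
      also have "\<dots> = 4 ^ d * G" by (simp add: power_mult_distrib[symmetric] mult.assoc[symmetric])
      finally show ?thesis using C1 by (simp add: add_increasing)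
    qed
    also have "\<dots> \<le> (C1 + 4 ^ d) * (a powr p + G)"
      using C1 G by (simp add: algebra_simps)
    finally show "Phi d s (\<alpha> * a powr (p / (p - 1))) \<le> (C1 + 4 ^ d) * (a powr p + G)"
      by (simp add: t_def)
  qed (use C1 in auto)
qed

section \<open>Compact sets of class \<open>C\<^sup>0\<^sup>,\<^sup>1\<close>\<close>

text \<open>The Lipschitz seminorm is a genuine supremum because the quotients are bounded above.\<close>

lemma ratio_le_C01_norm:
  fixes f :: "'a::real_normed_vector \<Rightarrow> 'b::real_normed_vector"
  assumes f: "in_C01 S f" and xy: "x \<in> S" "y \<in> S" "x \<noteq> y"
  shows "norm (f x - f y) / norm (x - y) \<le> C01_norm S f"
proof -
  let ?D = "{(x, y). x \<in> S \<and> y \<in> S \<and> x \<noteq> y}"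
  let ?q = "\<lambda>(x, y). norm (f x - f y) / norm (x - y)"
  obtain L where L: "L-lipschitz_on S f" using f by (auto simp: in_C01_def)
  have "bdd_above (?q ` ?D)"
    using lipschitz_onD[OF L] by (intro bdd_aboveI2[of _ _ L]) (auto simp: dist_norm divide_simps)
  then have "?q (x, y) \<le> (SUP z\<in>?D. ?q z)"
    using xy by (intro cSUP_upper) auto
  moreover have "norm (f x) \<le> (SUP x\<in>S. norm (f x))"
    using f xy by (intro cSUP_upper bounded_imp_bdd_above) (auto simp: in_C01_def bounded_norm_comp image_image[symmetric])
  then have "0 \<le> (SUP x\<in>S. norm (f x))" by (rule order_trans[rotated]) simp
  ultimately show ?thesis by (simp add: C01_norm_def)
qed

text \<open>The two norms are nonnegative, so a bound on their sum makes both the chart and its inverse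
  Lipschitz with one constant that serves for all charts.\<close>

lemma bi_Lipschitz_charts:
  fixes K \<Omega> :: "(real^'d) set"
  assumes "C01_codim k \<Omega> K"
  obtains J :: "'d set" and C :: real where "card J = k" "1 \<le> C"
    "\<And>x. x \<in> K \<Longrightarrow> \<exists>r>0. \<exists>T. T ` model_domain J = ball x r \<and>
        (\<forall>\<xi>\<in>model_domain J. \<forall>\<eta>\<in>model_domain J. dist (T \<xi>) (T \<eta>) \<le> C * dist \<xi> \<eta> \<and> dist \<xi> \<eta> \<le> C * dist (T \<xi>) (T \<eta>)) \<and>
        (\<forall>\<xi>\<in>model_domain J. T \<xi> \<in> K \<longleftrightarrow> (\<forall>i\<in>J. \<xi> $ i = 0))"
proof -
  obtain J :: "'d set" and C0 where J: "card J = k" and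
    ch: "\<forall>x\<in>K. \<exists>r>0. \<exists>(T :: real^'d \<Rightarrow> real^'d) T'.
       bij_betw T (model_domain J) (ball x r) \<and> (\<forall>\<xi>\<in>model_domain J. T' (T \<xi>) = \<xi>) \<and>
       in_C01 (closure (model_domain J)) T \<and> in_C01 (closure (ball x r)) T' \<and>
       C01_norm (closure (model_domain J)) T + C01_norm (closure (ball x r)) T' \<le> C0 \<and>
       {\<xi>\<in>model_domain J. T \<xi> \<in> ball x r \<inter> K} = {\<xi>\<in>model_domain J. \<forall>i\<in>J. \<xi> $ i = 0} \<and>
       (\<exists>C1>0. \<exists>C2>0. \<forall>\<xi>\<in>model_domain J. T \<xi> \<in> (\<Omega> - K) \<inter> ball x r \<longrightarrow>
                 C1 * L2_set (($) \<xi>) J \<le> infdist (T \<xi>) K \<and>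
                 infdist (T \<xi>) K \<le> C2 * L2_set (($) \<xi>) J)"
    using assms unfolding C01_codim_def Let_def by (elim exE conjE) (rule that; assumption)
  show ?thesis
  proof (rule that[OF J, of "max C0 1"])
    fix x assume "x \<in> K"
    from bspec[OF ch this] obtain r T T' where r: "0 < r" and bij: "bij_betw T (model_domain J) (ball x r)"
      and inv: "\<And>\<xi>. \<xi> \<in> model_domain J \<Longrightarrow> T' (T \<xi>) = \<xi>"
      and C01: "in_C01 (closure (model_domain J)) T" "in_C01 (closure (ball x r)) T'"
      and norms: "C01_norm (closure (model_domain J)) T + C01_norm (closure (ball x r)) T' \<le> C0"
      and K: "{\<xi>\<in>model_domain J. T \<xi> \<in> ball x r \<inter> K} = {\<xi>\<in>model_domain J. \<forall>i\<in>J. \<xi> $ i = 0}"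
      by (elim exE conjE) (rule that; (assumption | blast))
    let ?Q = "model_domain J"
    have im: "T ` ?Q = ball x r" using bij by (simp add: bij_betw_def)
    have cQ: "\<And>\<xi>. \<xi> \<in> ?Q \<Longrightarrow> \<xi> \<in> closure ?Q" "\<And>y. y \<in> ball x r \<Longrightarrow> y \<in> closure (ball x r)"
      using closure_subset by blast+
    have both: "0 \<le> C01_norm (closure ?Q) T" "0 \<le> C01_norm (closure (ball x r)) T'" 
    proof -
      have "x \<in> ball x r" "x + (r / 2) *\<^sub>R axis undefined 1 \<in> ball x r" "x \<noteq> x + (r / 2) *\<^sub>R axis undefined 1"
        using r by (auto simp: dist_norm axis_eq_0_iff)
      then obtain y where y: "x \<in> ball x r" "y \<in> ball x r" "x \<noteq> y" by metis
      then obtain \<xi> \<eta> where "\<xi> \<in> ?Q" "\<eta> \<in> ?Q" "T \<xi> = x" "T \<eta> = y" "\<xi> \<noteq> \<eta>"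
        using im by (metis imageE)
      then show "0 \<le> C01_norm (closure ?Q) T"
        using order_trans[OF _ ratio_le_C01_norm[OF C01(1) cQ(1) cQ(1)]] by (metis divide_nonneg_nonneg norm_ge_zero)
      show "0 \<le> C01_norm (closure (ball x r)) T'"
        using order_trans[OF _ ratio_le_C01_norm[OF C01(2) cQ(2) cQ(2)]] y by (metis divide_nonneg_nonneg norm_ge_zero)
    qed
    have lip: "dist (T \<xi>) (T \<eta>) \<le> max C0 1 * dist \<xi> \<eta>" if "\<xi> \<in> ?Q" "\<eta> \<in> ?Q" for \<xi> \<eta>
    proof (cases "\<xi> = \<eta>")
      case False
      then have "norm (T \<xi> - T \<eta>) / norm (\<xi> - \<eta>) \<le> max C0 1"
        using ratio_le_C01_norm[OF C01(1) cQ(1)[OF that(1)] cQ(1)[OF that(2)]] both norms by linarith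
      then show ?thesis using False by (simp add: dist_norm field_simps)
    qed simp
    have lip': "dist (T' y) (T' z) \<le> max C0 1 * dist y z" if "y \<in> ball x r" "z \<in> ball x r" for y z
    proof (cases "y = z")
      case False
      then have "norm (T' y - T' z) / norm (y - z) \<le> max C0 1"
        using ratio_le_C01_norm[OF C01(2) cQ(2)[OF that(1)] cQ(2)[OF that(2)]] both norms by linarith
      then show ?thesis using False by (simp add: dist_norm field_simps)
    qed simp
    have "dist \<xi> \<eta> \<le> max C0 1 * dist (T \<xi>) (T \<eta>)" if "\<xi> \<in> ?Q" "\<eta> \<in> ?Q" for \<xi> \<eta>
      using lip'[of "T \<xi>" "T \<eta>"] that inv imageI[of _ ?Q T, unfolded im] by simp
    moreover have "T \<xi> \<in> K \<longleftrightarrow> (\<forall>i\<in>J. \<xi> $ i = 0)" if "\<xi> \<in> ?Q" for \<xi>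
    proof -
      have "T \<xi> \<in> ball x r" using im that by auto
      then show ?thesis using K that by blast
    qed
    ultimately show "\<exists>r>0. \<exists>T. T ` ?Q = ball x r \<and>
        (\<forall>\<xi>\<in>?Q. \<forall>\<eta>\<in>?Q. dist (T \<xi>) (T \<eta>) \<le> max C0 1 * dist \<xi> \<eta> \<and> dist \<xi> \<eta> \<le> max C0 1 * dist (T \<xi>) (T \<eta>)) \<and>
        (\<forall>\<xi>\<in>?Q. T \<xi> \<in> K \<longleftrightarrow> (\<forall>i\<in>J. \<xi> $ i = 0))"
      using r im lip by (intro exI[of _ r] exI[of _ T]) blast
  qed simp
qed

text \<open>Near each of its points, \<open>K\<close> is the Lipschitz image of a piece of a hyperplane.\<close>

lemma negligible_C01_codim:
  fixes K \<Omega> :: "(real^'d) set"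
  assumes "C01_codim k \<Omega> K" "0 < k"
  shows "negligible K"
proof -
  obtain J :: "'d set" and C where J: "card J = k" and
    ch: "\<And>x. x \<in> K \<Longrightarrow> \<exists>r>0. \<exists>T. T ` model_domain J = ball x r \<and>
        (\<forall>\<xi>\<in>model_domain J. \<forall>\<eta>\<in>model_domain J. dist (T \<xi>) (T \<eta>) \<le> C * dist \<xi> \<eta> \<and> dist \<xi> \<eta> \<le> C * dist (T \<xi>) (T \<eta>)) \<and>
        (\<forall>\<xi>\<in>model_domain J. T \<xi> \<in> K \<longleftrightarrow> (\<forall>i\<in>J. \<xi> $ i = 0))"
    by (rule bi_Lipschitz_charts[OF assms(1)]) (rule that; assumption)
  obtain j where j: "j \<in> J" using J assms(2) by (metis card.empty ex_in_conv less_irrefl)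
  have "\<exists>r>0. negligible (K \<inter> ball x r)" if xK: "x \<in> K" for x
  proof -
    let ?Q = "model_domain J"
    obtain r T where r: "0 < r" and im: "T ` ?Q = ball x r"
      and lip: "\<And>\<xi> \<eta>. \<xi> \<in> ?Q \<Longrightarrow> \<eta> \<in> ?Q \<Longrightarrow> dist (T \<xi>) (T \<eta>) \<le> C * dist \<xi> \<eta>"
      and K: "\<And>\<xi>. \<xi> \<in> ?Q \<Longrightarrow> T \<xi> \<in> K \<longleftrightarrow> (\<forall>i\<in>J. \<xi> $ i = 0)"
      using ch[OF xK] by (elim exE conjE) (rule that; (assumption | blast))
    let ?S = "{\<xi> \<in> ?Q. \<xi> $ j = 0}"
    have "negligible {\<xi> :: real^'d. axis j 1 \<bullet> \<xi> = 0}"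
      by (rule negligible_hyperplane) (auto simp: axis_eq_0_iff)
    then have "negligible ?S"
      by (rule negligible_subset) (auto simp: inner_axis inner_commute)
    then have "negligible (T ` ?S)"
    proof (rule negligible_locally_Lipschitz_image[rotated])
      show "\<exists>U B. open U \<and> \<xi> \<in> U \<and> (\<forall>\<eta>\<in>?S \<inter> U. norm (T \<eta> - T \<xi>) \<le> B * norm (\<eta> - \<xi>))" if "\<xi> \<in> ?S" for \<xi>
        using lip that by (intro exI[of _ UNIV] exI[of _ C]) (auto simp: dist_norm)
    qed simp
    moreover have "K \<inter> ball x r \<subseteq> T ` ?S" using im K j by fastforce
    ultimately show ?thesis using r negligible_subset by blast
  qed
  then have "\<forall>x\<in>K. \<exists>U. x \<in> U \<and> openin (top_of_set K) U \<and> negligible U"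
    by (metis IntI Int_commute centre_in_ball open_ball openin_open_Int)
  then show ?thesis
    by (intro locally_negligible_alt[THEN iffD2]) metis
qed

text \<open>The chart at \<open>x\<close> carries a grid of \<open>m\<^sup>d\<^sup>-\<^sup>k\<close> points in the coordinates that parametrise \<open>K\<close> to separated points
  of \<open>K\<close>. In every such coordinate the grid starts at \<open>x\<close> and runs towards the farther end of the unit
  interval, so it stays inside the chart no matter where \<open>x\<close> lies.\<close>

lemma packing_C01_codim:
  fixes K \<Omega> :: "(real^'d) set"
  assumes "C01_codim k \<Omega> K"
  obtains c r0 :: real where "0 < c" "c \<le> 1" "0 < r0"
    "\<And>x r m. x \<in> K \<Longrightarrow> 0 < r \<Longrightarrow> r \<le> r0 \<Longrightarrow> 0 < m \<Longrightarrow> \<exists>P. finite P \<and> P \<subseteq> K \<inter> cball x r \<and>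
       card P = m ^ (CARD('d) - k) \<and> (\<forall>y\<in>P. \<forall>z\<in>P. y \<noteq> z \<longrightarrow> c * r / real m \<le> dist y z)"
proof -
  obtain J :: "'d set" and C where J: "card J = k" and C: "1 \<le> C" and
    ch: "\<And>x. x \<in> K \<Longrightarrow> \<exists>r>0. \<exists>T. T ` model_domain J = ball x r \<and>
        (\<forall>\<xi>\<in>model_domain J. \<forall>\<eta>\<in>model_domain J. dist (T \<xi>) (T \<eta>) \<le> C * dist \<xi> \<eta> \<and> dist \<xi> \<eta> \<le> C * dist (T \<xi>) (T \<eta>)) \<and>
        (\<forall>\<xi>\<in>model_domain J. T \<xi> \<in> K \<longleftrightarrow> (\<forall>i\<in>J. \<xi> $ i = 0))"
    by (rule bi_Lipschitz_charts[OF assms(1)]) (rule that; assumption)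
  define D where "D = real CARD('d)"
  have D: "1 \<le> D" by (simp add: D_def)
  show ?thesis
  proof (rule that[of "1 / (C\<^sup>2 * D)" "C * D / 2"])
    show "0 < 1 / (C\<^sup>2 * D)" "0 < C * D / 2" using C D by auto
    have "1 * 1 \<le> C\<^sup>2 * D" using C D by (intro mult_mono) auto
    then show "1 / (C\<^sup>2 * D) \<le> 1" by simp
    fix x r and m :: nat assume "x \<in> K" and r: "0 < r" "r \<le> C * D / 2" and m: "0 < m"
    let ?Q = "model_domain J"
    obtain r1 T where r1: "0 < r1" and im: "T ` ?Q = ball x r1"
      and lip: "\<And>\<xi> \<eta>. \<xi> \<in> ?Q \<Longrightarrow> \<eta> \<in> ?Q \<Longrightarrow> dist (T \<xi>) (T \<eta>) \<le> C * dist \<xi> \<eta>"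
      and lip': "\<And>\<xi> \<eta>. \<xi> \<in> ?Q \<Longrightarrow> \<eta> \<in> ?Q \<Longrightarrow> dist \<xi> \<eta> \<le> C * dist (T \<xi>) (T \<eta>)"
      and K: "\<And>\<xi>. \<xi> \<in> ?Q \<Longrightarrow> T \<xi> \<in> K \<longleftrightarrow> (\<forall>i\<in>J. \<xi> $ i = 0)"
      using ch[OF \<open>x \<in> K\<close>] by (elim exE conjE) (rule that; (assumption | blast))
    have "x \<in> T ` ?Q" using r1 im by simp
    then obtain \<xi> where \<xi>: "\<xi> \<in> ?Q" "T \<xi> = x" by auto
    with K \<open>x \<in> K\<close> have \<xi>0: "\<xi> $ i = 0" if "i \<in> J" for i using that by auto
    have \<xi>1: "0 < \<xi> $ i" "\<xi> $ i < 1" if "i \<notin> J" for i using that \<xi> by (auto simp: model_domain_def)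
    define h where "h = r / (C * D)"
    have h: "0 < h" "h \<le> 1 / 2" using r C D by (auto simp: h_def field_simps)
    \<comment> \<open>The direction of the grid in each coordinate, and its points.\<close>
    define \<sigma> :: "'d \<Rightarrow> real" where "\<sigma> = (\<lambda>i. if \<xi> $ i < 1 / 2 then 1 else -1)"
    define g where "g = (\<lambda>n :: 'd \<Rightarrow> nat. \<chi> i. if i \<in> J then 0 else \<xi> $ i + \<sigma> i * (h * (real (n i) / real m)))"
    let ?N = "PiE (- J) (\<lambda>_. {..<m})"
    have frac: "0 \<le> h * (real (n i) / real m)" "h * (real (n i) / real m) < h"
      if "n \<in> ?N" "i \<notin> J" for n i
    proof -
      have "n i < m" using that by (auto simp: PiE_iff)
      then have "real (n i) / real m < 1" by simp
      then show "0 \<le> h * (real (n i) / real m)" "h * (real (n i) / real m) < h"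
        using h mult_strict_left_mono[of "real (n i) / real m" 1 h] by auto
    qed
    have gQ: "g n \<in> ?Q" if n: "n \<in> ?N" for n
    proof -
      have "L2_set (($) (g n)) J = 0" by (auto simp: g_def L2_set_def)
      moreover have "0 < g n $ i \<and> g n $ i < 1" if "i \<notin> J" for i
      proof -
        define q where "q = h * (real (n i) / real m)"
        have "g n $ i = (if \<xi> $ i < 1 / 2 then \<xi> $ i + q else \<xi> $ i - q)"
          using that by (simp add: g_def \<sigma>_def q_def)
        moreover have "0 \<le> q" "q < h" using frac[OF n that] by (auto simp: q_def)
        ultimately show ?thesis using \<xi>1[OF that] h by (auto split: if_splits)
      qed
      ultimately show ?thesis by (auto simp: model_domain_def)
    qed
    have TgK: "T (g n) \<in> K" if "n \<in> ?N" for n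
      using K[OF gQ[OF that]] by (simp add: g_def)
    have near: "dist x (T (g n)) \<le> r" if n: "n \<in> ?N" for n
    proof -
      have "dist \<xi> (g n) \<le> (\<Sum>i\<in>UNIV. \<bar>(\<xi> - g n) $ i\<bar>)"
        unfolding dist_norm by (rule norm_le_l1_cart)
      also have "\<dots> \<le> (\<Sum>i\<in>(UNIV :: 'd set). h)"
        using frac[OF n] \<xi>0 h by (intro sum_mono) (auto simp: g_def \<sigma>_def abs_mult less_imp_le)
      finally have "dist \<xi> (g n) \<le> D * h" by (simp add: D_def)
      then have "C * dist \<xi> (g n) \<le> C * (D * h)" using C by (intro mult_left_mono) auto
      also have "\<dots> = r" using C D by (simp add: h_def)
      finally show ?thesis using lip[OF \<xi>(1) gQ[OF n]] \<xi>(2) by simp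
    qed
    have sep: "1 / (C\<^sup>2 * D) * r / real m \<le> dist (T (g n)) (T (g n'))"
      if n: "n \<in> ?N" "n' \<in> ?N" "n \<noteq> n'" for n n'
    proof -
      obtain i where i: "i \<notin> J" "n i \<noteq> n' i" using PiE_ext[of n "- J" _ n'] n by blast
      have "h / real m * 1 \<le> h / real m * \<bar>real (n i) - real (n' i)\<bar>"
        using i h by (intro mult_left_mono) auto
      also have "\<dots> = \<bar>(g n - g n') $ i\<bar>"
      proof -
        have "(g n - g n') $ i = \<sigma> i * (h / real m * (real (n i) - real (n' i)))"
          using i by (simp add: g_def algebra_simps diff_divide_distrib)
        then show ?thesis using h by (simp add: abs_mult \<sigma>_def)
      qed
      also have "\<dots> \<le> dist (g n) (g n')"
        unfolding dist_norm by (rule component_le_norm_cart)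
      also have "\<dots> \<le> C * dist (T (g n)) (T (g n'))"
        by (rule lip'[OF gQ gQ]) (use n in auto)
      finally have "h / real m / C \<le> dist (T (g n)) (T (g n'))"
        using C by (subst pos_divide_le_eq) (auto simp: mult.commute)
      also have "h / real m / C = 1 / (C\<^sup>2 * D) * r / real m"
        by (simp add: h_def power2_eq_square)
      finally show ?thesis .
    qed
    have "inj_on (\<lambda>n. T (g n)) ?N"
    proof (rule inj_onI, rule ccontr)
      fix n n' assume n: "n \<in> ?N" "n' \<in> ?N" "T (g n) = T (g n')" "n \<noteq> n'"
      have "1 / (C\<^sup>2 * D) * r / real m \<le> 0" using sep[OF n(1,2,4)] n(3) by simp
      moreover have "0 < 1 / (C\<^sup>2 * D) * r / real m" using C D r m by simp
      ultimately show False by linarith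
    qed
    then have "card ((\<lambda>n. T (g n)) ` ?N) = card ?N" by (rule card_image)
    also have "\<dots> = m ^ card (- J)" by (simp add: card_PiE)
    also have "card (- J) = CARD('d) - k" using J by (simp add: Compl_eq_Diff_UNIV card_Diff_subset)
    finally show "\<exists>P. finite P \<and> P \<subseteq> K \<inter> cball x r \<and> card P = m ^ (CARD('d) - k) \<and>
        (\<forall>y\<in>P. \<forall>z\<in>P. y \<noteq> z \<longrightarrow> 1 / (C\<^sup>2 * D) * r / real m \<le> dist y z)"
    proof (intro exI[of _ "(\<lambda>n. T (g n)) ` ?N"] conjI ballI impI)
      show "finite ((\<lambda>n. T (g n)) ` ?N)" by (intro finite_imageI finite_PiE) auto
      show "(\<lambda>n. T (g n)) ` ?N \<subseteq> K \<inter> cball x r"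
      proof (rule image_subsetI)
        fix n assume "n \<in> ?N"
        then show "T (g n) \<in> K \<inter> cball x r" using TgK[of n] near[of n] by simp
      qed
      fix y z assume y: "y \<in> (\<lambda>n. T (g n)) ` ?N" and z: "z \<in> (\<lambda>n. T (g n)) ` ?N" and "y \<noteq> z"
      from y obtain n where n: "n \<in> ?N" "y = T (g n)" by (rule imageE)
      from z obtain n' where n': "n' \<in> ?N" "z = T (g n')" by (rule imageE)
      from n n' \<open>y \<noteq> z\<close> have "n \<noteq> n'" by (intro notI) simp
      then show "1 / (C\<^sup>2 * D) * r / real m \<le> dist y z" using sep[OF n(1) n'(1)] n n' by simp
    qed
  qed
qed

section \<open>A Hardy inequality near the compact set\<close>

lemma powr_add_le:
  fixes a b p :: real
  assumes "0 \<le> a" "0 \<le> b" "0 \<le> p"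
  shows "(a + b) powr p \<le> 2 powr p * (a powr p + b powr p)"
proof -
  have "(a + b) powr p \<le> (2 * max a b) powr p" using assms by (intro powr_mono2) auto
  also have "\<dots> = 2 powr p * max a b powr p" using assms by (subst powr_mult) auto
  also have "max a b powr p \<le> a powr p + b powr p" by (simp add: max_def)
  finally show ?thesis by simp
qed

text \<open>Points of \<open>K\<close> that are \<open>c \<delta>(x) / m\<close> apart, with \<open>\<delta>(x)\<close> the distance of \<open>x\<close> to \<open>K\<close>, are centres of disjoint balls of half that
  radius. There are \<open>m\<^sup>d\<^sup>-\<^sup>k\<close> such points near \<open>x\<close>, and each ball has volume of order
  \<open>(\<delta>(x) / m)\<^sup>d\<close>.\<close>

lemma emeasure_near_K:
  fixes K :: "(real^'d) set"
  assumes K: "compact K" "K \<noteq> {}" and neg: "negligible K" and c: "0 < c" "c \<le> 1" and k: "k \<le> CARD('d)"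
    and pack: "\<And>x r m. x \<in> K \<Longrightarrow> 0 < r \<Longrightarrow> r \<le> r0 \<Longrightarrow> 0 < m \<Longrightarrow> \<exists>P. finite P \<and> P \<subseteq> K \<inter> cball x r \<and>
       card P = m ^ (CARD('d) - k) \<and> (\<forall>y\<in>P. \<forall>z\<in>P. y \<noteq> z \<longrightarrow> c * r / real m \<le> dist y z)"
    and x: "0 < infdist x K" "infdist x K \<le> r0" and m: "0 < m"
  shows "ennreal (unit_ball_vol CARD('d) * (c / 2) ^ CARD('d) / real m ^ k * infdist x K ^ CARD('d)) \<le>
    emeasure lebesgue {y. y \<notin> K \<and> dist x y \<le> 3 * infdist x K \<and> infdist y K < infdist x K / real m}"
    (is "_ \<le> emeasure lebesgue ?E")
proof -
  let ?d = "CARD('d)"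
  define \<delta> where "\<delta> = infdist x K"
  have \<delta>: "0 < \<delta>" "\<delta> \<le> r0" using x by (simp_all add: \<delta>_def)
  define \<rho> where "\<rho> = c * \<delta> / real m / 2"
  have \<rho>: "0 < \<rho>" using c \<delta> m by (simp add: \<rho>_def)
  have \<rho>2: "\<rho> < \<delta> / real m" "\<delta> / real m \<le> \<delta>"
  proof -
    define q where "q = \<delta> / real m"
    have q: "0 < q" "\<rho> = c * q / 2" using \<delta> m by (simp_all add: q_def \<rho>_def)
    moreover have "c * q \<le> 1 * q" using c q by (intro mult_right_mono) auto
    ultimately show "\<rho> < \<delta> / real m" unfolding q_def[symmetric] by linarith
    have "\<delta> / real m \<le> \<delta> / 1" using \<delta> m by (intro divide_left_mono) auto
    then show "\<delta> / real m \<le> \<delta>" by simp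
  qed
  obtain x0 where x0: "x0 \<in> K" "dist x x0 = \<delta>"
    using infdist_attains_inf[OF compact_imp_closed[OF K(1)] K(2)] unfolding \<delta>_def by metis
  obtain P where P: "finite P" "P \<subseteq> K \<inter> cball x0 \<delta>" "card P = m ^ (?d - k)"
    and sep: "\<And>y z. y \<in> P \<Longrightarrow> z \<in> P \<Longrightarrow> y \<noteq> z \<Longrightarrow> c * \<delta> / real m \<le> dist y z"
    using pack[OF x0(1) \<delta> m] by blast
  have disj: "disjoint_family_on (\<lambda>y. ball y \<rho>) P"
  proof (unfold disjoint_family_on_def, intro ballI impI)
    fix y z assume yz: "y \<in> P" "z \<in> P" "y \<noteq> z"
    have "w \<notin> ball y \<rho> \<inter> ball z \<rho>" for w
    proof
      assume "w \<in> ball y \<rho> \<inter> ball z \<rho>"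
      then have "dist y w < \<rho>" "dist z w < \<rho>" by auto
      then have "dist y z < 2 * \<rho>" using dist_triangle2[of y z w] by linarith
      then show False using sep[OF yz] by (simp add: \<rho>_def)
    qed
    then show "ball y \<rho> \<inter> ball z \<rho> = {}" by blast
  qed
  have sub: "(\<Union>y\<in>P. ball y \<rho>) - K \<subseteq> ?E"
  proof
    fix z assume "z \<in> (\<Union>y\<in>P. ball y \<rho>) - K"
    then obtain y where y: "y \<in> P" "dist y z < \<rho>" "z \<notin> K" by auto
    then have yK: "y \<in> K" "dist x0 y \<le> \<delta>" using P(2) by auto
    have "dist x z \<le> dist x x0 + dist x0 y + dist y z"
      using dist_triangle[of x z x0] dist_triangle[of x0 z y] by linarith
    also have "\<dots> \<le> 3 * \<delta>" using x0 yK y(2) \<rho>2 by linarith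
    finally have "dist x z \<le> 3 * \<delta>" .
    moreover have "infdist z K \<le> dist z y" by (rule infdist_le[OF yK(1)])
    then have "infdist z K < \<delta> / real m" using y(2) \<rho>2 by (simp add: dist_commute)
    ultimately show "z \<in> ?E" using y(3) by (simp add: \<delta>_def)
  qed
  have meas: "?E \<in> sets lebesgue"
  proof -
    have "?E = - K \<inter> (cball x (3 * infdist x K) \<inter> {y. infdist y K < infdist x K / real m})" by auto
    moreover have "open {y. infdist y K < infdist x K / real m}"
      by (intro open_Collect_less continuous_intros)
    ultimately show ?thesis
      using K(1) by (auto intro!: sets.Int sets_completionI_sets borel_open open_Int open_Compl compact_imp_closed)
  qed
  have "real m ^ (?d - k) * (unit_ball_vol ?d * \<rho> ^ ?d) =
      unit_ball_vol ?d * (c / 2) ^ ?d / real m ^ k * \<delta> ^ ?d"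
  proof -
    have "real m ^ ?d = real m ^ (?d - k) * real m ^ k" using k by (simp add: power_add[symmetric])
    then have "real m ^ (?d - k) * (1 / real m ^ ?d) = 1 / real m ^ k" using m by (simp add: field_simps)
    moreover have "\<rho> ^ ?d = (c / 2) ^ ?d * \<delta> ^ ?d * (1 / real m ^ ?d)"
      by (simp add: \<rho>_def power_divide power_mult_distrib)
    then have "real m ^ (?d - k) * (unit_ball_vol ?d * \<rho> ^ ?d) =
        (real m ^ (?d - k) * (1 / real m ^ ?d)) * (unit_ball_vol ?d * ((c / 2) ^ ?d * \<delta> ^ ?d))"
      by (simp only: mult_ac)
    ultimately show ?thesis by simp
  qed
  then have "ennreal (unit_ball_vol ?d * (c / 2) ^ ?d / real m ^ k * \<delta> ^ ?d) =
      (\<Sum>y\<in>P. emeasure lborel (ball y \<rho>))"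
    using \<rho> P(3) by (simp add: emeasure_ball ennreal_of_nat_eq_real_of_nat ennreal_mult[symmetric])
  also have "\<dots> = emeasure lborel (\<Union>y\<in>P. ball y \<rho>)"
    using P(1) disj by (intro sum_emeasure) auto
  also have "\<dots> = emeasure lebesgue (\<Union>y\<in>P. ball y \<rho>)"
  proof -
    have "(\<Union>y\<in>P. ball y \<rho>) \<in> sets lborel" by (auto intro!: borel_open)
    then show ?thesis by simp
  qed
  also have "\<dots> = emeasure lebesgue ((\<Union>y\<in>P. ball y \<rho>) - K)"
  proof -
    have "open (\<Union>y\<in>P. ball y \<rho>)" by auto
    then show ?thesis
      using neg by (intro emeasure_Diff_null_set[symmetric])
        (auto simp: negligible_iff_null_sets intro!: sets_completionI_sets borel_open)
  qed
  also have "\<dots> \<le> emeasure lebesgue ?E" by (rule emeasure_mono[OF sub meas])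
  finally show ?thesis by (simp add: \<delta>_def)
qed

text \<open>For \<open>x\<close> near \<open>K\<close>, compare \<open>\<phi> x\<close> with the values of \<open>\<phi>\<close> on the set \<open>E x\<close> of points that are \<open>m\<close> times closer to
  \<open>K\<close>. The differences are controlled by the energy. In the other term the order of integration is exchanged:
  a point \<open>y\<close> lies in \<open>E x\<close> only if the distance of \<open>x\<close> to \<open>K\<close> is at least both \<open>m\<close> times that of \<open>y\<close> and
  \<open>|x - y| / 3\<close>, and integrating over such \<open>x\<close> gives back the weighted mass with a factor of order
  \<open>m\<^sup>k\<^sup>-\<^sup>d\<close>. For large \<open>m\<close> it is at most 1/2 and is absorbed, which is legitimate because the mass is finite for a
  bounded function that vanishes near \<open>K\<close>.\<close>

lemma hardy_near_compact:
  fixes K :: "(real^'d) set"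
  assumes K: "compact K" "K \<noteq> {}" and neg: "negligible K" and c: "0 < c" "c \<le> 1" and k: "k < CARD('d)"
    and pack: "\<And>x r m. x \<in> K \<Longrightarrow> 0 < r \<Longrightarrow> r \<le> r0 \<Longrightarrow> 0 < m \<Longrightarrow> \<exists>P. finite P \<and> P \<subseteq> K \<inter> cball x r \<and>
       card P = m ^ (CARD('d) - k) \<and> (\<forall>y\<in>P. \<forall>z\<in>P. y \<noteq> z \<longrightarrow> c * r / real m \<le> dist y z)"
    and p: "1 \<le> p"
  defines "N \<equiv> {x. 0 < infdist x K \<and> infdist x K < r0}"
  obtains C :: real where "0 < C"
    "\<And>\<phi> b \<eta>. \<phi> \<in> borel_measurable lebesgue \<Longrightarrow> (\<And>x. \<bar>\<phi> x\<bar> \<le> b) \<Longrightarrow> 0 < \<eta> \<Longrightarrow>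
      (\<And>x. infdist x K < \<eta> \<Longrightarrow> \<phi> x = 0) \<Longrightarrow>
      (hardy_mass p K N \<phi>) \<le>
      ennreal C * energy_on p \<phi> N"
proof -
  let ?d = "CARD('d)"
  define \<delta> where "\<delta> = (\<lambda>x. infdist x K)"
  define w where "w = unit_ball_vol (real ?d)"
  have w: "0 < w" by (simp add: w_def)
  define c2 where "c2 = w * (c / 2) ^ ?d"
  have c2: "0 < c2" using w c by (simp add: c2_def)
  \<comment> \<open>Large enough for the transported mass to be absorbed, see \<open>small\<close>.\<close>
  obtain m :: nat where m': "2 * (2 powr p / c2 * (2 * w * 3 ^ ?d)) < real m"
    using reals_Archimedean2 by blast
  define Y where "Y = 2 powr p / c2 * (2 * w * 3 ^ ?d)"
  have Y: "0 < Y" using w c2 by (simp add: Y_def)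
  with m' have m: "0 < m" unfolding Y_def[symmetric] by (intro gr0I) auto
  define B where "B = 2 powr p * real m ^ k / c2"
  have B: "0 < B" using c2 m by (simp add: B_def)
  have small: "B * (2 * w * 3 ^ ?d / real m ^ ?d) \<le> 1 / 2"
  proof -
    have "real m ^ (k + 1) \<le> real m ^ ?d" using k m by (intro power_increasing) auto
    then have "real m ^ k / real m ^ ?d \<le> 1 / real m" using m by (simp add: field_simps)
    then have "Y * (real m ^ k / real m ^ ?d) \<le> Y * (1 / real m)" using Y by (intro mult_left_mono) auto
    also have "\<dots> \<le> 1 / 2" using m'[folded Y_def] m by (simp add: field_simps)
    finally show ?thesis by (simp add: B_def Y_def field_simps)
  qed
  have \<delta>0: "0 < \<delta> x \<longleftrightarrow> x \<notin> K" for x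
    using infdist_nonneg[of x K] in_closed_iff_infdist_zero[OF compact_imp_closed[OF K(1)] K(2), of x]
    by (auto simp: \<delta>_def less_le)
  have [measurable]: "\<delta> \<in> borel_measurable borel"
    unfolding \<delta>_def by (intro borel_measurable_continuous_onI continuous_intros)
  have [measurable]: "N \<in> sets lebesgue"
  proof -
    have "N = {x. 0 < \<delta> x \<and> \<delta> x < r0}" by (simp add: N_def \<delta>_def)
    also have "\<dots> \<in> sets borel" by measurable
    finally show ?thesis by (simp add: sets_completionI_sets)
  qed
  define E where "E = (\<lambda>x. {y. y \<notin> K \<and> dist x y \<le> 3 * \<delta> x \<and> \<delta> y < \<delta> x / real m})"
  define I :: "real^'d \<Rightarrow> real^'d \<Rightarrow> ennreal" where "I = (\<lambda>x y. if x \<in> N \<and> y \<in> E x then 1 else 0)"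
  have I_meas [measurable]: "(\<lambda>(x, y). I x y) \<in> borel_measurable (lebesgue \<Otimes>\<^sub>M lebesgue)"
  proof -
    have "I x y = (if 0 < \<delta> x \<and> \<delta> x < r0 \<and> 0 < \<delta> y \<and> dist x y \<le> 3 * \<delta> x \<and> \<delta> y < \<delta> x / real m then 1 else 0)" for x y
    proof -
      have "x \<in> N \<longleftrightarrow> 0 < \<delta> x \<and> \<delta> x < r0" by (simp add: N_def \<delta>_def)
      then show ?thesis using \<delta>0[of y] by (simp add: I_def E_def)
    qed
    then show ?thesis by simp
  qed
  have I_meas1 [measurable]: "I x \<in> borel_measurable lebesgue" "(\<lambda>x. I x y) \<in> borel_measurable lebesgue" for x y
    using measurable_Pair2[OF I_meas, of x] measurable_Pair1[OF I_meas, of y] by auto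
  have E_N: "y \<in> N" if "x \<in> N" "y \<in> E x" for x y
  proof -
    have "\<delta> x / real m \<le> \<delta> x / 1"
      using that m by (intro divide_left_mono) (auto simp: N_def \<delta>_def)
    then show ?thesis using that \<delta>0[of y] by (auto simp: E_def N_def \<delta>_def)
  qed
  have inner: "(\<integral>\<^sup>+x. I x y * ennreal (1 / \<delta> x ^ (2 * ?d)) \<partial>lebesgue) \<le>
      ennreal (2 * w * 3 ^ ?d / real m ^ ?d) * ennreal (1 / \<delta> y ^ ?d)" if y: "y \<in> N" for y
  proof -
    have \<delta>y: "0 < \<delta> y" using y by (simp add: N_def \<delta>_def)
    define \<rho> where "\<rho> = 3 * (real m * \<delta> y)"
    have \<rho>: "0 < \<rho>" using \<delta>y m by (simp add: \<rho>_def)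
    have "(\<integral>\<^sup>+x. I x y * ennreal (1 / \<delta> x ^ (2 * ?d)) \<partial>lebesgue) \<le>
        (\<integral>\<^sup>+x. ennreal (9 ^ ?d) * ennreal (1 / max \<rho> (norm (x - y)) ^ (2 * ?d)) \<partial>lebesgue)"
    proof (rule nn_integral_mono)
      fix x
      show "I x y * ennreal (1 / \<delta> x ^ (2 * ?d)) \<le> ennreal (9 ^ ?d) * ennreal (1 / max \<rho> (norm (x - y)) ^ (2 * ?d))"
      proof (cases "x \<in> N \<and> y \<in> E x")
        case True
        then have "max \<rho> (norm (x - y)) \<le> 3 * \<delta> x"
          using m by (auto simp: E_def \<rho>_def dist_norm field_simps)
        then have "max \<rho> (norm (x - y)) ^ (2 * ?d) \<le> (3 * \<delta> x) ^ (2 * ?d)"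
          using \<rho> by (intro power_mono) auto
        also have "\<dots> = 9 ^ ?d * \<delta> x ^ (2 * ?d)" by (simp add: power_mult_distrib power_mult)
        finally have le: "max \<rho> (norm (x - y)) ^ (2 * ?d) \<le> 9 ^ ?d * \<delta> x ^ (2 * ?d)" .
        have "0 < \<delta> x" using True by (simp add: N_def \<delta>_def)
        then have "1 / \<delta> x ^ (2 * ?d) \<le> 9 ^ ?d * (1 / max \<rho> (norm (x - y)) ^ (2 * ?d))"
          using le \<rho> by (simp add: field_simps)
        then show ?thesis using True by (simp add: I_def ennreal_mult[symmetric] ennreal_leI)
      qed (auto simp: I_def)
    qed
    also have "\<dots> = ennreal (9 ^ ?d) * (\<integral>\<^sup>+x. ennreal (1 / max \<rho> (norm (x - y)) ^ (2 * ?d)) \<partial>lborel)"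
      by (subst nn_integral_cmult) (auto simp: nn_integral_completion)
    also have "\<dots> = ennreal (9 ^ ?d) * ennreal (2 * w / \<rho> ^ ?d)"
      using nn_integral_truncated_kernel[OF \<rho>, of y] by (simp add: w_def)
    also have "\<dots> = ennreal (2 * w * 3 ^ ?d / real m ^ ?d * (1 / \<delta> y ^ ?d))"
    proof -
      have "(9::real) ^ ?d = 3 ^ ?d * 3 ^ ?d" by (simp add: power_mult_distrib[symmetric])
      then have "9 ^ ?d * (2 * w / \<rho> ^ ?d) = 2 * w * 3 ^ ?d / real m ^ ?d * (1 / \<delta> y ^ ?d)"
        by (simp add: \<rho>_def power_mult_distrib)
      then show ?thesis using w \<rho> by (simp add: ennreal_mult[symmetric])
    qed
    also have "\<dots> = ennreal (2 * w * 3 ^ ?d / real m ^ ?d) * ennreal (1 / \<delta> y ^ ?d)"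
      using w \<delta>y by (subst ennreal_mult) auto
    finally show ?thesis .
  qed
  show ?thesis
  proof (rule that[of "2 * (B * 9 ^ ?d)"])
    show "0 < 2 * (B * 9 ^ ?d)" using B by simp
    fix \<phi> :: "real^'d \<Rightarrow> real" and b \<eta> :: real
    assume [measurable]: "\<phi> \<in> borel_measurable lebesgue" and b: "\<And>x. \<bar>\<phi> x\<bar> \<le> b" and \<eta>: "0 < \<eta>"
      and van: "\<And>x. infdist x K < \<eta> \<Longrightarrow> \<phi> x = 0"
    define S where "S = (\<integral>\<^sup>+x\<in>N. ennreal (\<bar>\<phi> x\<bar> powr p / \<delta> x ^ ?d) \<partial>lebesgue)"
    define G where "G = energy_on p \<phi> N"
    have [measurable]: "(\<lambda>x. potential_on p \<phi> N x) \<in> borel_measurable lebesgue"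
      by (rule lebesgue.borel_measurable_nn_integral) measurable
    have [measurable]: "(\<lambda>x. \<integral>\<^sup>+y. I x y * ennreal (\<bar>\<phi> y\<bar> powr p) \<partial>lebesgue) \<in> borel_measurable lebesgue"
      by (rule lebesgue.borel_measurable_nn_integral) measurable
    have pw: "ennreal (\<bar>\<phi> x\<bar> powr p / \<delta> x ^ ?d) \<le>
        ennreal B * (ennreal (1 / \<delta> x ^ (2 * ?d)) * (\<integral>\<^sup>+y. I x y * ennreal (\<bar>\<phi> y\<bar> powr p) \<partial>lebesgue) +
          ennreal (9 ^ ?d) * potential_on p \<phi> N x)" if x: "x \<in> N" for x
    proof -
      define J1 where "J1 = (\<integral>\<^sup>+y. I x y * ennreal (\<bar>\<phi> y\<bar> powr p) \<partial>lebesgue)"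
      define J2 where "J2 = potential_on p \<phi> N x"
      have \<delta>x: "0 < \<delta> x" "\<delta> x \<le> r0" using x by (auto simp: N_def \<delta>_def)
      define V where "V = c2 / real m ^ k * \<delta> x ^ ?d"
      have V: "0 < V" using c2 m \<delta>x by (simp add: V_def)
      have "ennreal V \<le> emeasure lebesgue (E x)"
        using emeasure_near_K[OF K neg c less_imp_le[OF k] pack _ _ m, where x = x] \<delta>x
        by (simp add: V_def c2_def w_def E_def \<delta>_def)
      also have "\<dots> = (\<integral>\<^sup>+y. I x y \<partial>lebesgue)"
      proof -
        have "I x = indicator (E x)" using x by (auto simp: I_def indicator_def)
        moreover have "E x \<in> sets lebesgue"
        proof -
          have "E x = I x -` {1} \<inter> space lebesgue" using x by (auto simp: I_def)
          also have "\<dots> \<in> sets lebesgue" by (rule measurable_sets[OF I_meas1(1)]) simp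
          finally show ?thesis .
        qed
        ultimately show ?thesis by simp
      qed
      finally have "ennreal V * ennreal (\<bar>\<phi> x\<bar> powr p) \<le> (\<integral>\<^sup>+y. I x y \<partial>lebesgue) * ennreal (\<bar>\<phi> x\<bar> powr p)"
        by (rule mult_right_mono) simp
      also have "\<dots> = (\<integral>\<^sup>+y. I x y * ennreal (\<bar>\<phi> x\<bar> powr p) \<partial>lebesgue)"
        by (rule nn_integral_multc[symmetric]) simp
      also have "\<dots> \<le> (\<integral>\<^sup>+y. ennreal (2 powr p) * (I x y * ennreal (\<bar>\<phi> y\<bar> powr p) +
          ennreal ((3 * \<delta> x) ^ (2 * ?d)) * (gagliardo p \<phi> x y * indicator N y)) \<partial>lebesgue)"
      proof (rule nn_integral_mono)
        fix y
        show "I x y * ennreal (\<bar>\<phi> x\<bar> powr p) \<le> ennreal (2 powr p) * (I x y * ennreal (\<bar>\<phi> y\<bar> powr p) +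
          ennreal ((3 * \<delta> x) ^ (2 * ?d)) * (gagliardo p \<phi> x y * indicator N y))"
        proof (cases "y \<in> E x")
          case True
          have "\<bar>\<phi> x\<bar> powr p \<le> (\<bar>\<phi> y\<bar> + \<bar>\<phi> x - \<phi> y\<bar>) powr p"
            using p by (intro powr_mono2) auto
          also have "\<dots> \<le> 2 powr p * (\<bar>\<phi> y\<bar> powr p + \<bar>\<phi> x - \<phi> y\<bar> powr p)"
            using p by (intro powr_add_le) auto
          finally have "ennreal (\<bar>\<phi> x\<bar> powr p) \<le> ennreal (2 powr p * (\<bar>\<phi> y\<bar> powr p + \<bar>\<phi> x - \<phi> y\<bar> powr p))"
            by (rule ennreal_leI)
          also have "\<dots> = ennreal (2 powr p) * (ennreal (\<bar>\<phi> y\<bar> powr p) + ennreal (\<bar>\<phi> x - \<phi> y\<bar> powr p))"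
            by (simp add: ennreal_mult)
          also have "\<dots> \<le> ennreal (2 powr p) * (ennreal (\<bar>\<phi> y\<bar> powr p) + ennreal ((3 * \<delta> x) ^ (2 * ?d)) * gagliardo p \<phi> x y)"
            using True \<delta>x by (intro mult_left_mono add_left_mono le_gagliardo) (auto simp: E_def dist_norm)
          finally show ?thesis using True x E_N[OF x True] by (simp add: I_def)
        qed (auto simp: I_def)
      qed
      also have "\<dots> = ennreal (2 powr p) * (J1 + ennreal ((3 * \<delta> x) ^ (2 * ?d)) * J2)"
        unfolding J1_def J2_def by (simp add: nn_integral_cmult nn_integral_add)
      finally have "ennreal (1 / (V * \<delta> x ^ ?d)) * (ennreal V * ennreal (\<bar>\<phi> x\<bar> powr p)) \<le>
          ennreal (1 / (V * \<delta> x ^ ?d)) * (ennreal (2 powr p) * (J1 + ennreal ((3 * \<delta> x) ^ (2 * ?d)) * J2))"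
        by (rule mult_left_mono) simp
      moreover have "ennreal (1 / (V * \<delta> x ^ ?d)) * (ennreal V * ennreal (\<bar>\<phi> x\<bar> powr p)) = ennreal (\<bar>\<phi> x\<bar> powr p / \<delta> x ^ ?d)"
        using V \<delta>x by (simp add: ennreal_mult[symmetric])
      moreover have "ennreal (1 / (V * \<delta> x ^ ?d)) * (ennreal (2 powr p) * (J1 + ennreal ((3 * \<delta> x) ^ (2 * ?d)) * J2)) =
          ennreal B * (ennreal (1 / \<delta> x ^ (2 * ?d)) * J1 + ennreal (9 ^ ?d) * J2)"
      proof -
        have V2: "V * \<delta> x ^ ?d = c2 / real m ^ k * \<delta> x ^ (2 * ?d)" unfolding V_def mult_2 power_add by simp
        have 1: "1 / (V * \<delta> x ^ ?d) * 2 powr p = B * (1 / \<delta> x ^ (2 * ?d))"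
          unfolding V2 B_def using m by simp
        have 2: "(3 * \<delta> x) ^ (2 * ?d) = 9 ^ ?d * \<delta> x ^ (2 * ?d)" by (simp add: power_mult_distrib power_mult)
        have "ennreal (1 / (V * \<delta> x ^ ?d)) * (ennreal (2 powr p) * X) = ennreal B * (ennreal (1 / \<delta> x ^ (2 * ?d)) * X)" for X
        proof -
          have "ennreal (1 / (V * \<delta> x ^ ?d)) * ennreal (2 powr p) = ennreal B * ennreal (1 / \<delta> x ^ (2 * ?d))"
            using 1 V \<delta>x B by (simp only: ennreal_mult[symmetric] powr_ge_zero zero_le_divide_1_iff less_imp_le mult_nonneg_nonneg zero_le_power)
          then show ?thesis by (simp only: mult.assoc[symmetric])
        qed
        moreover have "ennreal (1 / \<delta> x ^ (2 * ?d)) * (J1 + ennreal ((3 * \<delta> x) ^ (2 * ?d)) * J2) =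
            ennreal (1 / \<delta> x ^ (2 * ?d)) * J1 + ennreal (9 ^ ?d) * J2"
        proof -
          have "1 / \<delta> x ^ (2 * ?d) * (3 * \<delta> x) ^ (2 * ?d) = 9 ^ ?d" using 2 \<delta>x by simp
          then have "ennreal (1 / \<delta> x ^ (2 * ?d)) * ennreal ((3 * \<delta> x) ^ (2 * ?d)) = ennreal (9 ^ ?d)"
            using \<delta>x by (simp only: ennreal_mult[symmetric] zero_le_divide_1_iff less_imp_le mult_nonneg_nonneg zero_le_power zero_le_numeral)
          then show ?thesis by (simp only: distrib_left mult.assoc[symmetric])
        qed
        ultimately show ?thesis by simp
      qed
      ultimately show ?thesis by (simp add: J1_def J2_def)
    qed
    have "S \<le> (\<integral>\<^sup>+x. ennreal B * ((\<integral>\<^sup>+y. I x y * (ennreal (1 / \<delta> x ^ (2 * ?d)) * ennreal (\<bar>\<phi> y\<bar> powr p)) \<partial>lebesgue) +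
          ennreal (9 ^ ?d) * ((potential_on p \<phi> N x) * indicator N x)) \<partial>lebesgue)"
      unfolding S_def
    proof (rule nn_integral_mono)
      fix x
      have "(\<integral>\<^sup>+y. I x y * (ennreal (1 / \<delta> x ^ (2 * ?d)) * ennreal (\<bar>\<phi> y\<bar> powr p)) \<partial>lebesgue) =
          ennreal (1 / \<delta> x ^ (2 * ?d)) * (\<integral>\<^sup>+y. I x y * ennreal (\<bar>\<phi> y\<bar> powr p) \<partial>lebesgue)"
        by (subst nn_integral_cmult[symmetric]) (auto simp: mult_ac)
      then show "ennreal (\<bar>\<phi> x\<bar> powr p / \<delta> x ^ ?d) * indicator N x \<le> ennreal B * ((\<integral>\<^sup>+y. I x y * (ennreal (1 / \<delta> x ^ (2 * ?d)) * ennreal (\<bar>\<phi> y\<bar> powr p)) \<partial>lebesgue) +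
          ennreal (9 ^ ?d) * ((potential_on p \<phi> N x) * indicator N x))"
        using pw[of x] by (auto split: split_indicator)
    qed
    also have "\<dots> = ennreal B * ((\<integral>\<^sup>+x. (\<integral>\<^sup>+y. I x y * (ennreal (1 / \<delta> x ^ (2 * ?d)) * ennreal (\<bar>\<phi> y\<bar> powr p)) \<partial>lebesgue) \<partial>lebesgue) +
        ennreal (9 ^ ?d) * G)"
    proof -
      have [measurable]: "(\<lambda>x. \<integral>\<^sup>+y. I x y * (ennreal (1 / \<delta> x ^ (2 * ?d)) * ennreal (\<bar>\<phi> y\<bar> powr p)) \<partial>lebesgue) \<in> borel_measurable lebesgue"
        by (rule lebesgue.borel_measurable_nn_integral) measurable
      show ?thesis unfolding G_def by (simp add: nn_integral_cmult nn_integral_add)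
    qed
    also have "(\<integral>\<^sup>+x. (\<integral>\<^sup>+y. I x y * (ennreal (1 / \<delta> x ^ (2 * ?d)) * ennreal (\<bar>\<phi> y\<bar> powr p)) \<partial>lebesgue) \<partial>lebesgue) =
        (\<integral>\<^sup>+y. (\<integral>\<^sup>+x. I x y * (ennreal (1 / \<delta> x ^ (2 * ?d)) * ennreal (\<bar>\<phi> y\<bar> powr p)) \<partial>lebesgue) \<partial>lebesgue)"
      by (rule lebesgue_pair.Fubini'[symmetric]) measurable
    also have "\<dots> \<le> (\<integral>\<^sup>+y. ennreal (2 * w * 3 ^ ?d / real m ^ ?d) * (ennreal (\<bar>\<phi> y\<bar> powr p / \<delta> y ^ ?d) * indicator N y) \<partial>lebesgue)"
    proof (rule nn_integral_mono)
      fix y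
      have eq: "(\<integral>\<^sup>+x. I x y * (ennreal (1 / \<delta> x ^ (2 * ?d)) * ennreal (\<bar>\<phi> y\<bar> powr p)) \<partial>lebesgue) =
          (\<integral>\<^sup>+x. I x y * ennreal (1 / \<delta> x ^ (2 * ?d)) \<partial>lebesgue) * ennreal (\<bar>\<phi> y\<bar> powr p)"
        by (subst nn_integral_multc[symmetric]) (auto simp: mult_ac)
      show "(\<integral>\<^sup>+x. I x y * (ennreal (1 / \<delta> x ^ (2 * ?d)) * ennreal (\<bar>\<phi> y\<bar> powr p)) \<partial>lebesgue) \<le>
          ennreal (2 * w * 3 ^ ?d / real m ^ ?d) * (ennreal (\<bar>\<phi> y\<bar> powr p / \<delta> y ^ ?d) * indicator N y)"
      proof (cases "y \<in> N")
        case True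
        have "ennreal (\<bar>\<phi> y\<bar> powr p / \<delta> y ^ ?d) = ennreal (1 / \<delta> y ^ ?d) * ennreal (\<bar>\<phi> y\<bar> powr p)"
          using True by (subst ennreal_mult[symmetric]) (auto simp: \<delta>_def infdist_nonneg)
        then show ?thesis unfolding eq using mult_right_mono[OF inner[OF True], of "ennreal (\<bar>\<phi> y\<bar> powr p)"] True
          by (simp add: mult.assoc)
      next
        case False
        then have "I x y = 0" for x using E_N by (auto simp: I_def)
        then show ?thesis by simp
      qed
    qed
    also have "\<dots> = ennreal (2 * w * 3 ^ ?d / real m ^ ?d) * S"
      unfolding S_def by (rule nn_integral_cmult) measurable
    finally have SB: "S \<le> ennreal B * (ennreal (2 * w * 3 ^ ?d / real m ^ ?d) * S + ennreal (9 ^ ?d) * G)"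
      by (simp add: mult_left_mono add_right_mono)
    also have "\<dots> = ennreal (B * (2 * w * 3 ^ ?d / real m ^ ?d)) * S + ennreal (B * 9 ^ ?d) * G"
    proof -
      have "ennreal (B * (2 * w * 3 ^ ?d / real m ^ ?d)) = ennreal B * ennreal (2 * w * 3 ^ ?d / real m ^ ?d)"
        by (rule ennreal_mult) (use B w in auto)
      moreover have "ennreal (B * 9 ^ ?d) = ennreal B * ennreal (9 ^ ?d)"
        by (rule ennreal_mult) (use B in auto)
      ultimately show ?thesis by (simp only: distrib_left mult.assoc)
    qed
    also have "\<dots> \<le> ennreal (1 / 2) * S + ennreal (B * 9 ^ ?d) * G"
      using small by (intro add_right_mono mult_right_mono ennreal_leI) auto
    finally have half: "S \<le> ennreal (1 / 2) * S + ennreal (B * 9 ^ ?d) * G" .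
    have fin: "S < \<infinity>"
    proof -
      have "bounded N"
      proof -
        obtain R where R: "\<And>x. x \<in> K \<Longrightarrow> norm x \<le> R" using compact_imp_bounded[OF K(1)] bounded_iff by blast
        have "norm x \<le> r0 + R" if "x \<in> N" for x
        proof -
          obtain x0 where "x0 \<in> K" "dist x x0 = infdist x K"
            using infdist_attains_inf[OF compact_imp_closed[OF K(1)] K(2)] by metis
          then show ?thesis using that R[of x0] norm_triangle_sub[of x x0] by (auto simp: N_def dist_norm)
        qed
        then show ?thesis by (auto simp: bounded_iff)
      qed
      then have N_fin: "emeasure lebesgue N < \<infinity>"
        using bounded_set_imp_lmeasurable[of N] by (simp add: fmeasurable_def)
      have "S \<le> (\<integral>\<^sup>+x\<in>N. ennreal (b powr p / \<eta> ^ ?d) \<partial>lebesgue)"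
        unfolding S_def
      proof (rule nn_integral_mono)
        fix x
        have "\<bar>\<phi> x\<bar> powr p / \<delta> x ^ ?d \<le> b powr p / \<eta> ^ ?d"
        proof (cases "\<delta> x < \<eta>")
          case False
          have "\<bar>\<phi> x\<bar> powr p \<le> b powr p" using b p by (intro powr_mono2) auto
          moreover have "\<eta> ^ ?d \<le> \<delta> x ^ ?d" using False \<eta> by (intro power_mono) auto
          ultimately show ?thesis using \<eta> by (intro frac_le) auto
        qed (use van[of x] \<eta> in \<open>simp add: \<delta>_def\<close>)
        then show "ennreal (\<bar>\<phi> x\<bar> powr p / \<delta> x ^ ?d) * indicator N x \<le> ennreal (b powr p / \<eta> ^ ?d) * indicator N x"
          by (intro mult_right_mono ennreal_leI) auto
      qed
      also have "\<dots> = ennreal (b powr p / \<eta> ^ ?d) * emeasure lebesgue N"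
        by (rule nn_integral_cmult_indicator) simp
      also have "\<dots> < \<infinity>" using N_fin by (simp add: ennreal_mult_less_top)
      finally show ?thesis .
    qed
    have "S \<le> ennreal (2 * (B * 9 ^ ?d)) * G"
    proof (cases "G = \<infinity>")
      case True
      then show ?thesis using B by (simp add: ennreal_mult_top)
    next
      case False
      then obtain g where g: "0 \<le> g" "G = ennreal g" by (cases G) auto
      obtain t where t: "0 \<le> t" "S = ennreal t" using fin by (cases S) auto
      have "ennreal t \<le> ennreal (1 / 2 * t + B * 9 ^ ?d * g)"
      proof -
        have "ennreal (1 / 2 * t + B * 9 ^ ?d * g) = ennreal (1 / 2 * t) + ennreal (B * 9 ^ ?d * g)"
          by (rule ennreal_plus) (use B g t in auto)
        also have "ennreal (1 / 2 * t) = ennreal (1 / 2) * ennreal t"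
          by (rule ennreal_mult) (use t in auto)
        also have "ennreal (B * 9 ^ ?d * g) = ennreal (B * 9 ^ ?d) * ennreal g"
          by (rule ennreal_mult) (use B g in auto)
        finally show ?thesis using half unfolding g(2) t(2) by simp
      qed
      then have "t \<le> 1 / 2 * t + B * 9 ^ ?d * g" using B g t by (subst (asm) ennreal_le_iff) auto
      then have "t \<le> 2 * (B * 9 ^ ?d) * g" by simp
      then show ?thesis unfolding g(2) t(2) using B g(1) by (subst ennreal_mult[symmetric]) (auto intro: ennreal_leI)
    qed
    then show "(hardy_mass p K N \<phi>) \<le>
      ennreal (2 * (B * 9 ^ ?d)) * energy_on p \<phi> N"
      by (simp add: S_def G_def \<delta>_def)
  qed
qed

section \<open>The Hardy inequality on the closure of the test functions\<close>

lemma epowr_epowr: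
  assumes "0 < a" "0 < b"
  shows "epowr (epowr x a) b = epowr x (a * b)"
proof (cases x)
  case (real r)
  then show ?thesis by (simp add: epowr_def powr_powr)
qed (simp add: epowr_def)

lemma epowr_1: "epowr x 1 = x"
  by (cases x) (auto simp: epowr_def)

lemma powr_less_iff_mono:
  fixes x y a :: real
  assumes "0 < a" "0 \<le> x" "0 \<le> y"
  shows "x powr a < y powr a \<longleftrightarrow> x < y"
proof
  show "x < y" if "x powr a < y powr a"
    using powr_mono2[of a y x] assms that by (intro not_le_imp_less notI) auto
qed (use assms powr_less_mono2 in auto)

lemma epowr_less_ennreal_iff:
  assumes "0 < p" "0 \<le> r"
  shows "epowr x (1 / p) < ennreal r \<longleftrightarrow> x < ennreal (r powr p)"
proof (cases x)
  case (real t)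
  have "t powr (1 / p) < r \<longleftrightarrow> t < r powr p"
  proof -
    have "t powr (1 / p) < r \<longleftrightarrow> t powr (1 / p) < (r powr p) powr (1 / p)"
      using assms by (simp add: powr_powr)
    also have "\<dots> \<longleftrightarrow> t < r powr p"
      using assms real by (intro powr_less_iff_mono) auto
    finally show ?thesis .
  qed
  then show ?thesis using real assms by (simp add: epowr_def ennreal_less_iff)
qed (auto simp: epowr_def)

lemma epowr_le_1_iff:
  assumes "0 < p"
  shows "epowr x (1 / p) \<le> 1 \<longleftrightarrow> x \<le> 1"
proof (cases x)
  case (real t)
  have "t powr (1 / p) \<le> 1 \<longleftrightarrow> t \<le> 1"
  proof -
    have "t powr (1 / p) \<le> 1 \<longleftrightarrow> t powr (1 / p) \<le> 1 powr (1 / p)" by simp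
    also have "\<dots> \<longleftrightarrow> \<not> 1 powr (1 / p) < t powr (1 / p)" by auto
    also have "\<dots> \<longleftrightarrow> t \<le> 1" using assms real by (subst powr_less_iff_mono) auto
    finally show ?thesis .
  qed
  then show ?thesis using real by (simp add: epowr_def ennreal_le_1)
qed (auto simp: epowr_def)

lemma Wsp_seminorm_eq:
  fixes u :: "real^'d \<Rightarrow> real"
  assumes "s * p = real CARD('d)"
  shows "Wsp_seminorm s p U u = epowr (energy_on p u U) (1 / p)"
  unfolding Wsp_seminorm_def gagliardo_def assms by simp

lemma Wsp_norm_lessD:
  fixes u :: "real^'d \<Rightarrow> real"
  assumes "s * p = real CARD('d)" "0 < p" "0 \<le> \<epsilon>" "Wsp_norm s p U u < ennreal \<epsilon>"
  shows "energy_on p u U < ennreal (\<epsilon> powr p)"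
    and "(\<integral>\<^sup>+x\<in>U. ennreal (\<bar>u x\<bar> powr p) \<partial>lebesgue) < ennreal (\<epsilon> powr p)"
proof -
  have "(energy_on p u U) +
      (\<integral>\<^sup>+x\<in>U. ennreal (\<bar>u x\<bar> powr p) \<partial>lebesgue) < ennreal (\<epsilon> powr p)"
    using assms(4) unfolding Wsp_norm_def Lp_norm_def Wsp_seminorm_eq[OF assms(1)]
    using assms(2,3) by (simp add: epowr_epowr epowr_1 epowr_less_ennreal_iff)
  then show "energy_on p u U < ennreal (\<epsilon> powr p)"
    and "(\<integral>\<^sup>+x\<in>U. ennreal (\<bar>u x\<bar> powr p) \<partial>lebesgue) < ennreal (\<epsilon> powr p)"
    by (auto intro: le_less_trans[rotated])
qed

lemma zero_ext_measurable:
  fixes u :: "real^'d \<Rightarrow> real"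
  assumes "u \<in> borel_measurable (lebesgue_on \<Omega>)" "open \<Omega>" "closed K"
  shows "zero_ext \<Omega> K u \<in> borel_measurable lebesgue"
proof -
  have "\<Omega> - K \<in> sets lebesgue" using assms by (intro sets_completionI_sets) (auto intro: borel_open open_Diff)
  moreover have "u \<in> borel_measurable (lebesgue_on (\<Omega> - K))"
    by (rule measurable_restrict_mono[OF assms(1)]) auto
  ultimately show ?thesis unfolding zero_ext_def by (subst borel_measurable_if) auto
qed

text \<open>The support is compact and disjoint from the compact set \<open>K\<close>, hence at a positive distance from it.\<close>

lemma Cc_infinity_bounded_away:
  fixes \<phi> :: "real^'d \<Rightarrow> real"
  assumes \<phi>: "\<phi> \<in> Cc_infinity (\<Omega> - K)" and K: "compact K" "K \<noteq> {}"
  shows "\<phi> \<in> borel_measurable borel" and "\<exists>b. \<forall>x. \<bar>\<phi> x\<bar> \<le> b"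
    and "\<exists>\<eta>>0. \<forall>x. infdist x K < \<eta> \<longrightarrow> \<phi> x = 0"
proof -
  let ?S = "closure {x. \<phi> x \<noteq> 0}"
  have S: "compact ?S" "?S \<subseteq> \<Omega> - K" and cont: "continuous_on UNIV \<phi>"
    using \<phi> by (auto simp: Cc_infinity_def dest: spec[of _ 0])
  show "\<phi> \<in> borel_measurable borel" using cont by (rule borel_measurable_continuous_onI)
  have "compact (\<phi> ` ?S)" by (rule compact_continuous_image[OF continuous_on_subset[OF cont subset_UNIV] S(1)])
  then obtain b where b: "\<And>y. y \<in> \<phi> ` ?S \<Longrightarrow> \<bar>y\<bar> \<le> b" using compact_imp_bounded[of "\<phi> ` ?S"] unfolding bounded_iff real_norm_def by blast
  have "\<bar>\<phi> x\<bar> \<le> max b 0" for x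
    using b[of "\<phi> x"] closure_subset[of "{x. \<phi> x \<noteq> 0}"] by (cases "\<phi> x = 0") (auto simp: max_def)
  then show "\<exists>b. \<forall>x. \<bar>\<phi> x\<bar> \<le> b" by blast
  have "\<exists>\<eta>>0. \<forall>x\<in>?S. \<forall>y\<in>K. \<eta> \<le> dist x y"
    using S K compact_imp_closed by (intro separate_compact_closed) auto
  then obtain \<eta> where \<eta>: "0 < \<eta>" "\<And>x y. x \<in> ?S \<Longrightarrow> y \<in> K \<Longrightarrow> \<eta> \<le> dist x y" by blast
  have "\<phi> x = 0" if "infdist x K < \<eta>" for x
  proof (rule ccontr)
    assume "\<phi> x \<noteq> 0"
    then have "x \<in> ?S" using closure_subset[of "{x. \<phi> x \<noteq> 0}"] by auto
    moreover obtain y where "y \<in> K" "infdist x K = dist x y"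
      using infdist_attains_inf[OF compact_imp_closed[OF K(1)] K(2)] by metis
    ultimately show False using \<eta>(2)[of x y] that by simp
  qed
  with \<eta>(1) show "\<exists>\<eta>>0. \<forall>x. infdist x K < \<eta> \<longrightarrow> \<phi> x = 0" by blast
qed

lemma gagliardo_add_le:
  fixes u v :: "real^'d \<Rightarrow> real"
  assumes "0 \<le> p"
  shows "gagliardo p v x y \<le> ennreal (2 powr p) * (gagliardo p u x y + gagliardo p (\<lambda>z. u z - v z) x y)"
proof -
  let ?n = "norm (x - y) powr (2 * real CARD('d))"
  have "\<bar>v x - v y\<bar> powr p \<le> (\<bar>u x - u y\<bar> + \<bar>(u x - v x) - (u y - v y)\<bar>) powr p"
    using assms by (intro powr_mono2) auto
  also have "\<dots> \<le> 2 powr p * (\<bar>u x - u y\<bar> powr p + \<bar>(u x - v x) - (u y - v y)\<bar> powr p)"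
    using assms by (intro powr_add_le) auto
  finally have "\<bar>v x - v y\<bar> powr p / ?n \<le>
      2 powr p * (\<bar>u x - u y\<bar> powr p + \<bar>(u x - v x) - (u y - v y)\<bar> powr p) / ?n"
    by (intro divide_right_mono) auto
  also have "\<dots> = 2 powr p * (\<bar>u x - u y\<bar> powr p / ?n + \<bar>(u x - v x) - (u y - v y)\<bar> powr p / ?n)"
    by (simp only: times_divide_eq_right[symmetric] add_divide_distrib)
  finally show ?thesis
    unfolding gagliardo_def by (simp add: ennreal_mult[symmetric] ennreal_plus[symmetric] ennreal_leI del: ennreal_plus)
qed

text \<open>Every point of \<open>\<Omega>\<close> interacts with a ball disjoint from \<open>\<Omega>\<close>, where \<open>u\<close> vanishes.\<close>

lemma Lp_far_bound:
  fixes \<Omega> :: "(real^'d) set"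
  assumes "bounded \<Omega>" "1 \<le> p"
  obtains C :: real where "0 \<le> C"
    "\<And>u. u \<in> borel_measurable lebesgue \<Longrightarrow> (\<And>x. x \<notin> \<Omega> \<Longrightarrow> u x = 0) \<Longrightarrow>
      (\<integral>\<^sup>+x. ennreal (\<bar>u x\<bar> powr p) \<partial>lebesgue) \<le>
      ennreal C * energy p u"
proof -
  obtain R where R: "0 < R" "\<And>x. x \<in> \<Omega> \<Longrightarrow> norm x \<le> R" using assms(1) bounded_pos by metis
  define e :: "real^'d" where "e = (3 * R) *\<^sub>R axis undefined 1"
  have e: "norm e = 3 * R" using R by (simp add: e_def norm_axis_1)
  \<comment> \<open>A ball that avoids \<open>\<Omega>\<close> and is within distance \<open>5 R\<close> of each of its points.\<close>
  define F where "F = ball e R"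
  have F: "x \<notin> \<Omega>" if "x \<in> F" for x
  proof
    assume "x \<in> \<Omega>"
    then show False using that R(2)[of x] norm_triangle_sub[of e x] e R(1) by (simp add: F_def dist_norm)
  qed
  have dist: "norm (x - y) \<le> 5 * R" if "x \<in> \<Omega>" "y \<in> F" for x y
    using that R(2)[of x] norm_triangle_sub[of y e] norm_triangle_ineq4[of x y] e
    by (simp add: F_def dist_norm norm_minus_commute)
  define f where "f = unit_ball_vol CARD('d) * R ^ CARD('d)"
  have f: "0 < f" "emeasure lebesgue F = ennreal f"
    using R(1) by (simp_all add: f_def F_def emeasure_ball)
  have F_meas [measurable]: "F \<in> sets lebesgue" by (simp add: F_def)
  show ?thesis
  proof (rule that[of "(5 * R) ^ (2 * CARD('d)) / f"])
    show "0 \<le> (5 * R) ^ (2 * CARD('d)) / f" using f R by simp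
    fix u :: "real^'d \<Rightarrow> real"
    assume [measurable]: "u \<in> borel_measurable lebesgue" and u0: "\<And>x. x \<notin> \<Omega> \<Longrightarrow> u x = 0"
    have [measurable]: "(\<lambda>x. potential p u x) \<in> borel_measurable lebesgue"
      by (rule lebesgue.borel_measurable_nn_integral) measurable
    have "ennreal f * ennreal (\<bar>u x\<bar> powr p) \<le> ennreal ((5 * R) ^ (2 * CARD('d))) * potential p u x" for x
    proof (cases "x \<in> \<Omega>")
      case True
      have "ennreal f * ennreal (\<bar>u x\<bar> powr p) = (\<integral>\<^sup>+y\<in>F. ennreal (\<bar>u x\<bar> powr p) \<partial>lebesgue)"
        using f F_meas by (subst nn_integral_cmult_indicator) (simp_all add: mult.commute)
      also have "\<dots> \<le> (\<integral>\<^sup>+y. ennreal ((5 * R) ^ (2 * CARD('d))) * gagliardo p u x y \<partial>lebesgue)"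
      proof (rule nn_integral_mono)
        fix y
        show "ennreal (\<bar>u x\<bar> powr p) * indicator F y \<le> ennreal ((5 * R) ^ (2 * CARD('d))) * gagliardo p u x y"
          using le_gagliardo[OF dist[OF True], of y u p] u0[OF F, of y] R(1) by (auto split: split_indicator)
      qed
      finally show ?thesis by (simp add: nn_integral_cmult)
    next
      case False
      then show ?thesis using u0 assms(2) by simp
    qed
    then have "ennreal (1 / f) * (ennreal f * ennreal (\<bar>u x\<bar> powr p)) \<le>
        ennreal (1 / f) * (ennreal ((5 * R) ^ (2 * CARD('d))) * potential p u x)" for x
      by (intro mult_left_mono) auto
    then have "ennreal (\<bar>u x\<bar> powr p) \<le> ennreal ((5 * R) ^ (2 * CARD('d)) / f) * potential p u x" for x
      using f(1) R(1) by (simp add: mult.assoc[symmetric] ennreal_mult[symmetric])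
    then have "(\<integral>\<^sup>+x. ennreal (\<bar>u x\<bar> powr p) \<partial>lebesgue) \<le>
        (\<integral>\<^sup>+x. ennreal ((5 * R) ^ (2 * CARD('d)) / f) * potential p u x \<partial>lebesgue)"
      by (intro nn_integral_mono)
    then show "(\<integral>\<^sup>+x. ennreal (\<bar>u x\<bar> powr p) \<partial>lebesgue) \<le>
      ennreal ((5 * R) ^ (2 * CARD('d)) / f) * energy p u"
      by (simp add: nn_integral_cmult)
  qed
qed

text \<open>Away from \<open>K\<close> the weight is bounded and \<open>Lp_far_bound\<close> applies. Near \<open>K\<close> the inequality for test functions has
  to survive a limit in a norm without weight. Cutting out the points at distance less than \<open>\<eta>\<close> from \<open>K\<close> makes
  the weight bounded, so a test function sufficiently close to \<open>u\<close>, depending on \<open>\<eta>\<close>, gives a bound that is uniform in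
  \<open>\<eta>\<close>; then \<open>\<eta>\<close> tends to 0.\<close>

lemma hardy_Wsp0_tilde:
  fixes \<Omega> K :: "(real^'d) set"
  assumes k: "0 < k" "k < CARD('d)" and \<Omega>: "open \<Omega>" "bounded \<Omega>"
    and K: "compact K" "K \<noteq> {}" "K \<subseteq> \<Omega>" "C01_codim k \<Omega> K"
    and p: "1 < p" "s * p = real CARD('d)"
  obtains C :: real where "0 \<le> C"
    "\<And>u. u \<in> Wsp0_tilde s p \<Omega> K \<Longrightarrow>
      (energy p u) \<le> 1 \<Longrightarrow>
      (hardy_mass p K (-K) u) \<le> ennreal C"
proof -
  let ?d = "CARD('d)"
  have clK: "closed K" using K(1) by (rule compact_imp_closed)
  obtain c r1 where c: "0 < c" "c \<le> 1" and r1: "0 < r1" and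
    pack: "\<And>x r m. x \<in> K \<Longrightarrow> 0 < r \<Longrightarrow> r \<le> r1 \<Longrightarrow> 0 < m \<Longrightarrow> \<exists>P. finite P \<and> P \<subseteq> K \<inter> cball x r \<and>
       card P = m ^ (?d - k) \<and> (\<forall>y\<in>P. \<forall>z\<in>P. y \<noteq> z \<longrightarrow> c * r / real m \<le> dist y z)"
    by (rule packing_C01_codim[OF K(4)]) (rule that; assumption)
  have "\<exists>r>0. \<forall>x\<in>K. \<forall>y\<in>- \<Omega>. r \<le> dist x y"
    by (rule separate_compact_closed) (use K \<Omega> in \<open>auto simp: closed_Compl\<close>)
  then obtain r2 where r2: "0 < r2" "\<And>x y. x \<in> K \<Longrightarrow> y \<in> - \<Omega> \<Longrightarrow> r2 \<le> dist x y"
    by blast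
  define r0 where "r0 = min r1 r2"
  have r0: "0 < r0" using r1 r2 by (simp add: r0_def)
  define N where "N = {x. 0 < infdist x K \<and> infdist x K < r0}"
  have pack0: "\<exists>P. finite P \<and> P \<subseteq> K \<inter> cball x r \<and> card P = m ^ (?d - k) \<and>
        (\<forall>y\<in>P. \<forall>z\<in>P. y \<noteq> z \<longrightarrow> c * r / real m \<le> dist y z)"
    if "x \<in> K" "0 < r" "r \<le> r0" "0 < m" for x r and m :: nat
    using that by (intro pack) (auto simp: r0_def)
  obtain C1 where C1: "0 < C1" and near: "\<And>\<phi> b \<eta>. \<phi> \<in> borel_measurable lebesgue \<Longrightarrow> (\<And>x. \<bar>\<phi> x\<bar> \<le> b) \<Longrightarrow> 0 < \<eta> \<Longrightarrow>
      (\<And>x. infdist x K < \<eta> \<Longrightarrow> \<phi> x = 0) \<Longrightarrow>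
      (hardy_mass p K N \<phi>) \<le>
      ennreal C1 * energy_on p \<phi> N"
  proof (rule hardy_near_compact[OF K(1,2) negligible_C01_codim[OF K(4) k(1)] c k(2) _ less_imp_le[OF p(1)], of r0, folded N_def], goal_cases)
    case (1 x r m)
    then show ?case by (intro pack0)
  next
    case (2 C)
    show ?case by (rule that[OF 2(2,3)])
  qed
  obtain C2 where C2: "0 \<le> C2" and far: "\<And>u. u \<in> borel_measurable lebesgue \<Longrightarrow> (\<And>x. x \<notin> \<Omega> \<Longrightarrow> u x = 0) \<Longrightarrow>
      (\<integral>\<^sup>+x. ennreal (\<bar>u x\<bar> powr p) \<partial>lebesgue) \<le>
      ennreal C2 * energy p u"
  proof (rule Lp_far_bound[OF \<Omega>(2) less_imp_le[OF p(1)]], goal_cases)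
    case (1 C)
    show ?case by (rule that[OF 1(2,3)])
  qed
  have [measurable]: "(\<lambda>x. infdist x K) \<in> borel_measurable borel"
    by (intro borel_measurable_continuous_onI continuous_intros)
  have N_meas [measurable]: "N \<in> sets lebesgue"
  proof -
    have "N \<in> sets borel" unfolding N_def by measurable
    then show ?thesis by (simp add: sets_completionI_sets)
  qed
  have N_sub: "x \<in> \<Omega> - K" if "x \<in> N" for x
  proof -
    obtain x0 where "x0 \<in> K" "infdist x K = dist x x0"
      using infdist_attains_inf[OF clK K(2)] by metis
    then show ?thesis using that r2(2)[of x0 x] by (auto simp: N_def r0_def dist_commute)
  qed
  define D where "D = 2 powr p * (1 + C1 * (2 powr p * 2)) + C2 / r0 ^ ?d"
  have D: "0 \<le> D" using C1 C2 r0 by (simp add: D_def)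
  show ?thesis
  proof (rule that[OF D])
    fix u assume u: "u \<in> Wsp0_tilde s p \<Omega> K"
      and E: "energy p u \<le> 1"
    then obtain v where v: "v \<in> Wsp0 s p \<Omega> K" "u = zero_ext \<Omega> K v" by (auto simp: Wsp0_tilde_def)
    have uv: "u x = v x" if "x \<in> \<Omega> - K" for x using that by (simp add: v zero_ext_def)
    have u0: "u x = 0" if "x \<notin> \<Omega>" for x using that by (simp add: v zero_ext_def)
    have [measurable]: "u \<in> borel_measurable lebesgue"
      unfolding v(2) using v(1) \<Omega>(1) clK by (intro zero_ext_measurable) (auto simp: Wsp0_def Wsp_def)
    define A where "A = (\<lambda>\<eta>. {x. \<eta> \<le> infdist x K \<and> 0 < infdist x K \<and> infdist x K < r0})"
    have A_meas [measurable]: "A \<eta> \<in> sets lebesgue" for \<eta>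
    proof -
      have "A \<eta> \<in> sets borel" unfolding A_def by measurable
      then show ?thesis by (simp add: sets_completionI_sets)
    qed
    have A_N: "A \<eta> \<subseteq> N" for \<eta> by (auto simp: A_def N_def)
    have cut: "(hardy_mass p K (A \<eta>) u) \<le>
        ennreal (2 powr p * (1 + C1 * (2 powr p * 2)))" if \<eta>: "0 < \<eta>" for \<eta>
    proof -
      \<comment> \<open>The approximation has to be good enough both for the energy and for the weight, which is at most
  \<open>\<eta>\<^sup>-\<^sup>d\<close>.\<close>
      define q where "q = min 1 (\<eta> ^ ?d)"
      have q: "0 < q" using \<eta> by (simp add: q_def)
      define \<epsilon> where "\<epsilon> = q powr (1 / p)"
      have \<epsilon>: "0 < \<epsilon>" "\<epsilon> powr p = q" using q p by (simp_all add: \<epsilon>_def powr_powr)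
      obtain \<phi> where \<phi>: "\<phi> \<in> Cc_infinity (\<Omega> - K)" "Wsp_norm s p \<Omega> (\<lambda>x. v x - \<phi> x) < ennreal \<epsilon>"
        using v(1) \<epsilon>(1) by (auto simp: Wsp0_def)
      have "0 < p" using p by simp
      note close = Wsp_norm_lessD[OF p(2) this less_imp_le[OF \<epsilon>(1)] \<phi>(2), unfolded \<epsilon>(2)]
      note away = Cc_infinity_bounded_away[OF \<phi>(1) K(1,2)]
      have [measurable]: "\<phi> \<in> borel_measurable lebesgue" using away(1) by (intro measurable_completion) simp
      obtain b where b: "\<And>x. \<bar>\<phi> x\<bar> \<le> b" using away(2) by blast
      obtain \<eta>' where \<eta>': "0 < \<eta>'" "\<And>x. infdist x K < \<eta>' \<Longrightarrow> \<phi> x = 0" using away(3) by blast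
      have energy: "energy_on p \<phi> N \<le> ennreal (2 powr p * 2)"
      proof -
        let ?w = "\<lambda>x. u x - \<phi> x"
        have [measurable]: "(\<lambda>x. potential_on p u N x) \<in> borel_measurable lebesgue"
          "(\<lambda>x. potential_on p ?w N x) \<in> borel_measurable lebesgue"
          by (rule lebesgue.borel_measurable_nn_integral, measurable)+
        have "potential_on p \<phi> N x \<le> ennreal (2 powr p) *
            ((potential_on p u N x) + potential_on p ?w N x)" for x
        proof -
          have "potential_on p \<phi> N x \<le> (\<integral>\<^sup>+y. ennreal (2 powr p) *
              (gagliardo p u x y * indicator N y + gagliardo p ?w x y * indicator N y) \<partial>lebesgue)"
            using gagliardo_add_le[of p \<phi> x _ u] p by (intro nn_integral_mono) (auto split: split_indicator)
          then show ?thesis by (simp add: nn_integral_cmult nn_integral_add)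
        qed
        then have "(energy_on p \<phi> N) \<le>
            (\<integral>\<^sup>+x. ennreal (2 powr p) * ((potential_on p u N x) * indicator N x +
              (potential_on p ?w N x) * indicator N x) \<partial>lebesgue)"
          by (intro nn_integral_mono) (auto split: split_indicator)
        also have "\<dots> = ennreal (2 powr p) * ((energy_on p u N) +
              (energy_on p ?w N))"
          by (simp add: nn_integral_cmult nn_integral_add)
        also have "\<dots> \<le> ennreal (2 powr p) * (1 + 1)"
        proof (intro mult_left_mono add_mono)
          have "(energy_on p u N) \<le>
              (energy p u)"
            by (intro nn_integral_mono) (auto intro!: nn_integral_mono split: split_indicator)
          with E show "energy_on p u N \<le> 1" by simp
          have "(energy_on p ?w N) \<le>
              (energy_on p (\<lambda>x. v x - \<phi> x) \<Omega>)"
          proof (intro nn_integral_mono)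
            fix x
            show "(potential_on p ?w N x) * indicator N x \<le>
                (potential_on p (\<lambda>x. v x - \<phi> x) \<Omega> x) * indicator \<Omega> x"
            proof (cases "x \<in> N")
              case True
              then have "potential_on p ?w N x \<le> potential_on p (\<lambda>x. v x - \<phi> x) \<Omega> x"
                using N_sub uv by (intro nn_integral_mono) (auto simp: gagliardo_def split: split_indicator)
              then show ?thesis using True N_sub by auto
            qed auto
          qed
          also have "\<dots> \<le> ennreal 1" using close(1) by (rule order_trans[OF less_imp_le]) (simp add: q_def ennreal_leI)
          finally show "energy_on p ?w N \<le> 1" by simp
        qed simp
        also have "\<dots> = ennreal (2 powr p * 2)"
          by (subst ennreal_mult) auto
        finally show ?thesis .
      qed
      have "(hardy_mass p K (A \<eta>) u) \<le>
          (\<integral>\<^sup>+x. ennreal (2 powr p) * (ennreal (1 / \<eta> ^ ?d) * (ennreal (\<bar>u x - \<phi> x\<bar> powr p) * indicator N x) +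
            ennreal (\<bar>\<phi> x\<bar> powr p / infdist x K ^ ?d) * indicator N x) \<partial>lebesgue)"
      proof (rule nn_integral_mono)
        fix x
        show "ennreal (\<bar>u x\<bar> powr p / infdist x K ^ ?d) * indicator (A \<eta>) x \<le>
          ennreal (2 powr p) * (ennreal (1 / \<eta> ^ ?d) * (ennreal (\<bar>u x - \<phi> x\<bar> powr p) * indicator N x) +
            ennreal (\<bar>\<phi> x\<bar> powr p / infdist x K ^ ?d) * indicator N x)"
        proof (cases "x \<in> A \<eta>")
          case True
          then have xA: "\<eta> \<le> infdist x K" "x \<in> N" "0 < infdist x K" by (auto simp: A_def N_def)
          have pw: "\<eta> ^ ?d \<le> infdist x K ^ ?d" using xA \<eta> by (intro power_mono) auto
          have "\<bar>u x\<bar> powr p \<le> (\<bar>u x - \<phi> x\<bar> + \<bar>\<phi> x\<bar>) powr p" using p by (intro powr_mono2) auto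
          also have "\<dots> \<le> 2 powr p * (\<bar>u x - \<phi> x\<bar> powr p + \<bar>\<phi> x\<bar> powr p)" using p by (intro powr_add_le) auto
          finally have "\<bar>u x\<bar> powr p / infdist x K ^ ?d \<le> 2 powr p * (\<bar>u x - \<phi> x\<bar> powr p + \<bar>\<phi> x\<bar> powr p) / infdist x K ^ ?d"
            by (intro divide_right_mono) (use xA in auto)
          also have "\<dots> = 2 powr p * (\<bar>u x - \<phi> x\<bar> powr p / infdist x K ^ ?d + \<bar>\<phi> x\<bar> powr p / infdist x K ^ ?d)"
            by (simp only: times_divide_eq_right[symmetric] add_divide_distrib)
          also have "\<dots> \<le> 2 powr p * (1 / \<eta> ^ ?d * \<bar>u x - \<phi> x\<bar> powr p + \<bar>\<phi> x\<bar> powr p / infdist x K ^ ?d)"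
          proof (intro mult_left_mono add_right_mono)
            show "\<bar>u x - \<phi> x\<bar> powr p / infdist x K ^ ?d \<le> 1 / \<eta> ^ ?d * \<bar>u x - \<phi> x\<bar> powr p"
              using frac_le[OF _ order_refl _ pw, of "\<bar>u x - \<phi> x\<bar> powr p"] \<eta> by simp
          qed simp
          finally have "ennreal (\<bar>u x\<bar> powr p / infdist x K ^ ?d) \<le>
              ennreal (2 powr p * (1 / \<eta> ^ ?d * \<bar>u x - \<phi> x\<bar> powr p + \<bar>\<phi> x\<bar> powr p / infdist x K ^ ?d))"
            by (rule ennreal_leI)
          also have "\<dots> = ennreal (2 powr p) * (ennreal (1 / \<eta> ^ ?d) * ennreal (\<bar>u x - \<phi> x\<bar> powr p) +
            ennreal (\<bar>\<phi> x\<bar> powr p / infdist x K ^ ?d))"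
            using \<eta> xA by (subst ennreal_mult, simp, simp, subst ennreal_plus, simp, simp, subst ennreal_mult) auto
          finally show ?thesis using True xA by simp
        qed simp
      qed
      also have "\<dots> = ennreal (2 powr p) * (ennreal (1 / \<eta> ^ ?d) * (\<integral>\<^sup>+x\<in>N. ennreal (\<bar>u x - \<phi> x\<bar> powr p) \<partial>lebesgue) +
          (hardy_mass p K N \<phi>))"
        by (simp add: nn_integral_cmult nn_integral_add)
      also have "\<dots> \<le> ennreal (2 powr p) * (ennreal (1 / \<eta> ^ ?d) * ennreal (\<eta> ^ ?d) + ennreal C1 * ennreal (2 powr p * 2))"
      proof (intro mult_left_mono add_mono)
        have "(\<integral>\<^sup>+x\<in>N. ennreal (\<bar>u x - \<phi> x\<bar> powr p) \<partial>lebesgue) \<le> (\<integral>\<^sup>+x\<in>\<Omega>. ennreal (\<bar>v x - \<phi> x\<bar> powr p) \<partial>lebesgue)"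
          using N_sub uv by (intro nn_integral_mono) (auto split: split_indicator)
        also have "\<dots> \<le> ennreal (\<eta> ^ ?d)" using close(2) by (rule order_trans[OF less_imp_le]) (simp add: q_def ennreal_leI)
        finally show "(\<integral>\<^sup>+x\<in>N. ennreal (\<bar>u x - \<phi> x\<bar> powr p) \<partial>lebesgue) \<le> ennreal (\<eta> ^ ?d)" .
        show "hardy_mass p K N \<phi> \<le> ennreal C1 * ennreal (2 powr p * 2)"
          by (rule order_trans[OF near[OF _ b \<eta>']]) (auto intro!: mult_left_mono energy)
      qed auto
      also have "\<dots> = ennreal (2 powr p * (1 + C1 * (2 powr p * 2)))"
      proof -
        have "ennreal (1 / \<eta> ^ ?d) * ennreal (\<eta> ^ ?d) = ennreal 1"
          using \<eta> by (subst ennreal_mult[symmetric]) auto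
        moreover have "ennreal C1 * ennreal (2 powr p * 2) = ennreal (C1 * (2 powr p * 2))"
          using C1 by (intro ennreal_mult[symmetric]) auto
        moreover have "ennreal 1 + ennreal (C1 * (2 powr p * 2)) = ennreal (1 + C1 * (2 powr p * 2))"
          using C1 by (intro ennreal_plus[symmetric]) auto
        ultimately show ?thesis using C1 by (simp only: ennreal_mult[symmetric] powr_ge_zero add_nonneg_nonneg mult_nonneg_nonneg less_imp_le zero_le_one zero_le_numeral)
      qed
      finally show ?thesis .
    qed
    have near_u: "(hardy_mass p K N u) \<le>
        ennreal (2 powr p * (1 + C1 * (2 powr p * 2)))"
    proof -
      let ?f = "\<lambda>n x. ennreal (\<bar>u x\<bar> powr p / infdist x K ^ ?d) * indicator (A (1 / real (Suc n))) x"
      have "(SUP n. ?f n x) = ennreal (\<bar>u x\<bar> powr p / infdist x K ^ ?d) * indicator N x" for x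
      proof (rule antisym)
        show "(SUP n. ?f n x) \<le> ennreal (\<bar>u x\<bar> powr p / infdist x K ^ ?d) * indicator N x"
          using A_N by (intro SUP_least) (auto split: split_indicator)
        show "ennreal (\<bar>u x\<bar> powr p / infdist x K ^ ?d) * indicator N x \<le> (SUP n. ?f n x)"
        proof (cases "x \<in> N")
          case True
          then obtain n where "inverse (real (Suc n)) < infdist x K"
            using reals_Archimedean[of "infdist x K"] by (auto simp: N_def)
          then have "x \<in> A (1 / real (Suc n))" using True by (auto simp: A_def N_def inverse_eq_divide)
          then show ?thesis using True by (intro SUP_upper2[of n]) auto
        qed auto
      qed
      then have "hardy_mass p K N u = (\<integral>\<^sup>+x. (SUP n. ?f n x) \<partial>lebesgue)"
        by simp
      also have "\<dots> = (SUP n. \<integral>\<^sup>+x. ?f n x \<partial>lebesgue)"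
      proof (rule nn_integral_monotone_convergence_SUP)
        show "incseq ?f"
        proof (rule incseq_SucI, rule le_funI)
          fix n x
          have "1 / real (Suc (Suc n)) \<le> 1 / real (Suc n)" by (intro divide_left_mono) auto
          then show "?f n x \<le> ?f (Suc n) x" by (auto simp: A_def split: split_indicator)
        qed
      qed measurable
      also have "\<dots> \<le> ennreal (2 powr p * (1 + C1 * (2 powr p * 2)))"
        by (intro SUP_least cut) simp
      finally show ?thesis .
    qed
    have "(hardy_mass p K (-K) u) \<le>
        (\<integral>\<^sup>+x. ennreal (\<bar>u x\<bar> powr p / infdist x K ^ ?d) * indicator N x + ennreal (1 / r0 ^ ?d) * ennreal (\<bar>u x\<bar> powr p) \<partial>lebesgue)"
    proof (rule nn_integral_mono)
      fix x
      show "ennreal (\<bar>u x\<bar> powr p / infdist x K ^ ?d) * indicator (- K) x \<le>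
          ennreal (\<bar>u x\<bar> powr p / infdist x K ^ ?d) * indicator N x + ennreal (1 / r0 ^ ?d) * ennreal (\<bar>u x\<bar> powr p)"
      proof (cases "x \<in> N \<or> x \<in> K")
        case False
        then have "r0 \<le> infdist x K"
          using infdist_nonneg[of x K] in_closed_iff_infdist_zero[OF clK K(2), of x] by (auto simp: N_def)
        then have pw: "r0 ^ ?d \<le> infdist x K ^ ?d" using r0 by (intro power_mono) auto
        have "\<bar>u x\<bar> powr p / infdist x K ^ ?d \<le> 1 / r0 ^ ?d * \<bar>u x\<bar> powr p"
          using frac_le[OF _ order_refl _ pw, of "\<bar>u x\<bar> powr p"] r0 by simp
        then have "ennreal (\<bar>u x\<bar> powr p / infdist x K ^ ?d) \<le> ennreal (1 / r0 ^ ?d) * ennreal (\<bar>u x\<bar> powr p)"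
          using r0 by (subst ennreal_mult[symmetric]) (auto intro: ennreal_leI)
        then show ?thesis using False by simp
      qed (auto simp: N_def intro!: add_increasing2 split: split_indicator)
    qed
    also have "\<dots> = hardy_mass p K N u +
        ennreal (1 / r0 ^ ?d) * (\<integral>\<^sup>+x. ennreal (\<bar>u x\<bar> powr p) \<partial>lebesgue)"
      by (simp add: nn_integral_add nn_integral_cmult)
    also have "\<dots> \<le> ennreal (2 powr p * (1 + C1 * (2 powr p * 2))) + ennreal (1 / r0 ^ ?d) * (ennreal C2 * 1)"
      using E by (intro add_mono mult_left_mono near_u order_trans[OF far[OF _ u0]]) auto
    also have "\<dots> = ennreal D"
    proof -
      have "ennreal (1 / r0 ^ ?d) * (ennreal C2 * 1) = ennreal (C2 / r0 ^ ?d)"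
        using r0 C2 by (simp add: ennreal_mult[symmetric])
      then show ?thesis unfolding D_def using C1 C2 r0 by (simp add: ennreal_plus del: times_divide_eq_right)
    qed
    finally show "(hardy_mass p K (-K) u) \<le> ennreal D" .
  qed
qed

section \<open>Small exponents\<close>

text \<open>The growth bound with \<open>R\<close> equal to the distance to \<open>K\<close> feeds \<open>Phi_growth\<close>, which gives the pointwise inequality; its
  right-hand side is integrated with the Hardy inequality. The Hardy inequality is used a second time to bound the
  mean over the first annulus, where the distance to \<open>K\<close> is at most \<open>2 \<delta>\<close>.\<close>

lemma TM_sup_finite_small_exponent:
  fixes \<Omega> K :: "(real^'d) set"
  assumes k: "0 < k" "k < CARD('d)" and \<Omega>: "open \<Omega>" "bounded \<Omega>"
    and K: "compact K" "K \<noteq> {}" "K \<subseteq> \<Omega>" "C01_codim k \<Omega> K"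
    and p: "1 < p" "s * p = real CARD('d)" and s: "0 < s"
  shows "\<exists>\<alpha>0>0. \<forall>\<alpha>. 0 \<le> \<alpha> \<and> \<alpha> < \<alpha>0 \<longrightarrow> TM_sup s p \<alpha> \<Omega> K < \<infinity>"
proof -
  let ?d = "CARD('d)"
  have clK: "closed K" using K(1) by (rule compact_imp_closed)
  have pd: "p = real ?d / s" using p s by (simp add: field_simps)
  have expo: "real ?d / (real ?d - s) = p / (p - 1)"
    using s p by (simp add: p(2)[symmetric] field_simps)
  obtain H where H: "0 \<le> H" and hardy: "\<And>u. u \<in> Wsp0_tilde s p \<Omega> K \<Longrightarrow>
      (energy p u) \<le> 1 \<Longrightarrow>
      (hardy_mass p K (-K) u) \<le> ennreal H"
  proof (rule hardy_Wsp0_tilde[OF k \<Omega> K p], goal_cases)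
    case (1 C)
    show ?case by (rule that[OF 1(2,3)])
  qed
  define \<kappa> where "\<kappa> = annulus_vol ?d"
  have \<kappa>: "0 < \<kappa>" by (simp add: \<kappa>_def annulus_vol_pos)
  define h where "h = 1 + 2 ^ ?d * H / \<kappa>"
  have h: "0 \<le> h" using H \<kappa> by (simp add: h_def)
  define c where "c = h + 2 + 1 / \<kappa> + 8 ^ ?d / \<kappa>\<^sup>2"
  have c: "0 < c" using h \<kappa> by (simp add: c_def add_pos_nonneg)
  define B where "B = c powr (p / (p - 1))"
  have B: "0 < B" using c by (simp add: B_def)
  show ?thesis
  proof (intro exI[of _ "real ?d * ln 2 / B"] conjI allI impI)
    show "0 < real ?d * ln 2 / B" using B by simp
    fix \<alpha> :: real assume "0 \<le> \<alpha> \<and> \<alpha> < real ?d * ln 2 / B"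
    then have \<alpha>: "0 \<le> \<alpha>" "\<alpha> * B \<le> real ?d * ln 2" using B by (auto simp: field_simps)
    obtain C where C: "0 \<le> C" and Phi: "\<And>a G. 0 \<le> a \<Longrightarrow> 0 \<le> G \<Longrightarrow>
      (\<And>N::nat. G \<le> 2 ^ (N * ?d) \<Longrightarrow> a powr (p / (p - 1)) \<le> B * (real N + 1)) \<Longrightarrow>
      Phi ?d s (\<alpha> * a powr (p / (p - 1))) \<le> C * (a powr p + G)"
      using Phi_growth[OF pd p(1) \<alpha>] by blast
    have main: "TM_integral s \<alpha> \<Omega> K u \<le> ennreal ((C + 1) * (H + 1))"
      if u: "u \<in> Wsp0_tilde s p \<Omega> K" and "Wsp_seminorm s p UNIV u \<le> 1" for u
    proof -
      have E: "energy p u \<le> 1"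
        using that(2) p by (simp add: Wsp_seminorm_eq[OF p(2)] epowr_le_1_iff)
      obtain v where v: "v \<in> Wsp0 s p \<Omega> K" "u = zero_ext \<Omega> K v" using u by (auto simp: Wsp0_tilde_def)
      have [measurable]: "u \<in> borel_measurable lebesgue"
        unfolding v(2) using v(1) \<Omega>(1) clK by (intro zero_ext_measurable) (auto simp: Wsp0_def Wsp_def)
      have u0: "u x = 0" if "x \<in> K" for x using that by (simp add: v zero_ext_def)
      have [measurable]: "(\<lambda>x. potential p u x) \<in> borel_measurable lebesgue"
        by (rule lebesgue.borel_measurable_nn_integral) measurable
      have [measurable]: "(\<lambda>x. infdist x K) \<in> borel_measurable borel"
        by (intro borel_measurable_continuous_onI continuous_intros)
      have [measurable]: "K \<in> sets lebesgue" using clK by (intro sets_completionI_sets) (auto intro: borel_closed)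
      have Hu: "(hardy_mass p K (-K) u) \<le> ennreal H"
        by (rule hardy[OF u E])
      have mean: "ennreal (1 / (\<kappa> * infdist x K ^ ?d)) * (mass_on (annulus x (infdist x K) 0) u) \<le> ennreal h"
        if x: "0 < infdist x K" for x
      proof -
        define \<delta> where "\<delta> = infdist x K"
        have \<delta>: "0 < \<delta>" using x by (simp add: \<delta>_def)
        let ?A = "annulus x \<delta> 0"
        have "(mass_on ?A u) \<le>
            (\<integral>\<^sup>+z. 1 * indicator ?A z + ennreal ((2 * \<delta>) ^ ?d) * (ennreal (\<bar>u z\<bar> powr p / infdist z K ^ ?d) * indicator (- K) z) \<partial>lebesgue)"
        proof (rule nn_integral_mono)
          fix z
          show "ennreal \<bar>u z\<bar> * indicator ?A z \<le> 1 * indicator ?A z +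
              ennreal ((2 * \<delta>) ^ ?d) * (ennreal (\<bar>u z\<bar> powr p / infdist z K ^ ?d) * indicator (- K) z)"
          proof (cases "z \<in> ?A \<and> z \<notin> K")
            case True
            then have z: "dist x z < \<delta>" by (simp add: annulus_def)
            have iz: "0 < infdist z K" using True in_closed_iff_infdist_zero[OF clK K(2), of z] infdist_nonneg[of z K] by auto
            have "infdist z K \<le> 2 * \<delta>"
              using infdist_triangle[of z K x] z by (simp add: \<delta>_def dist_commute)
            then have pw: "infdist z K ^ ?d \<le> (2 * \<delta>) ^ ?d" using iz by (intro power_mono) auto
            have pw2: "0 < infdist z K ^ ?d" using iz by simp
            have "\<bar>u z\<bar> \<le> 1 + \<bar>u z\<bar> powr p"
              using le_threshold_plus_powr[of "\<bar>u z\<bar>" 1 p] p by simp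
            also have "\<bar>u z\<bar> powr p \<le> (2 * \<delta>) ^ ?d * (\<bar>u z\<bar> powr p / infdist z K ^ ?d)"
              using mult_right_mono[OF pw, of "\<bar>u z\<bar> powr p"] pw2 by (simp add: field_simps)
            finally have "ennreal \<bar>u z\<bar> \<le> ennreal (1 + (2 * \<delta>) ^ ?d * (\<bar>u z\<bar> powr p / infdist z K ^ ?d))"
              by (intro ennreal_leI) simp
            also have "\<dots> = 1 + ennreal ((2 * \<delta>) ^ ?d) * ennreal (\<bar>u z\<bar> powr p / infdist z K ^ ?d)"
              using \<delta> pw2 by (subst ennreal_plus, simp, simp, subst ennreal_mult) auto
            finally show ?thesis using True by simp
          qed (use u0 in \<open>auto split: split_indicator\<close>)
        qed
        also have "\<dots> = emeasure lebesgue ?A + ennreal ((2 * \<delta>) ^ ?d) *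
            (\<integral>\<^sup>+z\<in>-K. ennreal (\<bar>u z\<bar> powr p / infdist z K ^ ?d) \<partial>lebesgue)"
          by (simp add: nn_integral_add nn_integral_cmult)
        also have "\<dots> \<le> ennreal (\<kappa> * \<delta> ^ ?d) + ennreal ((2 * \<delta>) ^ ?d) * ennreal H"
          using emeasure_annulus[OF \<delta>, of x 0] by (intro add_mono mult_left_mono Hu) (auto simp: \<kappa>_def)
        finally have "ennreal (1 / (\<kappa> * \<delta> ^ ?d)) * mass_on ?A u \<le>
            ennreal (1 / (\<kappa> * \<delta> ^ ?d)) * (ennreal (\<kappa> * \<delta> ^ ?d) + ennreal ((2 * \<delta>) ^ ?d) * ennreal H)"
          by (rule mult_left_mono) simp
        also have "\<dots> = ennreal (1 / (\<kappa> * \<delta> ^ ?d) * (\<kappa> * \<delta> ^ ?d + (2 * \<delta>) ^ ?d * H))"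
        proof -
          have "ennreal a * (ennreal b + ennreal e * ennreal r) = ennreal (a * (b + e * r))"
            if "0 \<le> a" "0 \<le> b" "0 \<le> e" "0 \<le> r" for a b e r
            using that by (simp add: ennreal_mult ennreal_plus)
          then show ?thesis using \<kappa> \<delta> H by auto
        qed
        also have "1 / (\<kappa> * \<delta> ^ ?d) * (\<kappa> * \<delta> ^ ?d + (2 * \<delta>) ^ ?d * H) = h"
          using \<kappa> \<delta> by (simp add: h_def power_mult_distrib field_simps)
        finally show ?thesis by (simp add: \<delta>_def)
      qed
      have pw: "ennreal (Phi ?d s (\<alpha> * \<bar>u x\<bar> powr (real ?d / (real ?d - s))) / infdist x K ^ ?d) * indicator \<Omega> x \<le>
          ennreal (C + 1) * (ennreal (\<bar>u x\<bar> powr p / infdist x K ^ ?d) * indicator (- K) x + potential p u x)" for x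
      proof (cases "x \<in> K \<or> (potential p u x) = \<infinity>")
        case True
        then show ?thesis
        proof
          assume "x \<in> K"
          then have "infdist x K = 0" by simp
          then show ?thesis by (simp add: zero_power)
        next
          assume "potential p u x = \<infinity>"
          then show ?thesis using C by (simp add: ennreal_mult_top)
        qed
      next
        case False
        define \<delta> where "\<delta> = infdist x K"
        have \<delta>: "0 < \<delta>"
          using False in_closed_iff_infdist_zero[OF clK K(2), of x] infdist_nonneg[of x K] by (auto simp: \<delta>_def)
        from False obtain g where g: "0 \<le> g" "potential p u x = ennreal g"
          by (cases "potential p u x") auto
        have "Phi ?d s (\<alpha> * \<bar>u x\<bar> powr (p / (p - 1))) \<le> C * (\<bar>u x\<bar> powr p + \<delta> ^ ?d * g)"
        proof (rule Phi)
          fix N :: nat assume N: "\<delta> ^ ?d * g \<le> 2 ^ (N * ?d)"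
          have "\<bar>u x\<bar> \<le> c * (real N + 1) powr (1 - 1 / p)"
            unfolding c_def \<kappa>_def
          proof (rule growth_bound[OF _ \<delta> p(1) h E])
            show "ennreal (1 / (annulus_vol ?d * \<delta> ^ ?d)) * mass_on (annulus x \<delta> 0) u \<le> ennreal h"
              using mean[of x] \<delta> by (simp add: \<delta>_def \<kappa>_def)
            show "ennreal (\<delta> ^ ?d) * potential p u x \<le> ennreal (2 ^ (N * ?d))"
              unfolding g(2) using N \<delta> g(1) by (subst ennreal_mult[symmetric]) (auto intro: ennreal_leI)
          qed measurable
          then have "\<bar>u x\<bar> powr (p / (p - 1)) \<le> (c * (real N + 1) powr (1 - 1 / p)) powr (p / (p - 1))"
            using p by (intro powr_mono2) auto
          also have "\<dots> = B * (real N + 1)"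
          proof -
            have e: "(1 - 1 / p) * (p / (p - 1)) = 1" using p by (simp add: field_simps)
            have "((real N + 1) powr (1 - 1 / p)) powr (p / (p - 1)) = real N + 1"
              unfolding powr_powr e by simp
            then show ?thesis using c by (simp add: powr_mult B_def)
          qed
          finally show "\<bar>u x\<bar> powr (p / (p - 1)) \<le> B * (real N + 1)" .
        qed (use \<delta> g in auto)
        also have "\<dots> \<le> (C + 1) * (\<bar>u x\<bar> powr p + \<delta> ^ ?d * g)"
          using g \<delta> by (intro mult_right_mono) auto
        finally have "Phi ?d s (\<alpha> * \<bar>u x\<bar> powr (p / (p - 1))) / \<delta> ^ ?d \<le> (C + 1) * (\<bar>u x\<bar> powr p + \<delta> ^ ?d * g) / \<delta> ^ ?d"
          using \<delta> by (intro divide_right_mono) auto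
        also have "\<dots> = (C + 1) * (\<bar>u x\<bar> powr p / \<delta> ^ ?d + g)"
          using \<delta> by (simp add: field_simps)
        finally have "ennreal (Phi ?d s (\<alpha> * \<bar>u x\<bar> powr (p / (p - 1))) / \<delta> ^ ?d) \<le> ennreal ((C + 1) * (\<bar>u x\<bar> powr p / \<delta> ^ ?d + g))"
          by (rule ennreal_leI)
        also have "\<dots> = ennreal (C + 1) * (ennreal (\<bar>u x\<bar> powr p / \<delta> ^ ?d) + ennreal g)"
          using C \<delta> g by (subst ennreal_mult, simp, simp, subst ennreal_plus) auto
        finally show ?thesis using False by (auto simp: expo \<delta>_def g(2) split: split_indicator)
      qed
      have "TM_integral s \<alpha> \<Omega> K u \<le> (\<integral>\<^sup>+x. ennreal (C + 1) * (ennreal (\<bar>u x\<bar> powr p / infdist x K ^ ?d) * indicator (- K) x +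
          (potential p u x)) \<partial>lebesgue)"
        unfolding TM_integral_def Let_def by (intro nn_integral_mono pw)
      also have "\<dots> = ennreal (C + 1) * ((hardy_mass p K (-K) u) +
          (energy p u))"
        by (simp add: nn_integral_cmult nn_integral_add)
      also have "\<dots> \<le> ennreal (C + 1) * (ennreal H + ennreal 1)"
        using E by (intro mult_left_mono add_mono Hu) auto
      also have "\<dots> = ennreal ((C + 1) * (H + 1))"
        using C H by (subst ennreal_plus[symmetric], simp, simp, subst ennreal_mult[symmetric]) auto
      finally show ?thesis .
    qed
    have "TM_sup s p \<alpha> \<Omega> K \<le> ennreal ((C + 1) * (H + 1))"
      unfolding TM_sup_def using main by (intro SUP_least) auto
    also have "\<dots> < \<infinity>" by simp
    finally show "TM_sup s p \<alpha> \<Omega> K < \<infinity>" .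
  qed
qed

section \<open>The energy of a radial profile\<close>

lemma gagliardo_commute: "gagliardo p u x y = gagliardo p u y x"
  by (simp add: gagliardo_def abs_minus_commute norm_minus_commute)

text \<open>The hypothesis \<open>lip\<close> trades \<open>p - 1\<close> of the \<open>p\<close> factors \<open>W y - W x\<close> for logarithms, and the remaining factor is the
  length of the interval of levels \<open>l\<close> between \<open>W x\<close> and \<open>W y\<close>. For every level the points \<open>y\<close> above it and
  the points \<open>x\<close> below it are separated by a sphere, so each of the levels between 0 and \<open>L\<close> contributes at
  most \<open>J\<close>.\<close>

lemma gagliardo_energy_radial:
  fixes W :: "real^'d \<Rightarrow> real"
  assumes cont: "continuous_on UNIV W" and W: "\<And>x. 0 \<le> W x" "\<And>x. W x \<le> L"
    and mono: "\<And>x y. norm y \<le> norm x \<Longrightarrow> W x \<le> W y"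
    and lip: "\<And>x y. y \<noteq> 0 \<Longrightarrow> norm y \<le> norm x \<Longrightarrow> W y - W x \<le> ln (norm x / norm y)"
    and p: "1 < p"
  defines "J \<equiv> (\<Sum>n. ennreal (unit_ball_vol CARD('d) * (CARD('d) * unit_ball_vol CARD('d)) * negbin CARD('d) n *
      (Gamma (p + 1) / real (CARD('d) + 2 * n) powr p)))"
  shows "energy p W \<le> ennreal (2 * L) * J"
proof -
  let ?d = "CARD('d)"
  have [measurable]: "W \<in> borel_measurable borel" using cont by (rule borel_measurable_continuous_onI)
  have L: "0 \<le> L" using W[of 0] by linarith
  have g_meas [measurable (raw)]: "(\<lambda>w. gagliardo p W (f w) (g w)) \<in> borel_measurable M"
    if [measurable]: "f \<in> borel_measurable M" "g \<in> borel_measurable M" for f g and M :: "'c measure"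
    unfolding gagliardo_def by measurable
  have l_meas [measurable (raw)]: "(\<lambda>w. log_kernel p (f w) (g w)) \<in> borel_measurable M"
    if [measurable]: "f \<in> borel_measurable M" "g \<in> borel_measurable M" for f g :: "'c \<Rightarrow> real^'d" and M :: "'c measure"
    unfolding log_kernel_def by measurable
  have "energy p W = (\<integral>\<^sup>+x. (\<integral>\<^sup>+y. gagliardo p W x y \<partial>lborel) \<partial>lborel)"
    by (simp add: nn_integral_completion)
  define H where "H = (\<lambda>x y. if norm y < norm x then gagliardo p W x y else 0)"
  have H_meas [measurable (raw)]: "(\<lambda>w. H (f w) (g w)) \<in> borel_measurable M"
    if [measurable]: "f \<in> borel_measurable M" "g \<in> borel_measurable M" for f g and M :: "'c measure"
    unfolding H_def by measurable
  \<comment> \<open>On spheres around the origin \<open>W\<close> is constant, so pairs of equal norm do not contribute.\<close>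
  have H: "gagliardo p W x y = H x y + H y x" for x y
  proof -
    have "W x = W y" if "norm x = norm y" using mono[of x y] mono[of y x] that by simp
    then have "gagliardo p W x y = 0" if "norm x = norm y" using that by (simp add: gagliardo_def)
    then show ?thesis by (auto simp: H_def gagliardo_commute[of p W y x] not_less)
  qed
  note \<open>(energy p W) = _\<close>
  also have "(\<integral>\<^sup>+x. (\<integral>\<^sup>+y. gagliardo p W x y \<partial>lborel) \<partial>lborel) =
      (\<integral>\<^sup>+x. (\<integral>\<^sup>+y. H x y \<partial>lborel) \<partial>lborel) + (\<integral>\<^sup>+x. (\<integral>\<^sup>+y. H y x \<partial>lborel) \<partial>lborel)"
    unfolding H by (simp add: nn_integral_add)
  also have "(\<integral>\<^sup>+x. (\<integral>\<^sup>+y. H y x \<partial>lborel) \<partial>lborel) = (\<integral>\<^sup>+y. (\<integral>\<^sup>+x. H y x \<partial>lborel) \<partial>lborel)"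
    by (rule lborel_pair.Fubini') measurable
  also have "(\<integral>\<^sup>+x. (\<integral>\<^sup>+y. H x y \<partial>lborel) \<partial>lborel) + (\<integral>\<^sup>+x. (\<integral>\<^sup>+y. H x y \<partial>lborel) \<partial>lborel) =
      2 * (\<integral>\<^sup>+x. (\<integral>\<^sup>+y. H x y \<partial>lborel) \<partial>lborel)"
    by (simp add: mult_2)
  also have "\<dots> \<le> 2 * (ennreal L * J)"
  proof (rule mult_left_mono)
    define V where "V = (\<lambda>x y l. (if W x \<le> l \<and> l < W y then log_kernel p x y else 0))"
    have V_meas [measurable (raw)]: "(\<lambda>w. V (f w) (g w) (h w)) \<in> borel_measurable M"
      if [measurable]: "f \<in> borel_measurable M" "g \<in> borel_measurable M" "h \<in> borel_measurable M"
      for f g h and M :: "'c measure"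
      unfolding V_def by measurable
    have H_le: "H x y \<le> (\<integral>\<^sup>+l\<in>{0..<L}. V x y l \<partial>lborel)" if y: "y \<noteq> 0" for x y
    proof (cases "norm y < norm x")
      case True
      let ?D = "W y - W x"
      have D: "0 \<le> ?D" "?D \<le> ln (norm x / norm y)" using mono[of y x] lip[OF y, of x] True by auto
      have "?D powr p \<le> ln (norm x / norm y) powr (p - 1) * ?D"
      proof (cases "?D = 0")
        case False
        then have "?D powr p = ?D powr (p - 1) * ?D" using D powr_add[of ?D "p - 1" 1] by simp
        also have "\<dots> \<le> ln (norm x / norm y) powr (p - 1) * ?D"
          using D p by (intro mult_right_mono powr_mono2) auto
        finally show ?thesis .
      qed simp
      then have "?D powr p / norm (x - y) ^ (2 * ?d) \<le> ln (norm x / norm y) powr (p - 1) * ?D / norm (x - y) ^ (2 * ?d)"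
        by (intro divide_right_mono) auto
      moreover have "H x y = ennreal (?D powr p / norm (x - y) ^ (2 * ?d))"
      proof -
        have "0 < norm (x - y)" using True by auto
        then have "norm (x - y) powr (2 * real ?d) = norm (x - y) ^ (2 * ?d)" by (simp add: powr_realpow[symmetric])
        then show ?thesis using True D by (simp add: H_def gagliardo_def abs_minus_commute)
      qed
      ultimately have "H x y \<le> ennreal (ln (norm x / norm y) powr (p - 1) / norm (x - y) ^ (2 * ?d) * ?D)"
        by (simp add: ennreal_leI)
      also have "\<dots> = log_kernel p x y * ennreal ?D"
        using True D by (subst ennreal_mult) (auto simp: log_kernel_def)
      also have "ennreal ?D = emeasure lborel {W x..<W y}" using D by simp
      also have "log_kernel p x y * \<dots> = (\<integral>\<^sup>+l. log_kernel p x y * indicator {W x..<W y} l \<partial>lborel)"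
        by (simp add: nn_integral_cmult_indicator)
      also have "\<dots> = (\<integral>\<^sup>+l\<in>{0..<L}. V x y l \<partial>lborel)"
        using W[of x] W[of y] by (intro nn_integral_cong) (auto simp: V_def split: split_indicator)
      finally show ?thesis .
    qed (simp add: H_def)
    have level: "(\<integral>\<^sup>+x. (\<integral>\<^sup>+y. V x y l \<partial>lborel) \<partial>lborel) \<le> J" for l
    proof (cases "(\<exists>x. W x \<le> l) \<and> (\<exists>y. y \<noteq> 0 \<and> l < W y)")
      case False
      have "AE y in lborel. V x y l = 0" for x
        using AE_lborel_singleton[of "0 :: real^'d"] by (rule eventually_mono) (use False in \<open>auto simp: V_def\<close>)
      then have "(\<integral>\<^sup>+y. V x y l \<partial>lborel) = 0" for x by (subst nn_integral_0_iff_AE) auto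
      then show ?thesis by simp
    next
      case True
      \<comment> \<open>The radius of the separating sphere. By continuity the points above the level form an open set, hence
  their norms are strictly less than \<open>r\<close>.\<close>
      define r where "r = Inf (norm ` {x. W x \<le> l})"
      have ne: "norm ` {x. W x \<le> l} \<noteq> {}" using True by auto
      have bdd: "bdd_below (norm ` {x. W x \<le> l})" by (intro bdd_belowI2[of _ 0]) auto
      have r_le: "r \<le> norm x" if "W x \<le> l" for x
        unfolding r_def by (rule cInf_lower[OF _ bdd]) (use that in auto)
      have less_r: "norm y < r" if y: "y \<noteq> 0" "l < W y" for y
      proof -
        have "((\<lambda>t. W ((1 + t) *\<^sub>R y)) \<longlongrightarrow> W ((1 + 0) *\<^sub>R y)) (at_right 0)"
          using cont by (intro isCont_tendsto_compose[of _ W] tendsto_intros) (simp add: continuous_on_eq_continuous_at)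
        then have "eventually (\<lambda>t. l < W ((1 + t) *\<^sub>R y)) (at_right 0)"
          using y(2) by (intro order_tendstoD(1)) auto
        moreover have "eventually (\<lambda>t::real. 0 < t) (at_right 0)" by (rule eventually_at_right_less)
        ultimately obtain t :: real where t: "l < W ((1 + t) *\<^sub>R y)" "0 < t"
          using eventually_happens[OF eventually_conj] trivial_limit_at_right_real by blast
        have "norm ((1 + t) *\<^sub>R y) \<le> r"
          unfolding r_def
        proof (rule cInf_greatest[OF ne])
          fix s assume "s \<in> norm ` {x. W x \<le> l}"
          then obtain x where x: "s = norm x" "W x \<le> l" by auto
          show "norm ((1 + t) *\<^sub>R y) \<le> s"
          proof (rule ccontr)
            assume "\<not> norm ((1 + t) *\<^sub>R y) \<le> s"
            then have "W ((1 + t) *\<^sub>R y) \<le> W x" using mono[of x "(1 + t) *\<^sub>R y"] x by simp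
            then show False using t x by simp
          qed
        qed
        moreover have "norm y < norm ((1 + t) *\<^sub>R y)" using t(2) y(1) by simp
        ultimately show ?thesis by simp
      qed
      obtain y0 where "y0 \<noteq> 0" "l < W y0" using True by blast
      then have r: "0 < r" using less_r[of y0] norm_ge_zero[of y0] by linarith
      have "(\<integral>\<^sup>+x. (\<integral>\<^sup>+y. V x y l \<partial>lborel) \<partial>lborel) \<le>
          (\<integral>\<^sup>+x. (\<integral>\<^sup>+y. (if norm y < r \<and> r \<le> norm x then log_kernel p x y else 0) \<partial>lborel) \<partial>(lborel :: (real^'d) measure))"
      proof (rule nn_integral_mono)
        fix x :: "real^'d"
        have "AE y in lborel. V x y l \<le> (if norm y < r \<and> r \<le> norm x then log_kernel p x y else 0)"
          using AE_lborel_singleton[of "0 :: real^'d"]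
          by (rule eventually_mono) (use r_le less_r in \<open>auto simp: V_def\<close>)
        then show "(\<integral>\<^sup>+y. V x y l \<partial>lborel) \<le> (\<integral>\<^sup>+y. (if norm y < r \<and> r \<le> norm x then log_kernel p x y else 0) \<partial>lborel)"
          by (rule nn_integral_mono_AE)
      qed
      also have "\<dots> \<le> J"
        using log_kernel_across_sphere[where 'a = "real^'d", OF p r] by (simp add: J_def)
      finally show ?thesis .
    qed
    have "(\<integral>\<^sup>+x. (\<integral>\<^sup>+y. H x y \<partial>lborel) \<partial>lborel) \<le> (\<integral>\<^sup>+x. (\<integral>\<^sup>+y. (\<integral>\<^sup>+l. V x y l * indicator {0..<L} l \<partial>lborel) \<partial>lborel) \<partial>lborel)"
    proof (rule nn_integral_mono)
      fix x :: "real^'d"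
      have "AE y in lborel. H x y \<le> (\<integral>\<^sup>+l. V x y l * indicator {0..<L} l \<partial>lborel)"
        using AE_lborel_singleton[of "0 :: real^'d"] by (rule eventually_mono) (rule H_le)
      then show "(\<integral>\<^sup>+y. H x y \<partial>lborel) \<le> (\<integral>\<^sup>+y. (\<integral>\<^sup>+l. V x y l * indicator {0..<L} l \<partial>lborel) \<partial>lborel)"
        by (rule nn_integral_mono_AE)
    qed
    also have "\<dots> = (\<integral>\<^sup>+x. (\<integral>\<^sup>+l. (\<integral>\<^sup>+y. V x y l * indicator {0..<L} l \<partial>lborel) \<partial>lborel) \<partial>lborel)"
      by (intro nn_integral_cong lborel_pair.Fubini') measurable
    also have "\<dots> = (\<integral>\<^sup>+l. (\<integral>\<^sup>+x. (\<integral>\<^sup>+y. V x y l * indicator {0..<L} l \<partial>lborel) \<partial>lborel) \<partial>lborel)"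
      by (intro lborel_pair.Fubini') measurable
    also have "\<dots> = (\<integral>\<^sup>+l. (\<integral>\<^sup>+x. (\<integral>\<^sup>+y. V x y l \<partial>lborel) \<partial>lborel) * indicator {0..<L} l \<partial>lborel)"
      by (simp add: nn_integral_multc)
    also have "\<dots> \<le> (\<integral>\<^sup>+l. J * indicator {0..<L} l \<partial>lborel)"
      by (intro nn_integral_mono mult_right_mono level) auto
    also have "\<dots> = ennreal L * J"
      using L by (simp add: nn_integral_cmult_indicator mult.commute)
    finally show "(\<integral>\<^sup>+x. (\<integral>\<^sup>+y. H x y \<partial>lborel) \<partial>lborel) \<le> ennreal L * J" .
  qed simp
  also have "2 * (ennreal L * J) = ennreal (2 * L) * J"
    using L by (simp add: ennreal_mult mult.assoc)
  finally show ?thesis .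
qed

section \<open>Smooth functions of a logarithm\<close>

text \<open>These functions vanish to infinite order at 0, and differentiation stays inside the family.\<close>

definition flat_exp :: "nat \<Rightarrow> real \<Rightarrow> real" where
  "flat_exp m t = (if 0 < t then exp (- 1 / t) / t ^ m else 0)"

lemma flat_exp_has_derivative:
  "(flat_exp m has_real_derivative (- real m * flat_exp (m + 1) t + flat_exp (m + 2) t)) (at t)"
proof -
  consider "t < 0" | "t = 0" | "0 < t" by linarith
  then show ?thesis
  proof cases
    case 1
    have "((\<lambda>_. 0) has_real_derivative 0) (at t)" by simp
    then have "(flat_exp m has_real_derivative 0) (at t)"
      by (rule has_field_derivative_transform_within_open[of _ _ _ "{..<0}"]) (use 1 in \<open>auto simp: flat_exp_def\<close>)
    then show ?thesis using 1 by (simp add: flat_exp_def)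
  next
    case 2
    have "((\<lambda>x::real. x ^ (m + 1) / exp x) \<longlongrightarrow> 0) at_top" by (rule tendsto_power_div_exp_0)
    then have "((\<lambda>h::real. inverse h ^ (m + 1) / exp (inverse h)) \<longlongrightarrow> 0) (at_right 0)"
      by (rule filterlim_compose[OF _ filterlim_inverse_at_top_right])
    then have "((\<lambda>h. flat_exp m h / h) \<longlongrightarrow> 0) (at_right 0)"
    proof (rule Lim_transform_eventually)
      show "\<forall>\<^sub>F h in at_right 0. inverse h ^ (m + 1) / exp (inverse h) = flat_exp m h / h"
        using eventually_at_right_less[of 0]
        by (rule eventually_mono) (simp add: flat_exp_def exp_minus field_simps)
    qed
    moreover have "((\<lambda>h. flat_exp m h / h) \<longlongrightarrow> 0) (at_left 0)"
    proof (rule tendsto_eventually)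
      show "\<forall>\<^sub>F h in at_left 0. flat_exp m h / h = 0"
        by (rule eventually_at_leftI[of "-1"]) (auto simp: flat_exp_def)
    qed
    ultimately have "((\<lambda>h. flat_exp m h / h) \<longlongrightarrow> 0) (at 0)"
      by (simp add: filterlim_at_split)
    then have "(flat_exp m has_real_derivative 0) (at 0)"
      by (simp add: DERIV_def flat_exp_def)
    then show ?thesis by (simp add: 2 flat_exp_def)
  next
    case 3
    have "((\<lambda>t. exp (- 1 / t) / t ^ m) has_real_derivative (- real m * flat_exp (m + 1) t + flat_exp (m + 2) t)) (at t)"
    proof -
      have "((\<lambda>t. exp (- 1 / t) / t ^ m) has_real_derivative
          ((exp (- 1 / t) * (1 / t\<^sup>2)) * t ^ m - exp (- 1 / t) * (real m * t ^ (m - 1))) / (t ^ m * t ^ m)) (at t)"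
        using 3 by (auto intro!: derivative_eq_intros simp: power2_eq_square)
      moreover have "((exp (- 1 / t) * (1 / t\<^sup>2)) * t ^ m - exp (- 1 / t) * (real m * t ^ (m - 1))) / (t ^ m * t ^ m) =
          - real m * flat_exp (m + 1) t + flat_exp (m + 2) t"
      proof (cases m)
        case 0
        then show ?thesis using 3 by (simp add: flat_exp_def power2_eq_square)
      next
        case (Suc k)
        then show ?thesis using 3 by (simp add: flat_exp_def field_simps power2_eq_square)
      qed
      ultimately show ?thesis by simp
    qed
    then show ?thesis
      by (rule has_field_derivative_transform_within_open[of _ _ _ "{0<..}"]) (use 3 in \<open>auto simp: flat_exp_def\<close>)
  qed
qed

text \<open>The constant \<open>b > 0\<close> removes the singularity of the logarithm at \<open>x0\<close>.\<close>

definition log_depth :: "'a::real_inner \<Rightarrow> real \<Rightarrow> real \<Rightarrow> 'a \<Rightarrow> real" where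
  "log_depth x0 b c x = c - ln ((norm (x - x0))\<^sup>2 + b) / 2"

text \<open>A family of functions closed under directional derivatives, which makes all its members smooth without
  any formula for the higher derivatives.\<close>

inductive bump_algebra :: "'a::real_inner \<Rightarrow> real \<Rightarrow> real \<Rightarrow> ('a \<Rightarrow> real) \<Rightarrow> bool" for x0 b c where
  const: "bump_algebra x0 b c (\<lambda>x. k)"
| linear: "bump_algebra x0 b c (\<lambda>x. (x - x0) \<bullet> v)"
| depth: "bump_algebra x0 b c (log_depth x0 b c)"
| inv: "bump_algebra x0 b c (\<lambda>x. 1 / ((norm (x - x0))\<^sup>2 + b))"
| flat: "bump_algebra x0 b c (\<lambda>x. flat_exp m (log_depth x0 b c x))"
| add: "bump_algebra x0 b c f \<Longrightarrow> bump_algebra x0 b c g \<Longrightarrow> bump_algebra x0 b c (\<lambda>x. f x + g x)"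
| mult: "bump_algebra x0 b c f \<Longrightarrow> bump_algebra x0 b c g \<Longrightarrow> bump_algebra x0 b c (\<lambda>x. f x * g x)"

text \<open>The derivatives of the generators are polynomials in the generators; sums and products follow by the
  rules of differentiation.\<close>

lemma bump_algebra_derivative:
  fixes f :: "'a::real_inner \<Rightarrow> real"
  assumes "bump_algebra x0 b c f" and b: "0 < b"
  shows "\<exists>f'. (\<forall>x. (f has_derivative f' x) (at x)) \<and> (\<forall>v. bump_algebra x0 b c (\<lambda>x. f' x v))"
  using assms(1)
proof induction
  case (const k)
  show ?case by (intro exI[of _ "\<lambda>x h. 0"]) (auto intro: bump_algebra.const)
next
  case (linear v)
  have "((\<lambda>x. (x - x0) \<bullet> v) has_derivative (\<lambda>h. h \<bullet> v)) (at x)" for x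
    by (auto intro!: derivative_eq_intros)
  then show ?case by (intro exI[of _ "\<lambda>x h. h \<bullet> v"]) (auto intro: bump_algebra.const)
next
  case depth
  have N: "0 < (norm (x - x0))\<^sup>2 + b" for x using b by (simp add: add_nonneg_pos)
  have d: "(log_depth x0 b c has_derivative (\<lambda>h. (- 1) * ((x - x0) \<bullet> h) * (1 / ((norm (x - x0))\<^sup>2 + b)))) (at x)" for x
    unfolding log_depth_def power2_norm_eq_inner
    using N[of x] unfolding power2_norm_eq_inner
    by (auto intro!: derivative_eq_intros simp: inner_commute field_simps)
  show ?case
    by (intro exI[of _ "\<lambda>x h. (- 1) * ((x - x0) \<bullet> h) * (1 / ((norm (x - x0))\<^sup>2 + b))"] conjI allI d
        bump_algebra.mult bump_algebra.const bump_algebra.linear bump_algebra.inv)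
next
  case inv
  have N: "0 < (norm (x - x0))\<^sup>2 + b" for x using b by (simp add: add_nonneg_pos)
  have d: "((\<lambda>x. 1 / ((norm (x - x0))\<^sup>2 + b)) has_derivative
      (\<lambda>h. (- 2) * ((x - x0) \<bullet> h) * (1 / ((norm (x - x0))\<^sup>2 + b)) * (1 / ((norm (x - x0))\<^sup>2 + b)))) (at x)" for x
    using N[of x] unfolding power2_norm_eq_inner
    by (auto intro!: derivative_eq_intros simp: inner_commute field_simps power2_eq_square)
  show ?case
    by (intro exI[of _ "\<lambda>x h. (- 2) * ((x - x0) \<bullet> h) * (1 / ((norm (x - x0))\<^sup>2 + b)) * (1 / ((norm (x - x0))\<^sup>2 + b))"] conjI allI d
        bump_algebra.mult bump_algebra.const bump_algebra.linear bump_algebra.inv)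
next
  case (flat m)
  have N: "0 < (norm (x - x0))\<^sup>2 + b" for x using b by (simp add: add_nonneg_pos)
  have d: "(log_depth x0 b c has_derivative (\<lambda>h. (- 1) * ((x - x0) \<bullet> h) * (1 / ((norm (x - x0))\<^sup>2 + b)))) (at x)" for x
    unfolding log_depth_def power2_norm_eq_inner
    using N[of x] unfolding power2_norm_eq_inner
    by (auto intro!: derivative_eq_intros simp: inner_commute field_simps)
  let ?D = "\<lambda>x h. (- 1) * ((x - x0) \<bullet> h) * (1 / ((norm (x - x0))\<^sup>2 + b)) *
      ((- real m) * flat_exp (m + 1) (log_depth x0 b c x) + flat_exp (m + 2) (log_depth x0 b c x))"
  have "((\<lambda>x. flat_exp m (log_depth x0 b c x)) has_derivative ?D x) (at x)" for x
    by (rule DERIV_compose_FDERIV[OF flat_exp_has_derivative d])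
  then show ?case
    by (intro exI[of _ ?D] conjI allI bump_algebra.add bump_algebra.mult bump_algebra.const bump_algebra.linear
        bump_algebra.inv bump_algebra.flat)
next
  case (add f g)
  then obtain f' g' where
    "\<And>x. (f has_derivative f' x) (at x)" "\<And>v. bump_algebra x0 b c (\<lambda>x. f' x v)"
    "\<And>x. (g has_derivative g' x) (at x)" "\<And>v. bump_algebra x0 b c (\<lambda>x. g' x v)" by metis
  then show ?case
    by (intro exI[of _ "\<lambda>x h. f' x h + g' x h"] conjI allI has_derivative_add bump_algebra.add)
next
  case (mult f g)
  then obtain f' g' where fg:
    "\<And>x. (f has_derivative f' x) (at x)" "\<And>v. bump_algebra x0 b c (\<lambda>x. f' x v)"
    "\<And>x. (g has_derivative g' x) (at x)" "\<And>v. bump_algebra x0 b c (\<lambda>x. g' x v)" by metis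
  then show ?case using mult.hyps
    by (intro exI[of _ "\<lambda>x h. f x * g' x h + f' x h * g x"] conjI allI has_derivative_mult bump_algebra.add bump_algebra.mult)
qed

lemma bump_algebra_Ck:
  fixes f :: "'a::euclidean_space \<Rightarrow> real"
  assumes "bump_algebra x0 b c f" "0 < b"
  shows "Ck n f"
  using assms(1)
proof (induction n arbitrary: f)
  case 0
  then obtain f' where "\<And>x. (f has_derivative f' x) (at x)" using bump_algebra_derivative[OF 0 assms(2)] by blast
  then show ?case by (auto intro!: continuous_at_imp_continuous_on has_derivative_continuous)
next
  case (Suc n)
  obtain f' where f': "\<And>x. (f has_derivative f' x) (at x)" "\<And>v. bump_algebra x0 b c (\<lambda>x. f' x v)"
    using bump_algebra_derivative[OF Suc.prems assms(2)] by blast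
  then have "frechet_derivative f (at x) = f' x" for x by (metis frechet_derivative_at)
  then show ?case using f' Suc.IH by (auto simp: differentiable_def)
qed

text \<open>A smooth function that vanishes on the negative half-line, has slope between 0 and 1, and stays within 1 of the
  identity on the positive half-line.\<close>

definition smooth_ramp :: "real \<Rightarrow> real" where
  "smooth_ramp t = t * flat_exp 0 t"

lemma smooth_ramp_has_derivative:
  "(smooth_ramp has_real_derivative (flat_exp 0 t + flat_exp 1 t)) (at t)"
proof -
  have "(smooth_ramp has_real_derivative (1 * flat_exp 0 t + (- real 0 * flat_exp (0 + 1) t + flat_exp (0 + 2) t) * t)) (at t)"
    unfolding smooth_ramp_def by (intro DERIV_mult DERIV_ident flat_exp_has_derivative)
  moreover have "flat_exp (0 + 2) t * t = flat_exp 1 t" by (simp add: flat_exp_def)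
  ultimately show ?thesis by simp
qed

text \<open>For \<open>t > 0\<close> the slope is \<open>(1 + 1 / t) exp(- 1 / t)\<close>, and \<open>1 + y \<le> exp y\<close>.\<close>

lemma smooth_ramp_slope: "0 \<le> flat_exp 0 t + flat_exp 1 t" "flat_exp 0 t + flat_exp 1 t \<le> 1"
proof -
  show "0 \<le> flat_exp 0 t + flat_exp 1 t" by (simp add: flat_exp_def)
  show "flat_exp 0 t + flat_exp 1 t \<le> 1"
  proof (cases "0 < t")
    case True
    have "1 + 1 / t \<le> exp (1 / t)" by (rule exp_ge_add_one_self)
    then have "(1 + 1 / t) * exp (- (1 / t)) \<le> exp (1 / t) * exp (- (1 / t))" by (intro mult_right_mono) auto
    also have "\<dots> = 1" by (simp add: exp_minus)
    finally show ?thesis using True by (simp add: flat_exp_def algebra_simps)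
  qed (simp add: flat_exp_def)
qed

lemma smooth_ramp_mono_lipschitz:
  assumes "t \<le> t'"
  shows "smooth_ramp t \<le> smooth_ramp t'" "smooth_ramp t' - smooth_ramp t \<le> t' - t"
proof -
  show "smooth_ramp t \<le> smooth_ramp t'"
    by (rule DERIV_nonneg_imp_nondecreasing[OF assms]) (intro exI conjI, rule smooth_ramp_has_derivative, rule smooth_ramp_slope)
  have d: "((\<lambda>t. t - smooth_ramp t) has_real_derivative (1 - (flat_exp 0 x + flat_exp 1 x))) (at x)" for x
    by (intro DERIV_diff DERIV_ident smooth_ramp_has_derivative)
  have "t - smooth_ramp t \<le> t' - smooth_ramp t'"
    by (rule DERIV_nonneg_imp_nondecreasing[OF assms]) (intro exI conjI, rule d, use smooth_ramp_slope(2) in simp)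
  then show "smooth_ramp t' - smooth_ramp t \<le> t' - t" by simp
qed

lemma smooth_ramp_bounds:
  "0 \<le> smooth_ramp t" "t \<le> 0 \<Longrightarrow> smooth_ramp t = 0" "0 \<le> t \<Longrightarrow> smooth_ramp t \<le> t" "t - 1 \<le> smooth_ramp t"
proof -
  show "0 \<le> smooth_ramp t" by (simp add: smooth_ramp_def flat_exp_def)
  show "t \<le> 0 \<Longrightarrow> smooth_ramp t = 0" by (simp add: smooth_ramp_def flat_exp_def)
  show "0 \<le> t \<Longrightarrow> smooth_ramp t \<le> t"
    using smooth_ramp_mono_lipschitz(2)[of 0 t] by (simp add: smooth_ramp_def flat_exp_def)
  show "t - 1 \<le> smooth_ramp t"
  proof (cases "0 < t")
    case True
    have "1 - 1 / t \<le> exp (- (1 / t))" using exp_ge_add_one_self[of "- (1 / t)"] by simp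
    then have "t * (1 - 1 / t) \<le> t * exp (- (1 / t))" using True by (intro mult_left_mono) auto
    then show ?thesis using True by (simp add: smooth_ramp_def flat_exp_def algebra_simps)
  qed (simp add: smooth_ramp_def flat_exp_def)
qed

section \<open>Logarithmic bumps\<close>

text \<open>The quantity whose power is taken in the definition of \<open>alpha_upper\<close>.\<close>

definition energy_const :: "nat \<Rightarrow> real \<Rightarrow> real" where
  "energy_const d p = 2 * (real d * unit_ball_vol (real d))\<^sup>2 * Gamma (p + 1) / fact d *
     (\<Sum>n. fact (d + n - 1) / fact n * (1 / real (d + 2 * n) powr p))"

text \<open>The quotient of factorials has at most the order \<open>n\<^sup>d\<^sup>-\<^sup>1\<close>, so the terms decay at least like \<open>n\<close> to the power \<open>d - 1 - p < -1\<close>.\<close>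

lemma summable_energy_series:
  fixes p :: real
  assumes "real d < p" "0 < d"
  shows "summable (\<lambda>n. fact (d + n - 1) / fact n * (1 / real (d + 2 * n) powr p))"
proof (rule summable_comparison_test')
  have "summable (\<lambda>n. real n powr (real (d - 1) - p))"
    using assms by (subst summable_real_powr_iff) (auto simp: of_nat_diff)
  then show "summable (\<lambda>n. real (Suc n) powr (real (d - 1) - p))"
    by (subst summable_Suc_iff)
  fix n :: nat
  have "fact (d + n - 1) / fact n \<le> real (d + 2 * n) ^ (d - 1)"
  proof -
    have r: "d - 1 \<le> d + n - 1" "d + n - 1 - (d - 1) = n" using assms by auto
    have "(fact (d + n - 1) :: nat) div fact n \<le> (d + n - 1) ^ (d - 1)"
      using fact_div_fact_le_pow[OF r(1)] r(2) by simp
    also have "\<dots> \<le> (d + 2 * n) ^ (d - 1)" by (intro power_mono) auto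
    finally have "real ((fact (d + n - 1) :: nat) div fact n) \<le> real ((d + 2 * n) ^ (d - 1))"
      by (rule of_nat_mono)
    moreover have "real ((fact (d + n - 1) :: nat) div fact n) = fact (d + n - 1) / fact n"
      using assms by (subst real_of_nat_div) (auto intro!: fact_dvd)
    ultimately show ?thesis by simp
  qed
  then have "fact (d + n - 1) / fact n * (1 / real (d + 2 * n) powr p) \<le> real (d + 2 * n) ^ (d - 1) * (1 / real (d + 2 * n) powr p)"
    by (intro mult_right_mono) auto
  also have "\<dots> = real (d + 2 * n) powr (real (d - 1) - p)"
  proof -
    define X where "X = real (d + 2 * n)"
    have "0 < X" using assms by (simp add: X_def)
    then have "X ^ (d - 1) * (1 / X powr p) = X powr (real (d - 1) - p)"
      by (simp only: powr_diff powr_realpow) simp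
    then show ?thesis by (simp only: X_def)
  qed
  also have "\<dots> \<le> real (Suc n) powr (real (d - 1) - p)"
    using assms by (intro powr_mono2') auto
  finally show "norm (fact (d + n - 1) / fact n * (1 / real (d + 2 * n) powr p)) \<le> real (Suc n) powr (real (d - 1) - p)"
    by simp
qed

lemma energy_const_pos:
  assumes "real d < p" "0 < d"
  shows "0 < energy_const d p"
proof -
  have "0 < (\<Sum>n. fact (d + n - 1) / fact n * (1 / real (d + 2 * n) powr p))"
    using assms by (intro suminf_pos summable_energy_series) auto
  moreover have "0 < Gamma (p + 1)" using assms by (intro Gamma_real_pos) simp
  moreover have "0 < unit_ball_vol (real d)" by simp
  ultimately show ?thesis using assms unfolding energy_const_def by (intro mult_pos_pos divide_pos_pos zero_less_power) auto
qed

lemma energy_const_series: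
  assumes "real d < p" "0 < d" "0 \<le> L"
  shows "ennreal (2 * L) * (\<Sum>n. ennreal (unit_ball_vol d * (d * unit_ball_vol d) * negbin d n *
      (Gamma (p + 1) / real (d + 2 * n) powr p))) = ennreal (L * energy_const d p)"
proof -
  let ?w = "unit_ball_vol (real d)"
  define C where "C = ?w * (d * ?w) * Gamma (p + 1) / fact (d - 1)"
  have G: "0 < Gamma (p + 1)" using assms by (intro Gamma_real_pos) simp
  have C: "0 \<le> C" using G by (simp add: C_def)
  let ?t = "\<lambda>n. fact (d + n - 1) / fact n * (1 / real (d + 2 * n) powr p)"
  have t: "?w * (d * ?w) * negbin d n * (Gamma (p + 1) / real (d + 2 * n) powr p) = C * ?t n" for n
    by (simp add: C_def negbin_def mult_ac)
  have s: "summable ?t" by (rule summable_energy_series[OF assms(1,2)])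
  have "(\<Sum>n. ennreal (?w * (d * ?w) * negbin d n * (Gamma (p + 1) / real (d + 2 * n) powr p))) = (\<Sum>n. ennreal (C * ?t n))"
    unfolding t ..
  also have "\<dots> = ennreal (\<Sum>n. C * ?t n)"
    using C s by (intro suminf_ennreal2 summable_mult) auto
  also have "(\<Sum>n. C * ?t n) = C * (\<Sum>n. ?t n)" by (rule suminf_mult[OF s])
  finally have "ennreal (2 * L) * (\<Sum>n. ennreal (?w * (d * ?w) * negbin d n * (Gamma (p + 1) / real (d + 2 * n) powr p))) =
      ennreal (2 * L * (C * (\<Sum>n. ?t n)))"
    using assms C s by (simp add: ennreal_mult[symmetric] suminf_nonneg)
  also have "2 * L * (C * (\<Sum>n. ?t n)) = L * energy_const d p"
  proof -
    have "(fact d :: real) = d * fact (d - 1)" using assms(2) by (simp add: fact_reduce)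
    then have "2 * C = 2 * (real d * ?w)\<^sup>2 * Gamma (p + 1) / fact d"
      using assms(2) by (simp add: C_def power2_eq_square)
    then have "energy_const d p = 2 * C * (\<Sum>n. ?t n)" by (simp only: energy_const_def)
    then show ?thesis by simp
  qed
  finally show ?thesis .
qed

text \<open>A smooth version of \<open>ln(R / |x - x0|)\<close>, levelled off at radius \<open>a\<close> and cut off at radius \<open>R\<close>.\<close>

definition log_bump :: "'a::real_inner \<Rightarrow> real \<Rightarrow> real \<Rightarrow> 'a \<Rightarrow> real" where
  "log_bump x0 a R x = smooth_ramp (log_depth x0 (a\<^sup>2) (ln R) x)"

lemma log_bump_algebra: "bump_algebra x0 (a\<^sup>2) (ln R) (\<lambda>x. k * log_bump x0 a R x)"
  unfolding log_bump_def smooth_ramp_def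
  by (intro bump_algebra.mult bump_algebra.const bump_algebra.depth bump_algebra.flat)

lemma log_bump_support:
  assumes "0 < a" "0 < R" "log_bump x0 a R x \<noteq> 0"
  shows "x \<in> ball x0 R"
proof -
  have "0 < log_depth x0 (a\<^sup>2) (ln R) x"
    using assms(3) smooth_ramp_bounds(2)[of "log_depth x0 (a\<^sup>2) (ln R) x"] by (auto simp: log_bump_def not_less[symmetric])
  then have "ln ((norm (x - x0))\<^sup>2 + a\<^sup>2) < 2 * ln R" by (simp add: log_depth_def)
  also have "2 * ln R = ln (R\<^sup>2)" using assms by (simp add: ln_realpow)
  finally have "(norm (x - x0))\<^sup>2 + a\<^sup>2 < R\<^sup>2" using assms by (subst (asm) ln_less_cancel_iff) (auto intro: add_nonneg_pos)
  then have "(norm (x - x0))\<^sup>2 < R\<^sup>2" by (smt (verit) zero_le_power2)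
  then have "norm (x - x0) < R" using assms(2) by (auto intro: power2_less_imp_less)
  then show ?thesis by (simp add: dist_norm norm_minus_commute)
qed

lemma log_bump_bounds:
  assumes a: "0 < a" "a < R"
  shows "0 \<le> log_bump x0 a R x" "log_bump x0 a R x \<le> ln (R / a)"
    and "x \<in> ball x0 a \<Longrightarrow> ln (R / a) - 2 \<le> log_bump x0 a R x"
proof -
  have N: "0 < (norm (x - x0))\<^sup>2 + a\<^sup>2" using a by (intro add_nonneg_pos) auto
  have la: "ln (a\<^sup>2) = 2 * ln a" using a by (simp add: ln_realpow)
  have lR: "ln (R / a) = ln R - ln a" using a by (simp add: ln_div)
  have "ln (a\<^sup>2) \<le> ln ((norm (x - x0))\<^sup>2 + a\<^sup>2)" using a N by (subst ln_le_cancel_iff) auto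
  then have d: "log_depth x0 (a\<^sup>2) (ln R) x \<le> ln (R / a)" by (simp add: log_depth_def la lR)
  show "0 \<le> log_bump x0 a R x" by (simp add: log_bump_def smooth_ramp_bounds)
  have "0 < ln (R / a)" using a by simp
  have "log_bump x0 a R x \<le> smooth_ramp (ln (R / a))"
    unfolding log_bump_def by (rule smooth_ramp_mono_lipschitz(1)[OF d])
  also have "\<dots> \<le> ln (R / a)" using \<open>0 < ln (R / a)\<close> by (intro smooth_ramp_bounds(3)) simp
  finally show "log_bump x0 a R x \<le> ln (R / a)" .
  assume "x \<in> ball x0 a"
  then have "norm (x - x0) < a" by (simp add: dist_norm norm_minus_commute)
  then have "(norm (x - x0))\<^sup>2 < a\<^sup>2" by (intro power_strict_mono) auto
  then have "ln ((norm (x - x0))\<^sup>2 + a\<^sup>2) \<le> ln (2 * a\<^sup>2)" using N by (subst ln_le_cancel_iff) auto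
  also have "\<dots> = ln 2 + 2 * ln a" using a by (simp add: ln_mult la)
  also have "ln 2 \<le> (1::real)" using ln_add_one_self_le_self[of "1::real"] by simp
  finally have "ln (R / a) - 1 \<le> log_depth x0 (a\<^sup>2) (ln R) x" by (simp add: log_depth_def lR)
  then show "ln (R / a) - 2 \<le> log_bump x0 a R x"
    using smooth_ramp_bounds(4)[of "log_depth x0 (a\<^sup>2) (ln R) x"] by (simp add: log_bump_def)
qed

text \<open>Adding \<open>a\<^sup>2\<close> to numerator and denominator of a quotient that is at least 1 decreases it, so the
  regularised logarithm inherits the Lipschitz bound of the logarithm.\<close>

lemma log_bump_radial:
  assumes a: "0 < a" "a < R"
  shows "norm (y - x0) \<le> norm (x - x0) \<Longrightarrow> log_bump x0 a R x \<le> log_bump x0 a R y"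
    and "y \<noteq> x0 \<Longrightarrow> norm (y - x0) \<le> norm (x - x0) \<Longrightarrow> log_bump x0 a R y - log_bump x0 a R x \<le> ln (norm (x - x0) / norm (y - x0))"
proof -
  have N: "0 < (norm (z - x0))\<^sup>2 + a\<^sup>2" for z using a by (intro add_nonneg_pos) auto
  assume le: "norm (y - x0) \<le> norm (x - x0)"
  then have sq: "(norm (y - x0))\<^sup>2 \<le> (norm (x - x0))\<^sup>2" by (intro power_mono) auto
  then have depth: "log_depth x0 (a\<^sup>2) (ln R) x \<le> log_depth x0 (a\<^sup>2) (ln R) y"
    using N by (simp add: log_depth_def)
  show "log_bump x0 a R x \<le> log_bump x0 a R y"
    unfolding log_bump_def by (rule smooth_ramp_mono_lipschitz(1)[OF depth])
  assume "y \<noteq> x0"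
  then have y: "0 < norm (y - x0)" by simp
  then have x: "0 < norm (x - x0)" using le by linarith
  have "log_bump x0 a R y - log_bump x0 a R x \<le> log_depth x0 (a\<^sup>2) (ln R) y - log_depth x0 (a\<^sup>2) (ln R) x"
    unfolding log_bump_def by (rule smooth_ramp_mono_lipschitz(2)[OF depth])
  also have "\<dots> = ln (((norm (x - x0))\<^sup>2 + a\<^sup>2) / ((norm (y - x0))\<^sup>2 + a\<^sup>2)) / 2"
    using N[of x] N[of y] by (subst ln_div) (auto simp: log_depth_def)
  also have "\<dots> \<le> ln ((norm (x - x0) / norm (y - x0))\<^sup>2) / 2"
  proof -
    have "(norm (y - x0))\<^sup>2 * a\<^sup>2 \<le> (norm (x - x0))\<^sup>2 * a\<^sup>2" using sq by (intro mult_right_mono) auto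
    then have "((norm (x - x0))\<^sup>2 + a\<^sup>2) / ((norm (y - x0))\<^sup>2 + a\<^sup>2) \<le> (norm (x - x0) / norm (y - x0))\<^sup>2"
      using N[of y] y by (simp add: power_divide divide_simps algebra_simps)
    then show ?thesis using N[of x] N[of y] x y by (simp add: divide_pos_pos)
  qed
  also have "\<dots> = ln (norm (x - x0) / norm (y - x0))" using x y by (simp add: ln_realpow divide_pos_pos)
  finally show "log_bump x0 a R y - log_bump x0 a R x \<le> ln (norm (x - x0) / norm (y - x0))" .
qed

lemma continuous_log_bump:
  fixes x0 :: "'a::euclidean_space"
  assumes "0 < a"
  shows "continuous_on UNIV (log_bump x0 a R)"
  using bump_algebra_Ck[OF log_bump_algebra[of x0 a R 1], of 0] assms by simp

lemma log_bump_energy: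
  fixes x0 :: "real^'d"
  assumes a: "0 < a" "a < R" and p: "real CARD('d) < p"
  shows "(energy p (log_bump x0 a R)) \<le>
    ennreal (ln (R / a) * energy_const CARD('d) p)"
proof -
  let ?W = "log_bump (0 :: real^'d) a R"
  have shift: "(\<integral>\<^sup>+x. f (x - x0) \<partial>lborel) = (\<integral>\<^sup>+x. f x \<partial>lborel)" if [measurable]: "f \<in> borel_measurable borel" for f :: "real^'d \<Rightarrow> ennreal"
  proof -
    have "(\<integral>\<^sup>+x. f (x - x0) \<partial>lborel) = (\<integral>\<^sup>+x. f (x - x0) \<partial>distr lborel borel ((+) x0))"
      by (simp add: lborel_distr_plus)
    also have "\<dots> = (\<integral>\<^sup>+x. f x \<partial>lborel)" by (subst nn_integral_distr) auto
    finally show ?thesis .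
  qed
  have [measurable]: "log_bump z a R \<in> borel_measurable borel" for z :: "real^'d"
    by (rule borel_measurable_continuous_onI[OF continuous_log_bump[OF a(1)]])
  have g_meas [measurable (raw)]: "(\<lambda>w. gagliardo p (log_bump z a R) (f w) (g w)) \<in> borel_measurable M"
    if [measurable]: "f \<in> borel_measurable M" "g \<in> borel_measurable M" for f g and M :: "'c measure" and z :: "real^'d"
    unfolding gagliardo_def by measurable
  have eq: "gagliardo p (log_bump x0 a R) x y = gagliardo p ?W (x - x0) (y - x0)" for x y
    by (simp add: gagliardo_def log_bump_def log_depth_def)
  have "(energy p (log_bump x0 a R)) =
      (\<integral>\<^sup>+x. (\<integral>\<^sup>+y. gagliardo p (log_bump x0 a R) x y \<partial>lborel) \<partial>lborel)"
    by (simp add: nn_integral_completion)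
  also have "\<dots> = (\<integral>\<^sup>+x. (\<integral>\<^sup>+y. gagliardo p ?W (x - x0) y \<partial>lborel) \<partial>lborel)"
    unfolding eq by (intro nn_integral_cong shift) measurable
  also have "\<dots> = (\<integral>\<^sup>+x. (\<integral>\<^sup>+y. gagliardo p ?W x y \<partial>lborel) \<partial>lborel)"
    by (rule shift) measurable
  also have "\<dots> = energy p ?W"
    by (simp add: nn_integral_completion)
  also have "\<dots> \<le> ennreal (2 * ln (R / a)) * (\<Sum>n. ennreal (unit_ball_vol CARD('d) * (CARD('d) * unit_ball_vol CARD('d)) * negbin CARD('d) n *
      (Gamma (p + 1) / real (CARD('d) + 2 * n) powr p)))"
  proof (rule gagliardo_energy_radial)
    have "1 \<le> real CARD('d)" by simp
    then show "1 < p" using p by linarith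
    show "continuous_on UNIV ?W" by (rule continuous_log_bump[OF a(1)])
    show "0 \<le> ?W x" "?W x \<le> ln (R / a)" for x using log_bump_bounds[OF a] by auto
    show "?W x \<le> ?W y" if "norm y \<le> norm x" for x y using log_bump_radial(1)[OF a, of y 0 x] that by simp
    show "?W y - ?W x \<le> ln (norm x / norm y)" if "y \<noteq> 0" "norm y \<le> norm x" for x y
      using log_bump_radial(2)[OF a, of y 0 x] that by simp
  qed
  also have "\<dots> = ennreal (ln (R / a) * energy_const CARD('d) p)"
    using a p by (intro energy_const_series) auto
  finally show ?thesis .
qed

section \<open>Large exponents\<close>

lemma log_bump_in_Wsp0_tilde:
  fixes x0 :: "real^'d"
  assumes \<Omega>: "open \<Omega>" "bounded \<Omega>" and sub: "cball x0 R \<subseteq> \<Omega> - K" and a: "0 < a" "a < R"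
    and p: "s * p = real CARD('d)" "real CARD('d) < p"
  defines "u \<equiv> (\<lambda>x. 1 / (ln (R / a) * energy_const CARD('d) p) powr (1 / p) * log_bump x0 a R x)"
  shows "u \<in> Wsp0_tilde s p \<Omega> K" and "Wsp_seminorm s p UNIV u \<le> 1"
proof -
  define Z where "Z = ln (R / a) * energy_const CARD('d) p"
  define q where "q = 1 / Z powr (1 / p)"
  have "0 < real CARD('d)" by simp
  then have p0: "0 < p" using p by linarith
  have Z: "0 < Z" using a p(2) energy_const_pos[of "CARD('d)" p] by (simp add: Z_def)
  have q: "0 < q" "q powr p = 1 / Z" using Z p0 by (simp_all add: q_def powr_divide powr_powr)
  have u: "u = (\<lambda>x. q * log_bump x0 a R x)" by (simp add: u_def q_def Z_def)
  have cont: "continuous_on UNIV u"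
    unfolding u using continuous_log_bump[OF a(1)] by (intro continuous_intros) auto
  then have u_meas: "u \<in> borel_measurable lebesgue"
    by (intro measurable_completion) (simp add: borel_measurable_continuous_onI)
  have Cc: "u \<in> Cc_infinity (\<Omega> - K)"
  proof -
    have "Ck n u" for n unfolding u by (rule bump_algebra_Ck[OF log_bump_algebra]) (use a in auto)
    moreover have "{x. u x \<noteq> 0} \<subseteq> cball x0 R"
      using log_bump_support[OF a(1), of R x0] a by (fastforce simp: u)
    then have "closure {x. u x \<noteq> 0} \<subseteq> cball x0 R" by (intro closure_minimal) auto
    ultimately show ?thesis using sub
      by (auto simp: Cc_infinity_def compact_eq_bounded_closed intro: bounded_subset[OF bounded_cball])
  qed
  have u0: "u x = 0" if "x \<notin> \<Omega> - K" for x
  proof (rule ccontr)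
    assume "u x \<noteq> 0"
    then have "x \<in> ball x0 R" using log_bump_support[OF a(1), of R x0 x] a by (simp add: u)
    then have "x \<in> cball x0 R" by simp
    then show False using sub that by blast
  qed
  have E: "energy p u \<le> 1"
  proof -
    have [measurable]: "log_bump x0 a R \<in> borel_measurable lebesgue"
      by (intro measurable_completion) (simp add: borel_measurable_continuous_onI[OF continuous_log_bump[OF a(1)]])
    have [measurable]: "(\<lambda>x. potential p (log_bump x0 a R) x) \<in> borel_measurable lebesgue"
      by (rule lebesgue.borel_measurable_nn_integral) measurable
    have "gagliardo p u x y = ennreal (1 / Z) * gagliardo p (log_bump x0 a R) x y" for x y
    proof -
      have "\<bar>u x - u y\<bar> = q * \<bar>log_bump x0 a R x - log_bump x0 a R y\<bar>"
        using q(1) by (simp add: u abs_mult right_diff_distrib[symmetric])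
      then have "\<bar>u x - u y\<bar> powr p = 1 / Z * \<bar>log_bump x0 a R x - log_bump x0 a R y\<bar> powr p"
        using q by (simp add: powr_mult)
      then show ?thesis using Z by (simp add: gagliardo_def ennreal_mult[symmetric])
    qed
    then have "(energy p u) =
        ennreal (1 / Z) * energy p (log_bump x0 a R)"
      by (simp add: nn_integral_cmult)
    also have "\<dots> \<le> ennreal (1 / Z) * ennreal Z"
      using log_bump_energy[OF a p(2), of x0] by (intro mult_left_mono) (auto simp: Z_def)
    also have "\<dots> = 1" using Z by (simp add: ennreal_mult[symmetric])
    finally show ?thesis .
  qed
  then show "Wsp_seminorm s p UNIV u \<le> 1"
    using p0 by (simp add: Wsp_seminorm_eq[OF p(1)] epowr_le_1_iff)
  have "u \<in> Wsp s p \<Omega>"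
  proof -
    have "energy_on p u \<Omega> \<le> energy p u"
      by (intro nn_integral_mono) (auto intro!: nn_integral_mono split: split_indicator)
    then have 1: "energy_on p u \<Omega> < \<infinity>"
      by (rule le_less_trans[OF order_trans[OF _ E]]) simp
    have 2: "(\<integral>\<^sup>+x\<in>\<Omega>. ennreal (\<bar>u x\<bar> powr p) \<partial>lebesgue) < \<infinity>"
    proof -
      have \<Omega>m: "\<Omega> \<in> sets lebesgue" using \<Omega>(1) by (intro sets_completionI_sets) (simp add: borel_open)
      have "\<bar>u x\<bar> powr p \<le> (q * ln (R / a)) powr p" for x
        using log_bump_bounds[OF a, of x0 x] q(1) p0 by (intro powr_mono2) (auto simp: u abs_mult)
      then have "(\<integral>\<^sup>+x\<in>\<Omega>. ennreal (\<bar>u x\<bar> powr p) \<partial>lebesgue) \<le> (\<integral>\<^sup>+x\<in>\<Omega>. ennreal ((q * ln (R / a)) powr p) \<partial>lebesgue)"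
        by (intro nn_integral_mono mult_right_mono ennreal_leI) auto
      also have "\<dots> = ennreal ((q * ln (R / a)) powr p) * emeasure lebesgue \<Omega>"
        by (rule nn_integral_cmult_indicator[OF \<Omega>m])
      also have "\<dots> < \<infinity>"
        unfolding infinity_ennreal_def ennreal_mult_less_top
        using fmeasurableD2[OF bounded_set_imp_lmeasurable[OF \<Omega>(2) \<Omega>m], unfolded less_top] ennreal_less_top by blast
      finally show ?thesis .
    qed
    have fin: "x < \<infinity> \<Longrightarrow> epowr x r < \<infinity>" for x r by (auto simp: epowr_def)
    have "Wsp_norm s p \<Omega> u < \<infinity>"
      unfolding Wsp_norm_def Lp_norm_def Wsp_seminorm_eq[OF p(1)]
    proof (rule fin)
      show "epowr (epowr (energy_on p u \<Omega>) (1 / p)) p +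
          epowr (epowr (\<integral>\<^sup>+x\<in>\<Omega>. ennreal (\<bar>u x\<bar> powr p) \<partial>lebesgue) (1 / p)) p < \<infinity>"
        using fin[OF fin[OF 1]] fin[OF fin[OF 2]] by (simp only: infinity_ennreal_def ennreal_add_less_top)
    qed
    moreover have "u \<in> borel_measurable (lebesgue_on \<Omega>)"
      using u_meas by (rule measurable_restrict_space1)
    ultimately show ?thesis by (simp add: Wsp_def)
  qed
  moreover have "\<exists>\<phi>\<in>Cc_infinity (\<Omega> - K). Wsp_norm s p \<Omega> (\<lambda>x. u x - \<phi> x) < ennreal \<epsilon>" if "0 < \<epsilon>" for \<epsilon>
    using p0 that by (intro bexI[OF _ Cc])
      (simp add: Wsp_norm_def Lp_norm_def Wsp_seminorm_eq[OF p(1)] gagliardo_def epowr_def)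
  ultimately have "u \<in> Wsp0 s p \<Omega> K" by (simp add: Wsp0_def)
  moreover have "zero_ext \<Omega> K u = u" using u0 by (auto simp: zero_ext_def)
  ultimately show "u \<in> Wsp0_tilde s p \<Omega> K" unfolding Wsp0_tilde_def by (metis imageI)
qed

text \<open>The polynomial that is subtracted is negligible against the exponential.\<close>

lemma Phi_ge_half_exp:
  assumes "1 < real d / s"
  shows "eventually (\<lambda>t. exp t / 2 \<le> Phi d s t) at_top"
proof -
  define m where "m = (LEAST j::nat. real j \<ge> real d / s) - 1"
  have "((\<lambda>t::real. \<Sum>i<m. (t ^ i / exp t) / fact i) \<longlongrightarrow> (\<Sum>i<m. 0 / fact i)) at_top"
    by (intro tendsto_sum tendsto_divide tendsto_power_div_exp_0 tendsto_const) auto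
  then have "eventually (\<lambda>t::real. (\<Sum>i<m. (t ^ i / exp t) / fact i) < 1 / 2) at_top"
    by (intro order_tendstoD(2)) auto
  then show ?thesis
    using eventually_ge_at_top[of 0]
  proof eventually_elim
    fix t :: real assume t: "(\<Sum>i<m. (t ^ i / exp t) / fact i) < 1 / 2" "0 \<le> t"
    have "(\<Sum>i<m. t ^ i / fact i) = exp t * (\<Sum>i<m. (t ^ i / exp t) / fact i)"
      by (simp add: sum_distrib_left)
    also have "\<dots> \<le> exp t * (1 / 2)" using t by (intro mult_left_mono) auto
    finally show "exp t / 2 \<le> Phi d s t"
      using Phi_bounds(5)[OF assms t(2)] by (simp add: m_def)
  qed
qed

text \<open>With \<open>T = ln(R / a)\<close>, the normalised bump is at least \<open>(T - 2) / (T \<gamma>)\<^sup>1\<^sup>/\<^sup>p\<close> on the ball of radius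
  \<open>a = R exp(- T)\<close>, and the exponential of \<open>\<theta> T\<close> below beats the volume \<open>exp(- d T)\<close> because
  \<open>\<theta> T / T\<close> tends to \<open>\<beta> > d\<close>.\<close>

lemma TM_sup_infinite_above_alpha_upper:
  fixes \<Omega> K :: "(real^'d) set"
  assumes \<Omega>: "open \<Omega>" "bounded \<Omega>" "\<Omega> \<noteq> {}" and K: "compact K" "K \<noteq> {}" "negligible K"
    and d: "1 < CARD('d)"
    and s: "0 < s" "s < 1" "s * p = real CARD('d)" and \<alpha>: "alpha_upper CARD('d) s < \<alpha>"
  shows "TM_sup s p \<alpha> \<Omega> K = \<infinity>"
proof -
  let ?d = "CARD('d)"
  define \<gamma> where "\<gamma> = energy_const ?d p"
  have pd: "p = real ?d / s" using s by (simp add: field_simps)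
  have dp: "real ?d < p"
  proof -
    have "real ?d / 1 < real ?d / s" using s by (intro divide_strict_left_mono) auto
    then show ?thesis by (simp add: pd)
  qed
  have p1: "1 < p" using dp d by linarith
  have \<gamma>: "0 < \<gamma>" unfolding \<gamma>_def by (rule energy_const_pos[OF dp]) simp
  have expo: "real ?d / (real ?d - s) = p / (p - 1)" "s / (real ?d - s) = 1 / (p - 1)"
    using s p1 by (simp_all add: s(3)[symmetric] field_simps)
  define \<beta> where "\<beta> = \<alpha> / \<gamma> powr (1 / (p - 1))"
  have \<beta>: "real ?d < \<beta>"
  proof -
    have "alpha_upper ?d s = real ?d * \<gamma> powr (1 / (p - 1))"
      by (simp only: alpha_upper_def Let_def \<gamma>_def energy_const_def pd[symmetric] expo(2))
    then show ?thesis using \<alpha> \<gamma> by (simp add: \<beta>_def pos_less_divide_eq)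
  qed
  obtain x0 R where R: "0 < R" "cball x0 R \<subseteq> \<Omega> - K"
  proof -
    have "\<not> \<Omega> \<subseteq> K" using \<Omega>(1,3) K(3) negligible_subset open_not_negligible by blast
    then obtain x0 where "x0 \<in> \<Omega> - K" by blast
    moreover have "open (\<Omega> - K)" using \<Omega>(1) K(1) by (intro open_Diff compact_imp_closed)
    ultimately show ?thesis using that open_contains_cball by blast
  qed
  obtain M where M: "0 < M" "\<And>x. x \<in> \<Omega> \<Longrightarrow> infdist x K \<le> M"
  proof -
    obtain k where k: "k \<in> K" using K(2) by blast
    obtain e where e: "\<And>x. x \<in> \<Omega> \<Longrightarrow> dist k x \<le> e" using \<Omega>(2) unfolding bounded_any_center[of \<Omega> k] by blast
    have "infdist x K \<le> max 1 e" if "x \<in> \<Omega>" for x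
      using infdist_le[OF k, of x] e[OF that] by (simp add: dist_commute)
    then show ?thesis by (intro that[of "max 1 e"]) auto
  qed
  define c where "c = unit_ball_vol ?d * R ^ ?d / (2 * M ^ ?d)"
  have c: "0 < c" using R M by (simp add: c_def)
  define \<theta> where "\<theta> = (\<lambda>T::real. \<alpha> * ((T - 2) / (T * \<gamma>) powr (1 / p)) powr (p / (p - 1)))"
  have \<theta>_eq: "\<theta> T = T * (\<beta> * (1 - 2 / T) powr (p / (p - 1)))" if "2 < T" for T
  proof -
    have e: "(1 / p) * (p / (p - 1)) = 1 / (p - 1)" "p / (p - 1) = 1 + 1 / (p - 1)" using p1 by (simp_all add: field_simps)
    have "((T - 2) / (T * \<gamma>) powr (1 / p)) powr (p / (p - 1)) =
        (T * (1 - 2 / T)) powr (p / (p - 1)) / (T * \<gamma>) powr (1 / (p - 1))"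
    proof -
      have t2: "T - 2 = T * (1 - 2 / T)" using that by (simp add: field_simps)
      have "((T - 2) / (T * \<gamma>) powr (1 / p)) powr (p / (p - 1)) =
          (T - 2) powr (p / (p - 1)) / ((T * \<gamma>) powr (1 / p)) powr (p / (p - 1))"
        using that by (intro powr_divide)
      then show ?thesis unfolding powr_powr e(1) t2[symmetric] .
    qed
    also have "\<dots> = T powr (p / (p - 1)) * (1 - 2 / T) powr (p / (p - 1)) / (T powr (1 / (p - 1)) * \<gamma> powr (1 / (p - 1)))"
      using that \<gamma> by (subst (1 2) powr_mult) auto
    also have "T powr (p / (p - 1)) = T * T powr (1 / (p - 1))"
      unfolding e(2) using that by (simp add: powr_add)
    finally show ?thesis using that by (simp add: \<theta>_def \<beta>_def)
  qed
  have lower: "ennreal (c * exp (\<theta> T - real ?d * T)) \<le> TM_sup s p \<alpha> \<Omega> K"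
    if T: "2 < T" "\<forall>t\<ge>\<theta> T. exp t / 2 \<le> Phi ?d s t" for T
  proof -
    define a where "a = R * exp (- T)"
    have a: "0 < a" "a < R" using R T by (simp_all add: a_def)
    have "a * exp T = R" by (simp add: a_def mult.assoc flip: exp_add)
    then have "R / a = exp T" using a by (simp add: field_simps)
    then have lnRa: "ln (R / a) = T" by simp
    define q where "q = (T * \<gamma>) powr (1 / p)"
    have q: "0 < q" using T \<gamma> by (simp add: q_def)
    define u where "u = (\<lambda>x. 1 / q * log_bump x0 a R x)"
    have u: "u \<in> Wsp0_tilde s p \<Omega> K" "Wsp_seminorm s p UNIV u \<le> 1"
      using log_bump_in_Wsp0_tilde[OF \<Omega>(1,2) R(2) a s(3) dp] unfolding lnRa u_def q_def \<gamma>_def by auto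
    have aR: "ball x0 a \<subseteq> cball x0 R" using a by (auto simp: dist_norm)
    have pw: "ennreal (exp (\<theta> T) / 2 / M ^ ?d) * indicator (ball x0 a) x \<le>
        ennreal (Phi ?d s (\<alpha> * \<bar>u x\<bar> powr (real ?d / (real ?d - s))) / infdist x K ^ ?d) * indicator \<Omega> x" for x
    proof (cases "x \<in> ball x0 a")
      case True
      then have x: "x \<in> \<Omega>" "x \<notin> K" using aR R(2) by auto
      have \<delta>: "0 < infdist x K"
        using x(2) in_closed_iff_infdist_zero[OF compact_imp_closed[OF K(1)] K(2), of x] infdist_nonneg[of x K] by auto
      have "(T - 2) / q \<le> u x"
        using log_bump_bounds(3)[OF a True] q unfolding lnRa u_def by (simp add: divide_right_mono)
      moreover have "0 \<le> (T - 2) / q" using T q by simp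
      ultimately have "((T - 2) / q) powr (p / (p - 1)) \<le> \<bar>u x\<bar> powr (p / (p - 1))"
        using p1 by (intro powr_mono2) auto
      moreover have "0 \<le> \<alpha>"
      proof -
        have "0 < \<beta>" using \<beta> by (meson le_less_trans of_nat_0_le_iff)
        then show ?thesis using \<gamma> by (simp add: \<beta>_def zero_less_divide_iff)
      qed
      ultimately have le: "\<theta> T \<le> \<alpha> * \<bar>u x\<bar> powr (p / (p - 1))"
        unfolding \<theta>_def q_def by (intro mult_left_mono)
      then have "exp (\<theta> T) / 2 \<le> exp (\<alpha> * \<bar>u x\<bar> powr (p / (p - 1))) / 2" by simp
      also have "\<dots> \<le> Phi ?d s (\<alpha> * \<bar>u x\<bar> powr (p / (p - 1)))" using T(2) le by blast
      finally have Phi: "exp (\<theta> T) / 2 \<le> Phi ?d s (\<alpha> * \<bar>u x\<bar> powr (p / (p - 1)))" .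
      have "infdist x K ^ ?d \<le> M ^ ?d" using M(2)[OF x(1)] \<delta> by (intro power_mono) auto
      moreover have "0 \<le> Phi ?d s (\<alpha> * \<bar>u x\<bar> powr (p / (p - 1)))" using Phi by (rule order_trans[rotated]) simp
      ultimately have "exp (\<theta> T) / 2 / M ^ ?d \<le> Phi ?d s (\<alpha> * \<bar>u x\<bar> powr (p / (p - 1))) / infdist x K ^ ?d"
        using Phi \<delta> M(1) by (intro frac_le) auto
      then show ?thesis using True x(1) by (simp add: expo(1) ennreal_leI)
    qed simp
    have "ennreal (c * exp (\<theta> T - real ?d * T)) = ennreal (exp (\<theta> T) / 2 / M ^ ?d) * ennreal (unit_ball_vol ?d * a ^ ?d)"
    proof -
      have e: "exp (\<theta> T - real ?d * T) = exp (\<theta> T) * exp (- (real ?d * T))" by (simp flip: exp_add)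
      have "a ^ ?d = R ^ ?d * exp (- (real ?d * T))"
        by (simp add: a_def power_mult_distrib exp_of_nat_mult[symmetric])
      then have "c * exp (\<theta> T - real ?d * T) = exp (\<theta> T) / 2 / M ^ ?d * (unit_ball_vol ?d * a ^ ?d)"
        unfolding e c_def by simp
      moreover have "ennreal (exp (\<theta> T) / 2 / M ^ ?d * (unit_ball_vol ?d * a ^ ?d)) =
          ennreal (exp (\<theta> T) / 2 / M ^ ?d) * ennreal (unit_ball_vol ?d * a ^ ?d)"
        by (rule ennreal_mult) (use M a in auto)
      ultimately show ?thesis by simp
    qed
    also have "\<dots> = (\<integral>\<^sup>+x. ennreal (exp (\<theta> T) / 2 / M ^ ?d) * indicator (ball x0 a) x \<partial>lebesgue)"
      using a by (subst nn_integral_cmult_indicator) (auto simp: emeasure_ball)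
    also have "\<dots> \<le> TM_integral s \<alpha> \<Omega> K u"
      unfolding TM_integral_def Let_def by (intro nn_integral_mono pw)
    also have "\<dots> \<le> TM_sup s p \<alpha> \<Omega> K"
      unfolding TM_sup_def using u by (intro SUP_upper) auto
    finally show ?thesis .
  qed
  \<comment> \<open>Half of the excess of \<open>\<beta>\<close> over \<open>d\<close> is kept as exponential rate.\<close>
  define \<eta> where "\<eta> = (\<beta> - real ?d) / 2"
  have \<eta>: "0 < \<eta>" using \<beta> by (simp add: \<eta>_def)
  have "((\<lambda>T::real. \<beta> * (1 - 2 / T) powr (p / (p - 1))) \<longlongrightarrow> \<beta> * (1 - 0) powr (p / (p - 1))) at_top"
    by (intro tendsto_intros tendsto_divide_0[OF tendsto_const] filterlim_at_top_imp_at_infinity filterlim_ident) auto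
  then have ev1: "eventually (\<lambda>T::real. real ?d + \<eta> < \<beta> * (1 - 2 / T) powr (p / (p - 1))) at_top"
    using \<beta> by (intro order_tendstoD(1)) (auto simp: \<eta>_def field_simps)
  have ev: "eventually (\<lambda>T::real. 2 < T \<and> (real ?d + \<eta>) * T \<le> \<theta> T) at_top"
    using ev1 eventually_gt_at_top[of 2]
  proof eventually_elim
    fix T :: real assume "real ?d + \<eta> < \<beta> * (1 - 2 / T) powr (p / (p - 1))" "2 < T"
    then show "2 < T \<and> (real ?d + \<eta>) * T \<le> \<theta> T" by (simp add: \<theta>_eq mult.commute)
  qed
  obtain t0 where t0: "\<And>t. t0 \<le> t \<Longrightarrow> exp t / 2 \<le> Phi ?d s t"
    using Phi_ge_half_exp[of ?d s] p1 unfolding pd[symmetric] eventually_at_top_linorder by blast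
  have big: "ennreal b \<le> TM_sup s p \<alpha> \<Omega> K" for b
  proof -
    have "filterlim (\<lambda>T. c * exp (\<eta> * T)) at_top at_top"
      using c \<eta> by (intro filterlim_tendsto_pos_mult_at_top[OF tendsto_const] filterlim_compose[OF exp_at_top] filterlim_ident) auto
    then have "eventually (\<lambda>T. b \<le> c * exp (\<eta> * T)) at_top" by (simp add: filterlim_at_top)
    then have "eventually (\<lambda>T. (2 < T \<and> (real ?d + \<eta>) * T \<le> \<theta> T) \<and> b \<le> c * exp (\<eta> * T) \<and> max t0 0 \<le> T) at_top"
      by (rule eventually_conj[OF ev eventually_conj[OF _ eventually_ge_at_top]])
    then obtain T where T: "2 < T" "(real ?d + \<eta>) * T \<le> \<theta> T" "b \<le> c * exp (\<eta> * T)" "max t0 0 \<le> T"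
      using eventually_happens trivial_limit_at_top_linorder by blast
    have "1 * T \<le> (real ?d + \<eta>) * T" using T \<eta> d by (intro mult_right_mono) auto
    then have "t0 \<le> \<theta> T" using T(2,4) by linarith
    then have "\<forall>t\<ge>\<theta> T. exp t / 2 \<le> Phi ?d s t" using t0 by auto
    then have "ennreal (c * exp (\<theta> T - real ?d * T)) \<le> TM_sup s p \<alpha> \<Omega> K" by (rule lower[OF T(1)])
    moreover have "c * exp (\<eta> * T) \<le> c * exp (\<theta> T - real ?d * T)"
      using T(2) c by (simp add: algebra_simps)
    ultimately show ?thesis using T(3) by (meson ennreal_leI order_trans)
  qed
  show ?thesis
  proof (cases "TM_sup s p \<alpha> \<Omega> K")
    case (real r)
    then have "ennreal (r + 1) \<le> ennreal r" using big[of "r + 1"] by simp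
    then show ?thesis using real by (simp add: ennreal_le_iff)
  qed simp
qed

theorem theorem1:
  fixes \<Omega> K :: "(real^'d) set" and k :: nat and s p :: real
  assumes "1 < k" and "k < CARD('d)"
    and "bounded_Lipschitz_domain \<Omega>"
    and "compact K" and "K \<noteq> {}" and "K \<subseteq> \<Omega>" and "C01_codim k \<Omega> K"
    and "p > 1" and "0 < s" and "s < 1" and "s * p = real CARD('d)"
  shows "(\<exists>\<alpha>0>0. \<forall>\<alpha>. 0 \<le> \<alpha> \<and> \<alpha> < \<alpha>0 \<longrightarrow> TM_sup s p \<alpha> \<Omega> K < \<infinity>) \<and>
         (\<forall>\<alpha>. alpha_upper CARD('d) s < \<alpha> \<longrightarrow> TM_sup s p \<alpha> \<Omega> K = \<infinity>)"
proof -
  have \<Omega>: "open \<Omega>" "bounded \<Omega>" "\<Omega> \<noteq> {}" using assms(3) by (auto simp: bounded_Lipschitz_domain_def)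
  have k: "0 < k" "1 < CARD('d)" using assms(1,2) by auto
  show ?thesis
  proof (intro conjI allI impI)
    show "\<exists>\<alpha>0>0. \<forall>\<alpha>. 0 \<le> \<alpha> \<and> \<alpha> < \<alpha>0 \<longrightarrow> TM_sup s p \<alpha> \<Omega> K < \<infinity>"
      by (rule TM_sup_finite_small_exponent[OF k(1) assms(2) \<Omega>(1,2) assms(4-8,11,9)])
    fix \<alpha> assume "alpha_upper CARD('d) s < \<alpha>"
    then show "TM_sup s p \<alpha> \<Omega> K = \<infinity>"
      by (rule TM_sup_infinite_above_alpha_upper[OF \<Omega> assms(4,5) negligible_C01_codim[OF assms(7) k(1)] k(2) assms(9-11)])
  qed
qed

end
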